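(* For all non-negative integers $y,t,a,x$, the number $\operatorname{CSTC}(\mathcal{H}_{2t,y}(2a,2x))$ of lozenge tilings of $\mathcal{H}_{2t,y}(2a,2x)$ that are invariant under rotation by $120^\circ$ about the center and under reflection across the vertical symmetry axis equals $P_1(x+1,y,t-y-1,a)$.
   Context: Triangular lattice with horizontal lattice lines; hexagon side lengths listed clockwise from the northwestern side. For non-negative integers $x,y,a,t$, $\mathcal{H}_{t,y}(a,x)$ is obtained from the hexagon with side lengths $t+x+3a,\ t,\ t+x+3a,\ t,\ t+x+3a,\ t$ by removing an up-pointing triangle of side $x$ from the center and three up-pointing triangles of side $a$ placed along the segments from the center to the midpoints of the southern, northeastern and northwestern sides, with distance $2y$ from the central hole to each satellite hole. Pochhammer: $(x)_n=x(x+1)\cdots(x+n-1)$ ($n>0$), $(x)_0=1$, $(x)_{-n}=1/((x-1)\cdots(x-n))$. Skipped Pochhammer: $[x]_n=x(x+2)\cdots(x+2n-2)$ ($n>0$), $[x]_0=1$, $[x]_n=1/((x-2)(x-4)\cdots(x+2n))$ ($n<0$). \begin{align*} P_1(x,y,z,a)&=\frac{1}{2^{y+z}}\prod_{i=1}^{y+z}\frac{(2x+6a+2i)_i[2x+6a+4i+1]_{i-1}}{(i)_i[2x+6a+2i+1]_{i-1}}\\ &\times\prod_{i=1}^{a}\frac{(z+i)_{y+a-2i+1}(x+y+2z+2a+2i)_{2y+2a-4i+2}(x+3i-2)_{y-i+1}(x+3y+2i-1)_{i-1}}{(i)_y(y+2z+2i-1)_{y+2a-4i+3}(2z+2i)_{y+2a-4i+1}(x+y+z+2a+i)_{y+a-2i+1}}.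 \end{align*}
   Formalization: The formal theorem assumes y < t: at t = y = a = 0 there is one tiling but the formula gives 2, for y = t ≥ 1 and a ≥ 1 the formula has a zero denominator, and for y > t, a ≥ 1 the satellites leave the hexagon; for a = 0 the value of y is irrelevant. *)

theory Defs
  imports Complex_Main
begin

definition poch :: "rat \<Rightarrow> int \<Rightarrow> rat" where
  "poch x n = (if n \<ge> 0 then (\<Prod>k<nat n. x + of_nat k)
               else 1 / (\<Prod>k\<in>{1..nat (- n)}. x - of_nat k))"

definition spoch :: "rat \<Rightarrow> int \<Rightarrow> rat" where
  "spoch x n = (if n \<ge> 0 then (\<Prod>k<nat n. x + 2 * of_nat k)
               else 1 / (\<Prod>k\<in>{1..nat (- n)}. x - 2 * of_nat k))"

definition P1 :: "nat \<Rightarrow> nat \<Rightarrow> nat \<Rightarrow> nat \<Rightarrow> rat" where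
  "P1 x y z a =
    (1 / 2 ^ (y + z)) *
    (\<Prod>i\<in>{1..y+z}.
       (poch (2*of_nat x + 6*of_nat a + 2*of_nat i) (int i)
        * spoch (2*of_nat x + 6*of_nat a + 4*of_nat i + 1) (int i - 1))
     / (poch (of_nat i) (int i)
        * spoch (2*of_nat x + 6*of_nat a + 2*of_nat i + 1) (int i - 1))) *
    (\<Prod>i\<in>{1..a}.
       (poch (of_nat z + of_nat i) (int y + int a - 2*int i + 1)
        * poch (of_nat x + of_nat y + 2*of_nat z + 2*of_nat a + 2*of_nat i)
               (2*int y + 2*int a - 4*int i + 2)
        * poch (of_nat x + 3*of_nat i - 2) (int y - int i + 1)
        * poch (of_nat x + 3*of_nat y + 2*of_nat i - 1) (int i - 1))
     / (poch (of_nat i) (int y)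
        * poch (of_nat y + 2*of_nat z + 2*of_nat i - 1) (int y + 2*int a - 4*int i + 3)
        * poch (2*of_nat z + 2*of_nat i) (int y + 2*int a - 4*int i + 1)
        * poch (of_nat x + of_nat y + of_nat z + 2*of_nat a + of_nat i)
               (int y + int a - 2*int i + 1)))"

text \<open>
  We use three families of lattice lines h1 = const, h2 = const, h3 = const
  (integers), where h1,h2,h3 are affine functions on the plane with
  h1 + h2 + h3 = L (a fixed integer depending on the region);
  the lines h1 = const are the horizontal ones, h1 increasing upwards.
  A unit triangle is the open set {p. u_k - 1 < h_k(p) < u_k, k=1,2,3}
  for an integer triple u = (u1,u2,u3); it is nonempty iff
  u1+u2+u3 \<in> {L+1, L+2} (L+2: up-pointing, L+1: down-pointing).
  Two unit triangles share an edge iff their triples differ by 1 in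
  exactly one coordinate.  Rotation by 120 degrees about the point
  h1=h2=h3=L/3 permutes the coordinates cyclically; the reflection in the
  vertical line through that point swaps h2 and h3.\<close>

type_synonym tri = "int \<times> int \<times> int"

definition adj :: "tri \<Rightarrow> tri \<Rightarrow> bool" where
  "adj p q = (case p of (a,b,c) \<Rightarrow> case q of (a',b',c') \<Rightarrow>
      (\<bar>a - a'\<bar> = 1 \<and> b = b' \<and> c = c') \<or>
      (a = a' \<and> \<bar>b - b'\<bar> = 1 \<and> c = c') \<or>
      (a = a' \<and> b = b' \<and> \<bar>c - c'\<bar> = 1))"

definition lozenge_tilings :: "tri set \<Rightarrow> tri set set set" where
  "lozenge_tilings R = {T. (\<forall>e\<in>T. \<exists>p q. e = {p, q} \<and> p \<in> R \<and> q \<in> R \<and> adj p q)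
                          \<and> (\<forall>p\<in>R. \<exists>!e\<in>T. p \<in> e)}"

definition rot120 :: "tri \<Rightarrow> tri" where
  "rot120 u = (case u of (a,b,c) \<Rightarrow> (b,c,a))"

definition vrefl :: "tri \<Rightarrow> tri" where
  "vrefl u = (case u of (a,b,c) \<Rightarrow> (a,c,b))"

definition invariant_under :: "(tri \<Rightarrow> tri) \<Rightarrow> tri set set \<Rightarrow> bool" where
  "invariant_under f T = ((\<lambda>e. f ` e) ` T = T)"

text \<open>
  Here L = 3t + x + 3a.  The hexagon with sides t+x+3a, t, t+x+3a, t, t+x+3a, t
  (clockwise from the NW side) is the up-pointing triangle {h_k \<ge> 0} of side
  L with its three corners of side t cut off, i.e. {0 \<le> h_k \<le> L - t}.
  Its center is h1=h2=h3=L/3.  The central up-pointing hole of side x is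
  {h_k \<ge> t + a} (all k).  The satellite hole of side a towards the long side
  h_k = 0 (k = 1: southern side, the others: NE/NW sides) is the up-pointing
  triangle symmetric about the axis through the center perpendicular to that
  side, whose vertex pointing to the central hole is at (line) distance 2y from
  the side h_k = t + a of the central hole:
  {h_k \<ge> t - 2y, h_j \<ge> t + a + y + x/2 (j \<noteq> k)}.
  (This is a lattice triangle when x is even, which is the only case used.)\<close>

definition in_sat :: "nat \<Rightarrow> nat \<Rightarrow> nat \<Rightarrow> nat \<Rightarrow> int \<Rightarrow> int \<Rightarrow> int \<Rightarrow> bool" where
  "in_sat t y a x uk uj ul =
     (uk \<ge> int t - 2 * int y + 1 \<and>
      2 * (uj - 1) \<ge> 2 * int t + 2 * int a + 2 * int y + int x \<and>
      2 * (ul - 1) \<ge> 2 * int t + 2 * int a + 2 * int y + int x)"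

definition regionH :: "nat \<Rightarrow> nat \<Rightarrow> nat \<Rightarrow> nat \<Rightarrow> tri set" where
  "regionH t y a x =
    {(u1,u2,u3). let L = 3 * int t + int x + 3 * int a in
       (u1 + u2 + u3 = L + 1 \<or> u1 + u2 + u3 = L + 2)
       \<and> 1 \<le> u1 \<and> u1 \<le> L - int t
       \<and> 1 \<le> u2 \<and> u2 \<le> L - int t
       \<and> 1 \<le> u3 \<and> u3 \<le> L - int t
       \<and> \<not> (u1 \<ge> int t + int a + 1 \<and> u2 \<ge> int t + int a + 1 \<and> u3 \<ge> int t + int a + 1)
       \<and> \<not> in_sat t y a x u1 u2 u3
       \<and> \<not> in_sat t y a x u2 u3 u1
       \<and> \<not> in_sat t y a x u3 u1 u2}"

definition CSTC :: "tri set \<Rightarrow> nat" where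
  "CSTC R = card {T \<in> lozenge_tilings R. invariant_under rot120 T \<and> invariant_under vrefl T}"

end

theory Submission
  imports Defs "Jordan_Normal_Form.Determinant"
begin

text \<open>
  In a tiling with both symmetries the lozenges along the symmetry axes are forced, and the tiling is
  determined by its part in one of the six sectors cut out by the axes. There, following the lozenges
  across the edges of one direction gives \<open>t\<close> non-intersecting lattice paths, so the count is a
  determinant. Prolonging the paths backwards to the wall of the sector turns its entries into ballot
  numbers \<open>ballot x R k\<close>, with \<open>t\<close> consecutive rows and with \<open>t\<close> of the columns \<open>0, \<dots>, t + a - 1\<close>;
  the \<open>a\<close> omitted consecutive columns come from the satellite. Dodgson condensation at the two columns
  next to this gap relates such determinants to smaller ones of the same kind, and condensation at
  the first and last column evaluates the determinants without gap. Since
  \<open>ballot x (R + 2) (k + 1) = ballot (x + 3) R k\<close>, all the minors which occur belong to these two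
  families, whose product formulas therefore follow by induction.
\<close>

section \<open>Determinants indexed by lists of rows and columns\<close>

text \<open>The end points lie on different levels, which shapes the passage from tilings to
  determinants: instead of a sign-reversing involution on path systems, the count and the
  determinant are split together, one path step at a time, a row being the sum of the rows of its
  two successors. Two colliding paths give two equal rows, a missed end point gives a zero column.
  The row range of the determinants with a gap makes the last row number twice the last column
  number. The last column then has 1 as its only nonzero entry and can be deleted with the last row.
  This brings those minors back into the family whose first row number is one too large for their
  order, and it is why the condensation closes up. Condensation divides by an inner minor; it is
  nonzero because the closed forms are quotients of products of factorials, hence positive. The
  sizes \<open>2*t\<close>, \<open>2*a\<close>, \<open>2*x\<close> are even, so a symmetry axis
  enters and leaves the holes and the outer boundary between two forced lozenges, never through
  one.\<close>

definition dt :: "('a \<Rightarrow> 'b \<Rightarrow> rat) \<Rightarrow> 'a list \<Rightarrow> 'b list \<Rightarrow> rat" where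
  "dt f rs cs = det (mat (length rs) (length rs) (\<lambda>(i,j). f (rs ! i) (cs ! j)))"

lemma dt_Nil [simp]: "dt f [] cs = 1"
  by (simp add: dt_def)

lemma dt_single [simp]: "dt f [r] [c] = f r c"
  by (simp add: dt_def det_single)

lemma dt_cong:
  assumes "length rs = length cs"
    "\<And>i j. i < length cs \<Longrightarrow> j < length cs \<Longrightarrow> f (rs ! i) (cs ! j) = g (rs' ! i) (cs' ! j)"
    "length rs' = length rs"
  shows "dt f rs cs = dt g rs' cs'"
  unfolding dt_def using assms by (intro arg_cong[of _ _ det]) (auto intro!: eq_matI)

lemma dt_map_rows: "dt f (map h rs) cs = dt (\<lambda>r. f (h r)) rs cs"
  unfolding dt_def by (intro arg_cong[of _ _ det]) (auto intro!: eq_matI)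

lemma dt_transpose: "length rs = length cs \<Longrightarrow> dt f rs cs = dt (\<lambda>c r. f r c) cs rs"
  unfolding dt_def
  by (subst det_transpose[symmetric, where n = "length rs"])
     (auto intro!: arg_cong[of _ _ det] eq_matI)

lemma dt_append_four_block:
  assumes "length rs = length cs" "length ps = length qs"
  shows "dt f (rs @ ps) (cs @ qs) = det (four_block_mat
     (mat (length rs) (length rs) (\<lambda>(i,j). f (rs ! i) (cs ! j)))
     (mat (length rs) (length ps) (\<lambda>(i,j). f (rs ! i) (qs ! j)))
     (mat (length ps) (length rs) (\<lambda>(i,j). f (ps ! i) (cs ! j)))
     (mat (length ps) (length ps) (\<lambda>(i,j). f (ps ! i) (qs ! j))))"
  unfolding dt_def using assms
  by (intro arg_cong[of _ _ det] eq_matI) (auto simp: nth_append)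

lemma dt_append_block_triangular:
  assumes "length rs = length cs" "length ps = length qs"
    and "\<And>r c. r \<in> set rs \<Longrightarrow> c \<in> set qs \<Longrightarrow> f r c = 0"
  shows "dt f (rs @ ps) (cs @ qs) = dt f rs cs * dt f ps qs"
  unfolding dt_append_four_block[OF assms(1,2)]
  by (subst det_four_block_mat_upper_right_zero[where n = "length rs" and m = "length ps"])
     (use assms in \<open>auto simp: dt_def intro!: eq_matI\<close>)

lemma dt_swap_rows:
  assumes "length xs + length zs + 2 = length cs"
  shows "dt f (xs @ a # b # zs) cs = - dt f (xs @ b # a # zs) cs"
proof -
  let ?n = "length cs" and ?k = "length xs"
  let ?A = "mat ?n ?n (\<lambda>(i,j). f ((xs @ b # a # zs) ! i) (cs ! j))"
  have "dt f (xs @ a # b # zs) cs = det (swaprows ?k (Suc ?k) ?A)"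
    unfolding dt_def using assms
    by (intro arg_cong[of _ _ det] eq_matI)
       (auto simp: nth_append nth_Cons' mat_swaprows_def)
  also have "\<dots> = - det ?A"
    by (rule det_swaprows[of _ ?n]) (use assms in auto)
  finally show ?thesis using assms by (simp add: dt_def)
qed

lemma dt_equal_adjacent_rows:
  assumes "length xs + length zs + 2 = length cs" "\<And>c. c \<in> set cs \<Longrightarrow> f a c = f b c"
  shows "dt f (xs @ a # b # zs) cs = 0"
proof -
  let ?n = "length cs" and ?k = "length xs"
  let ?A = "mat ?n ?n (\<lambda>(i,j). f ((xs @ a # b # zs) ! i) (cs ! j))"
  have "det ?A = 0"
    by (rule det_identical_rows[of _ ?n ?k "Suc ?k"])
       (use assms in \<open>auto simp: nth_append intro!: eq_vecI\<close>)
  then show ?thesis using assms by (simp add: dt_def)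
qed

lemma dt_move_row:
  assumes "length xs + length ys + length zs + 1 = length cs"
  shows "dt f (xs @ a # ys @ zs) cs = (-1) ^ length ys * dt f (xs @ ys @ a # zs) cs"
  using assms
proof (induction ys arbitrary: xs)
  case (Cons b ys)
  have "dt f (xs @ a # (b # ys) @ zs) cs = - dt f (xs @ b # a # ys @ zs) cs"
    using dt_swap_rows[of xs "ys @ zs" cs f a b] Cons.prems by (simp add: add.assoc)
  also have "xs @ b # a # ys @ zs = (xs @ [b]) @ a # ys @ zs" by simp
  also have "dt f \<dots> cs = (-1) ^ length ys * dt f ((xs @ [b]) @ ys @ a # zs) cs"
    by (rule Cons.IH) (use Cons.prems in simp)
  finally show ?case by simp
qed simp

lemma dt_move_column:
  assumes "length xs + length ys + length zs + 1 = length rs"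
  shows "dt f rs (xs @ a # ys @ zs) = (-1) ^ length ys * dt f rs (xs @ ys @ a # zs)"
  using dt_move_row[OF assms, of "\<lambda>c r. f r c" a] assms
    dt_transpose[of rs "xs @ a # ys @ zs" f] dt_transpose[of rs "xs @ ys @ a # zs" f] by simp

lemma dt_row_add:
  assumes len: "length xs + length ys + 1 = length cs"
    and "\<And>c. c \<in> set cs \<Longrightarrow> f a c = f b c + f d c"
  shows "dt f (xs @ a # ys) cs = dt f (xs @ b # ys) cs + dt f (xs @ d # ys) cs"
proof -
  let ?n = "length cs" and ?k = "length xs"
  define c where "c i = vec ?n (\<lambda>j. f ((xs @ a # ys) ! i) (cs ! j))" for i
  let ?v = "\<lambda>r. (\<lambda>i::nat. vec ?n (\<lambda>j. f r (cs ! j)))"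
  have D: "dt f (xs @ r # ys) cs = det (mat\<^sub>r ?n ?n (\<lambda>i. if i = ?k then ?v r i else c i))" for r
    unfolding dt_def using len
    by (intro arg_cong[of _ _ det] eq_matI) (auto simp: nth_append c_def mat_of_rows_def nth_Cons')
  have "det (mat\<^sub>r ?n ?n (\<lambda>i. if i = ?k then ?v b i + ?v d i else c i)) =
     det (mat\<^sub>r ?n ?n (\<lambda>i. if i = ?k then ?v b i else c i)) +
     det (mat\<^sub>r ?n ?n (\<lambda>i. if i = ?k then ?v d i else c i))"
    by (rule det_row_add) (use len in \<open>auto simp: c_def\<close>)
  moreover have "?v a i = ?v b i + ?v d i" for i
    using assms(2) by (intro eq_vecI) auto
  then have "(\<lambda>i. if i = ?k then ?v a i else c i) = (\<lambda>i. if i = ?k then ?v b i + ?v d i else c i)"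
    by (simp add: fun_eq_iff)
  ultimately show ?thesis by (simp add: D)
qed

lemma dt_row_zero:
  assumes len: "length xs + length ys + 1 = length cs"
    and "\<And>c. c \<in> set cs \<Longrightarrow> f a c = 0"
  shows "dt f (xs @ a # ys) cs = 0"
  using dt_row_add[OF len, of f a a a] assms(2) by simp

lemma dt_permuted_unit_rows:
  assumes "length rs = length cs" "\<And>i j. i < length cs \<Longrightarrow> j < length cs \<Longrightarrow> f (rs ! i) (cs ! j) = (if i = j then 1 else 0)"
  shows "dt f rs cs = 1"
proof -
  have "mat (length rs) (length rs) (\<lambda>(i,j). f (rs ! i) (cs ! j)) = 1\<^sub>m (length rs)"
    using assms by (intro eq_matI) auto
  then show ?thesis by (simp add: dt_def)
qed

text \<open>The values of \<open>g\<close> are the entries of the Schur complement of the block \<open>I \<times> C\<close>; they do not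
  depend on which further rows and columns are adjoined.\<close>

lemma dt_schur:
  assumes len: "length I = length C" and nz: "dt f I C \<noteq> 0"
  obtains g where "\<And>ps qs. length ps = length qs \<Longrightarrow> dt f (I @ ps) (C @ qs) = dt f I C * dt g ps qs"
proof -
  let ?n = "length I"
  let ?A = "mat ?n ?n (\<lambda>(i,j). f (I ! i) (C ! j))"
  have A: "?A \<in> carrier_mat ?n ?n" by simp
  have "det ?A \<noteq> 0" using nz by (simp add: dt_def)
  from det_non_zero_imp_unit[OF A this]
  obtain X where X: "X \<in> carrier_mat ?n ?n" "?A * X = 1\<^sub>m ?n"
    by (auto simp: Units_def ring_mat_simps)
  \<comment> \<open>\<open>w c\<close> holds the coefficients of the combination of the columns
    \<open>C\<close> that agrees with the column \<open>c\<close> on the rows \<open>I\<close>;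
    \<open>g\<close> is the part of \<open>c\<close> that this combination misses on another
    row.\<close>
  define w where "w c = X *\<^sub>v vec ?n (\<lambda>i. f (I ! i) c)" for c
  define g where "g r c = f r c - (vec ?n (\<lambda>j. f r (C ! j))) \<bullet> w c" for r c
  have wdim: "dim_vec (w c) = ?n" for c using X by (simp add: w_def)
  have sol: "vec ?n (\<lambda>j. f (I ! i) (C ! j)) \<bullet> w c = f (I ! i) c" if "i < ?n" for i c
  proof -
    have "?A *\<^sub>v w c = (?A * X) *\<^sub>v vec ?n (\<lambda>i. f (I ! i) c)"
      unfolding w_def using X by (intro assoc_mult_mat_vec[symmetric]) auto
    then have "?A *\<^sub>v w c = vec ?n (\<lambda>i. f (I ! i) c)" using X by simp
    moreover have "row ?A i = vec ?n (\<lambda>j. f (I ! i) (C ! j))"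
      using that by (intro eq_vecI) auto
    moreover have "(?A *\<^sub>v w c) $ i = row ?A i \<bullet> w c"
      using that by (intro index_mult_mat_vec) simp
    ultimately show ?thesis using that by simp
  qed
  show ?thesis
  proof (rule that)
    fix ps :: "'a list" and qs :: "'b list" assume l: "length ps = length qs"
    let ?m = "length ps"
    let ?B = "mat ?n ?m (\<lambda>(i,j). f (I ! i) (qs ! j))"
    let ?C = "mat ?m ?n (\<lambda>(i,j). f (ps ! i) (C ! j))"
    let ?D = "mat ?m ?m (\<lambda>(i,j). f (ps ! i) (qs ! j))"
    let ?W = "mat ?n ?m (\<lambda>(i,j). - (w (qs ! j) $ i))"
    let ?G = "mat ?m ?m (\<lambda>(i,j). g (ps ! i) (qs ! j))"
    have sp: "(\<Sum>i = 0..<?n. h i * - (w c $ i)) = - (vec ?n h \<bullet> w c)" for h c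
      by (simp add: scalar_prod_def wdim sum_negf)
    \<comment> \<open>Multiplication by a unitriangular block matrix subtracts these combinations
      from the columns \<open>qs\<close>: the upper right block becomes zero and \<open>g\<close>
      appears below it.\<close>
    have "four_block_mat ?A ?B ?C ?D * four_block_mat (1\<^sub>m ?n) ?W (0\<^sub>m ?m ?n) (1\<^sub>m ?m)
      = four_block_mat (?A * 1\<^sub>m ?n + ?B * 0\<^sub>m ?m ?n) (?A * ?W + ?B * 1\<^sub>m ?m)
         (?C * 1\<^sub>m ?n + ?D * 0\<^sub>m ?m ?n) (?C * ?W + ?D * 1\<^sub>m ?m)"
      by (rule mult_four_block_mat) auto
    also have "?A * 1\<^sub>m ?n + ?B * 0\<^sub>m ?m ?n = ?A" by simp
    also have "?C * 1\<^sub>m ?n + ?D * 0\<^sub>m ?m ?n = ?C" by simp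
    also have "?A * ?W + ?B * 1\<^sub>m ?m = 0\<^sub>m ?n ?m"
    proof (intro eq_matI)
      fix i j assume "i < dim_row (0\<^sub>m ?n ?m)" "j < dim_col (0\<^sub>m ?n ?m)"
      then have ij: "i < ?n" "j < ?m" by auto
      have "(?A * ?W) $$ (i, j) = (\<Sum>k = 0..<?n. f (I ! i) (C ! k) * - (w (qs ! j) $ k))"
        using ij by (simp add: scalar_prod_def)
      also have "\<dots> = - (vec ?n (\<lambda>k. f (I ! i) (C ! k)) \<bullet> w (qs ! j))" by (rule sp)
      finally have "(?A * ?W) $$ (i, j) = - (vec ?n (\<lambda>k. f (I ! i) (C ! k)) \<bullet> w (qs ! j))" .
      then show "(?A * ?W + ?B * 1\<^sub>m ?m) $$ (i, j) = 0\<^sub>m ?n ?m $$ (i, j)"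
        using ij sol[OF ij(1), of "qs ! j"] by (simp del: index_mult_mat(1))
    qed auto
    also have "?C * ?W + ?D * 1\<^sub>m ?m = ?G"
    proof (intro eq_matI)
      fix i j assume "i < dim_row ?G" "j < dim_col ?G"
      then have ij: "i < ?m" "j < ?m" by auto
      have "(?C * ?W) $$ (i, j) = (\<Sum>k = 0..<?n. f (ps ! i) (C ! k) * - (w (qs ! j) $ k))"
        using ij by (simp add: scalar_prod_def)
      also have "\<dots> = - (vec ?n (\<lambda>k. f (ps ! i) (C ! k)) \<bullet> w (qs ! j))" by (rule sp)
      finally have "(?C * ?W) $$ (i, j) = - (vec ?n (\<lambda>k. f (ps ! i) (C ! k)) \<bullet> w (qs ! j))" .
      then show "(?C * ?W + ?D * 1\<^sub>m ?m) $$ (i, j) = ?G $$ (i, j)"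
        using ij by (simp add: g_def del: index_mult_mat(1))
    qed auto
    finally have eq: "four_block_mat ?A ?B ?C ?D * four_block_mat (1\<^sub>m ?n) ?W (0\<^sub>m ?m ?n) (1\<^sub>m ?m)
      = four_block_mat ?A (0\<^sub>m ?n ?m) ?C ?G" .
    have "det (four_block_mat ?A ?B ?C ?D) * det (four_block_mat (1\<^sub>m ?n) ?W (0\<^sub>m ?m ?n) (1\<^sub>m ?m))
      = det (four_block_mat ?A (0\<^sub>m ?n ?m) ?C ?G)"
      unfolding eq[symmetric]
      by (rule det_mult[symmetric, of _ "?n + ?m"]) auto
    also have "det (four_block_mat (1\<^sub>m ?n) ?W (0\<^sub>m ?m ?n) (1\<^sub>m ?m)) = 1"
      by (subst det_four_block_mat_lower_left_zero[of _ ?n _ ?m]) auto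
    also have "det (four_block_mat ?A (0\<^sub>m ?n ?m) ?C ?G) = det ?A * det ?G"
      by (rule det_four_block_mat_upper_right_zero) auto
    finally show "dt f (I @ ps) (C @ qs) = dt f I C * dt g ps qs"
      using len l by (simp add: dt_append_four_block) (simp add: dt_def)
  qed
qed

lemma dt_two: "dt g [p, q] [c, d] = g p c * g q d - g p d * g q c"
proof -
  let ?A = "mat 2 2 (\<lambda>(i,j). g ([p, q] ! i) ([c, d] ! j))"
  have "det ?A = (\<Sum>i<2. ?A $$ (i, 0) * cofactor ?A i 0)"
    by (rule laplace_expansion_column[of _ 2]) auto
  also have "det (mat_delete ?A 0 0) = g q d"
    by (subst det_single) (auto simp: mat_delete_def)
  then have "cofactor ?A 0 0 = g q d" by (simp add: cofactor_def)
  moreover have "det (mat_delete ?A 1 0) = g p d"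
    by (subst det_single) (auto simp: mat_delete_def)
  then have "cofactor ?A 1 0 = - g p d" by (simp add: cofactor_def)
  ultimately have "det ?A = g p c * g q d - g p d * g q c"
    by (simp add: numeral_2_eq_2 lessThan_Suc algebra_simps)
  then show ?thesis by (simp add: dt_def numeral_2_eq_2)
qed

text \<open>The Desnanot-Jacobi identity. All its determinants contain the factor
  \<open>dt f I C\<close>; what remains is the formula for a determinant of order two in the Schur
  complement.\<close>

lemma dodgson_end:
  assumes len: "length I = length C" and nz: "dt f I C \<noteq> 0"
  shows "dt f (I @ [p, q]) (C @ [c, d]) * dt f I C =
    dt f (I @ [p]) (C @ [c]) * dt f (I @ [q]) (C @ [d]) -
    dt f (I @ [p]) (C @ [d]) * dt f (I @ [q]) (C @ [c])"
proof -
  from dt_schur[OF len nz] obtain g where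
    g: "\<And>ps qs. length ps = length qs \<Longrightarrow> dt f (I @ ps) (C @ qs) = dt f I C * dt g ps qs" by blast
  show ?thesis by (simp add: g dt_two algebra_simps)
qed

text \<open>The form used for condensation: the special rows are the outer ones, the special columns
  stand anywhere, in particular on both sides of a gap. Moving them to the end costs the same total
  sign in each of the three products.\<close>

lemma dodgson:
  assumes len: "length I = length X + length Y + length Z" and nz: "dt f I (X @ Y @ Z) \<noteq> 0"
  shows "dt f (p # I @ [q]) (X @ c # Y @ d # Z) * dt f I (X @ Y @ Z) =
    dt f (p # I) (X @ c # Y @ Z) * dt f (I @ [q]) (X @ Y @ d # Z) -
    dt f (p # I) (X @ Y @ d # Z) * dt f (I @ [q]) (X @ c # Y @ Z)"
proof -
  let ?e = "\<lambda>xs. (-1 :: rat) ^ length xs"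
  let ?C = "X @ Y @ Z"
  have row: "dt f (p # I @ ws) cs = ?e I * dt f (I @ p # ws) cs"
    if "length cs = length I + length ws + 1" for ws cs
    using dt_move_row[of "[]" I ws cs f p] that by simp
  have c1: "dt f rs (X @ c # Y @ Z) = ?e (Y @ Z) * dt f rs (?C @ [c])"
    if "length rs = length I + 1" for rs
    using dt_move_column[of X "Y @ Z" "[]" rs f c] that len by simp
  have d1: "dt f rs (X @ Y @ d # Z) = ?e Z * dt f rs (?C @ [d])"
    if "length rs = length I + 1" for rs
    using dt_move_column[of "X @ Y" Z "[]" rs f d] that len by simp
  have cd: "dt f rs (X @ c # Y @ d # Z) = ?e Z * ?e (Y @ Z) * dt f rs (?C @ [c, d])"
    if "length rs = length I + 2" for rs
    using dt_move_column[of "X @ c # Y" Z "[]" rs f d] dt_move_column[of X "Y @ Z" "[d]" rs f c] that len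
    by simp
  have "dt f (p # I @ [q]) (X @ c # Y @ d # Z) * dt f I ?C =
      ?e I * ?e Z * ?e (Y @ Z) * (dt f (I @ [p, q]) (?C @ [c, d]) * dt f I ?C)"
    using row[of "X @ c # Y @ d # Z" "[q]"] cd[of "I @ [p, q]"] len by simp
  also have "dt f (I @ [p, q]) (?C @ [c, d]) * dt f I ?C =
    dt f (I @ [p]) (?C @ [c]) * dt f (I @ [q]) (?C @ [d]) -
    dt f (I @ [p]) (?C @ [d]) * dt f (I @ [q]) (?C @ [c])"
    by (rule dodgson_end) (use len nz in auto)
  also have "?e I * ?e Z * ?e (Y @ Z) * \<dots> =
     dt f (p # I) (X @ c # Y @ Z) * dt f (I @ [q]) (X @ Y @ d # Z) -
     dt f (p # I) (X @ Y @ d # Z) * dt f (I @ [q]) (X @ c # Y @ Z)"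
    using row[of "X @ c # Y @ Z" "[]"] row[of "X @ Y @ d # Z" "[]"]
      c1[of "I @ [p]"] c1[of "I @ [q]"] d1[of "I @ [p]"] d1[of "I @ [q]"] len
    by (simp add: algebra_simps)
  finally show ?thesis .
qed

section \<open>Closed forms\<close>

text \<open>For \<open>s > 0\<close> this is the product of the factorials of \<open>n - s\<close>,
  \<open>n - 2 * s\<close>, ... down to the last non-negative argument; for \<open>s = 1\<close> it
  is the Barnes value G(n + 1). The case \<open>s = 0\<close> is split off to make the recursion
  terminate.\<close>

function sfac :: "nat \<Rightarrow> nat \<Rightarrow> rat" where
  "sfac s n = (if s = 0 \<or> n < s then 1 else sfac s (n - s) * fact (n - s))"
  by auto
termination by (relation "measure snd") auto

declare sfac.simps [simp del]

lemma sfac_small: "n < s \<Longrightarrow> sfac s n = 1"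
  by (subst sfac.simps) simp

lemma sfac_add: "s > 0 \<Longrightarrow> sfac s (n + s) = sfac s n * fact n"
  by (subst sfac.simps) simp

lemma sfac_pos: "sfac s n > 0"
proof (induction n rule: less_induct)
  case (less n)
  then show ?case by (subst sfac.simps) auto
qed

lemma sfac_nonzero [simp]: "sfac s n \<noteq> 0"
  using sfac_pos[of s n] by linarith

lemma sfac_1_Suc: "sfac (Suc 0) (Suc n) = sfac (Suc 0) n * fact n"
  using sfac_add[of "Suc 0" n] by simp

text \<open>The arguments of the parity of \<open>n\<close> and those of the other parity together
  run through all numbers below \<open>n\<close>.\<close>

lemma sfac_2_mult_Suc: "sfac 2 n * sfac 2 (Suc n) = sfac (Suc 0) n"
proof (induction n)
  case (Suc n)
  have "sfac 2 (Suc (Suc n)) = sfac 2 n * fact n"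
    using sfac_add[of 2 n] by simp
  then show ?case using Suc by (simp add: sfac_1_Suc ac_simps)
qed (simp add: sfac_small)

text \<open>\<open>mixed_ratio r a b c d\<close> records a second-order ratio \<open>a b / (c d) = r\<close>. Every factor of the two
  closed forms below has a rational one along the steps of the Dodgson recurrences.\<close>

definition mixed_ratio :: "rat \<Rightarrow> rat \<Rightarrow> rat \<Rightarrow> rat \<Rightarrow> rat \<Rightarrow> bool" where
  "mixed_ratio r a b c d \<longleftrightarrow> a * b = r * (c * d)"

lemma mixed_ratio_mult:
  "mixed_ratio r a b c d \<Longrightarrow> mixed_ratio r' a' b' c' d' \<Longrightarrow>
   mixed_ratio (r * r') (a * a') (b * b') (c * c') (d * d')"
  unfolding mixed_ratio_def by (metis mult.assoc mult.left_commute)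

lemma mixed_ratio_divide:
  "mixed_ratio r a b c d \<Longrightarrow> mixed_ratio r' a' b' c' d' \<Longrightarrow>
   mixed_ratio (r / r') (a / a') (b / b') (c / c') (d / d')"
  unfolding mixed_ratio_def by (simp add: times_divide_times_eq)

lemma mixed_ratio_eq: "mixed_ratio r a b c d \<Longrightarrow> r = r' \<Longrightarrow> mixed_ratio r' a b c d"
  by simp

lemma mixed_ratio_same: "a = c \<Longrightarrow> b = d \<Longrightarrow> mixed_ratio 1 (sfac s a) (sfac s b) (sfac s c) (sfac s d)"
  by (simp add: mixed_ratio_def)

lemma mixed_ratio_swap: "a = d \<Longrightarrow> b = c \<Longrightarrow> mixed_ratio 1 (sfac s a) (sfac s b) (sfac s c) (sfac s d)"
  by (simp add: mixed_ratio_def)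

lemma mixed_ratio_flip:
  assumes "mixed_ratio r a b c d"
  shows "mixed_ratio r b a c d" "mixed_ratio r a b d c" "mixed_ratio r b a d c"
  using assms by (simp_all add: mixed_ratio_def mult.commute)

lemma mixed_ratio_inverse: "mixed_ratio r a b c d \<Longrightarrow> r \<noteq> 0 \<Longrightarrow> mixed_ratio (1 / r) c d a b"
  by (simp add: mixed_ratio_def)

text \<open>In this rule and the next two the outer pair of arguments is compared with the inner
  pair. The superfactorials cancel and a quotient of two factorials, with arguments one or two
  apart, is left.\<close>

lemma mixed_ratio_sfac_1:
  assumes "b = Suc a" "c = Suc a" "d = Suc (Suc a)"
  shows "mixed_ratio (of_nat b) (sfac (Suc 0) a) (sfac (Suc 0) d) (sfac (Suc 0) b) (sfac (Suc 0) c)"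
  using assms by (simp add: mixed_ratio_def sfac_1_Suc)

lemma mixed_ratio_sfac_2:
  assumes "b = Suc a" "c = Suc (Suc a)" "d = Suc (Suc (Suc a))"
  shows "mixed_ratio (of_nat b) (sfac 2 a) (sfac 2 d) (sfac 2 b) (sfac 2 c)"
  using assms sfac_add[of 2 a] sfac_add[of 2 "Suc a"] by (simp add: mixed_ratio_def)

lemma mixed_ratio_sfac_2_wide:
  assumes "b = a + 2" "c = a + 2" "d = a + 4"
  shows "mixed_ratio (of_nat (Suc a) * of_nat b) (sfac 2 a) (sfac 2 d) (sfac 2 b) (sfac 2 c)"
  using assms sfac_add[of 2 a] sfac_add[of 2 "a + 2"]
  by (simp add: mixed_ratio_def numeral_eq_Suc algebra_simps)

lemmas mixed_ratio_leaves =
  mixed_ratio_sfac_1 mixed_ratio_flip(1)[OF mixed_ratio_sfac_1]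
  mixed_ratio_sfac_2 mixed_ratio_flip[OF mixed_ratio_sfac_2]
  mixed_ratio_sfac_2_wide mixed_ratio_flip(1)[OF mixed_ratio_sfac_2_wide]

lemma mixed_ratio_diff:
  "mixed_ratio r a b p q \<Longrightarrow> mixed_ratio r' c d p q \<Longrightarrow> r - r' = 1 \<Longrightarrow> p * q = a * b - c * d"
  by (simp add: mixed_ratio_def left_diff_distrib[symmetric])

text \<open>Up to reflection of the Gamma functions this is the classical evaluation of
  \<open>det ((p + q + i + j - 1)! / ((p + 2 i - j)! (q + 2 j - i)!))\<close> for \<open>0 \<le> i, j < n\<close>.\<close>

definition block_form :: "nat \<Rightarrow> nat \<Rightarrow> nat \<Rightarrow> rat" where
  "block_form n d x =
    (sfac 3 (x+1) * sfac (Suc 0) n * sfac 2 (3*n+x+2*d) * sfac (Suc 0) (2*n+x+d) * sfac 2 d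
      * sfac 2 (x+3*n+1) * sfac 2 (6*n+3*d+2*x) * sfac 3 (3*n+3*d+2*x+1))
  / (sfac 3 (x+3*n+1) * sfac 2 (n+x+2*d) * sfac (Suc 0) (3*n+x+d) * sfac 2 (d+2*n)
      * sfac 2 (x+n+1) * sfac 2 (4*n+3*d+2*x) * sfac 3 (6*n+3*d+2*x+1))"

lemma block_form_pos: "block_form n d x > 0"
  unfolding block_form_def by (intro divide_pos_pos mult_pos_pos sfac_pos)

lemma block_form_0: "block_form 0 d x = 1"
  by (simp add: block_form_def sfac_small[of 0 "Suc 0"])

text \<open>Divided by the left-hand side, the two products on the right become rational functions
  \<open>?r1\<close> and \<open>?r2\<close> over the same denominator, and the recurrence is the
  polynomial identity behind \<open>?r1 - ?r2 = 1\<close>.\<close>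

lemma block_form_dodgson:
  "block_form (n+2) (d+1) x * block_form n (d+2) (x+3) =
   block_form (n+1) (d+2) x * block_form (n+1) (d+1) (x+3) -
   block_form (n+1) d (x+3) * block_form (n+1) (d+3) x"
proof -
  let ?q = "of_nat ((n+1) * (n+x+3) * (4*n+3*d+2*x+11)) :: rat"
  let ?r1 = "of_nat ((2*n+d+x+5) * (n+2*d+x+5) * (2*n+d+3)) / ?q"
  let ?r2 = "of_nat ((3*n+2*d+x+7) * (d+1) * (3*n+d+x+6)) / ?q"
  let ?A = "block_form (n+2) (d+1) x * block_form n (d+2) (x+3)"
  have 1: "mixed_ratio ?r1 (block_form (n+1) (d+2) x) (block_form (n+1) (d+1) (x+3))
     (block_form (n+2) (d+1) x) (block_form n (d+2) (x+3))"
    unfolding block_form_def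
    \<comment> \<open>The ratio is left open and assembled factor by factor: the arguments agree, or
      agree crosswise, or form one of the second-order patterns, possibly inverted. Only then is it
      compared with \<open>?r1\<close>.\<close>
    apply (rule mixed_ratio_eq)
     apply (rule mixed_ratio_mult | rule mixed_ratio_divide |
       (rule mixed_ratio_same, simp, simp) | (rule mixed_ratio_swap, simp, simp) |
       (rule mixed_ratio_leaves, simp, simp, simp) |
       (rule mixed_ratio_inverse, rule mixed_ratio_leaves, simp, simp, simp, simp))+
    apply (simp add: field_simps)
    done
  have 2: "mixed_ratio ?r2 (block_form (n+1) d (x+3)) (block_form (n+1) (d+3) x)
     (block_form (n+2) (d+1) x) (block_form n (d+2) (x+3))"
    unfolding block_form_def
    apply (rule mixed_ratio_eq)
     apply (rule mixed_ratio_mult | rule mixed_ratio_divide |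
       (rule mixed_ratio_same, simp, simp) | (rule mixed_ratio_swap, simp, simp) |
       (rule mixed_ratio_leaves, simp, simp, simp) |
       (rule mixed_ratio_inverse, rule mixed_ratio_leaves, simp, simp, simp, simp))+
    apply (simp add: field_simps)
    done
  have "?q > 0" unfolding of_nat_0_less_iff by (intro mult_pos_pos) simp_all
  then have q: "?q \<noteq> 0" by linarith
  have "?r1 - ?r2 = 1"
    unfolding diff_divide_distrib[symmetric] divide_eq_1_iff
    using q by (simp add: algebra_simps)
  then show ?thesis
    using mixed_ratio_diff[OF 1 2] by simp
qed


text \<open>Replace each \<open>(2j)!\<close> by \<open>2j * (2j - 1)!\<close>; the extracted
  factors \<open>2, 4, ..., 2k\<close> multiply to \<open>2 ^ k * fact k\<close>.\<close>

lemma sfac_2_even: "sfac 2 (2 * k + 2) = 2 ^ k * fact k * sfac 2 (2 * k + 1)"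
proof (induction k)
  case 0
  then show ?case using sfac_add[of 2 0] by (simp add: sfac_small)
next
  case (Suc k)
  have "sfac 2 (2 * Suc k + 2) = sfac 2 (2 * k + 2) * fact (2 * k + 2)"
    using sfac_add[of 2 "2 * k + 2"] by simp
  also have "\<dots> = 2 ^ Suc k * fact (Suc k) * (sfac 2 (2 * k + 1) * fact (2 * k + 1))"
    unfolding Suc.IH by (simp add: algebra_simps)
  also have "sfac 2 (2 * k + 1) * fact (2 * k + 1) = sfac 2 (2 * Suc k + 1)"
    using sfac_add[of 2 "2 * k + 1"] by simp
  finally show ?case .
qed

lemma sfac_1_split: "a = n \<Longrightarrow> b = n + 1 \<Longrightarrow> sfac (Suc 0) n = sfac 2 a * sfac 2 b"
  using sfac_2_mult_Suc[of n] by simp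

lemma sfac_step: "m = n + s \<Longrightarrow> s > 0 \<Longrightarrow> sfac s m = sfac s n * fact n"
  using sfac_add[of s n] by simp

lemma sfac_2_double: "m = 2 * k + 2 \<Longrightarrow> l = 2 * k + 1 \<Longrightarrow> sfac 2 m = 2 ^ k * fact k * sfac 2 l"
  using sfac_2_even[of k] by simp

lemmas sfac_rules = sfac_1_split sfac_step sfac_2_double

text \<open>The analytic counterpart of deleting the last row and column, which is possible exactly
  at \<open>d = 0\<close>; see \<open>dt_ballot_reduce\<close>.\<close>

lemma block_form_reduce: "block_form (n + 1) 0 x = block_form n 1 x"
proof -
  have "sfac (Suc 0) (3*n+x+3) = sfac 2 (3*n+x+3) * sfac 2 (x+3*n+4)"
    "sfac (Suc 0) (3*n+x+1) = sfac 2 (x+3*n+1) * sfac 2 (3*n+x+2)"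
    "sfac (Suc 0) (n+1) = sfac (Suc 0) n * fact n"
    "sfac (Suc 0) (2*n+x+2) = sfac (Suc 0) (2*n+x+1) * fact (2*n+x+1)"
    "sfac 2 (2*n+2) = 2^n * fact n * sfac 2 (2*n+1)"
    "sfac 2 (4*n+2*x+4) = 2^(2*n+x+1) * fact (2*n+x+1) * sfac 2 (4*n+2*x+3)"
    "sfac 2 (6*n+2*x+6) = sfac 2 (6*n+2*x+4) * fact (6*n+2*x+4)"
    "sfac 2 (6*n+2*x+4) = 2^(3*n+x+1) * fact (3*n+x+1) * sfac 2 (6*n+2*x+3)"
    "sfac 3 (x+3*n+4) = sfac 3 (x+3*n+1) * fact (x+3*n+1)"
    "sfac 3 (6*n+2*x+7) = sfac 3 (6*n+2*x+4) * fact (6*n+2*x+4)"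
    by (rule sfac_rules; simp)+
  note e = this
  have "block_form (n + 1) 0 x =
    (sfac 3 (x+1) * sfac (Suc 0) (n+1) * sfac 2 (3*n+x+3) * sfac (Suc 0) (2*n+x+2)
      * sfac 2 (x+3*n+4) * sfac 2 (6*n+2*x+6) * sfac 3 (3*n+2*x+4))
  / (sfac 3 (x+3*n+4) * sfac 2 (n+x+1) * sfac (Suc 0) (3*n+x+3) * sfac 2 (2*n+2)
      * sfac 2 (x+n+2) * sfac 2 (4*n+2*x+4) * sfac 3 (6*n+2*x+7))"
    by (simp add: block_form_def sfac_small ac_simps)
  also have "\<dots> =
    (sfac 3 (x+1) * sfac (Suc 0) n * sfac 2 (3*n+x+2) * sfac (Suc 0) (2*n+x+1)
      * sfac 2 (x+3*n+1) * sfac 2 (6*n+2*x+3) * sfac 3 (3*n+2*x+4))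
  / (sfac 3 (x+3*n+1) * sfac 2 (n+x+2) * sfac (Suc 0) (3*n+x+1) * sfac 2 (2*n+1)
      * sfac 2 (x+n+1) * sfac 2 (4*n+2*x+3) * sfac 3 (6*n+2*x+4))"
    by (simp only: e, simp add: divide_simps power_add ac_simps del: fact_Suc,
        simp add: power_add[symmetric])
  also have "\<dots> = block_form n 1 x"
    by (simp add: block_form_def sfac_small ac_simps)
  finally show ?thesis .
qed

text \<open>The function \<open>P1\<close> with every product written by superfactorials and with \<open>m\<close> in place of
  \<open>z + 1\<close>; in this form it extends to \<open>m = 0\<close>, which the recurrence below needs.\<close>

definition gap_form :: "nat \<Rightarrow> nat \<Rightarrow> nat \<Rightarrow> nat \<Rightarrow> rat" where
  "gap_form y m a x =
    (sfac 3 (x+1) * sfac (Suc 0) (2*y+2*m+3*a+x) * sfac 2 (6*y+6*m+6*a+2*x)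
      * sfac 3 (3*y+3*m+6*a+2*x+1) * sfac 2 (3*y+2*m+4*a+x) * sfac 2 (y+2*m+2*a+x)
      * sfac 2 (y+2*a+x+1) * sfac 3 (3*y+3*a+x+1) * sfac 2 (3*y+x+1) * sfac (Suc 0) (2*y+m+2*a+x)
      * sfac (Suc 0) a * sfac (Suc 0) y * sfac 2 (2*m+2*a) * sfac (Suc 0) m * sfac (Suc 0) (y+m+a))
  / (sfac 3 (3*y+3*m+3*a+x+1) * sfac 2 (4*y+4*m+6*a+2*x) * sfac 3 (6*y+6*m+6*a+2*x+1)
      * sfac 2 (3*y+2*m+2*a+x) * sfac 2 (y+2*m+4*a+x) * sfac 2 (y+x+1) * sfac 3 (3*y+x+1)
      * sfac 2 (3*y+2*a+x+1) * sfac (Suc 0) (y+a) * sfac (Suc 0) (y+m+2*a+x)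
      * sfac (Suc 0) (2*y+m+3*a+x) * sfac (Suc 0) (m+a) * sfac 2 (2*m) * sfac 2 (2*y+2*m+2*a))"

lemma gap_form_pos: "gap_form y m a x > 0"
  unfolding gap_form_def by (intro divide_pos_pos mult_pos_pos sfac_pos)

text \<open>Removing both columns next to the gap widens it by two, removing one of them widens it
  by one. The second arguments also account for the last row and column, deleted beforehand on the
  left and to be restored in two of the minors on the right.\<close>

lemma gap_form_dodgson:
  "gap_form (y+1) (m+2) a x * gap_form y m (a+2) x =
   gap_form (y+1) m (a+1) x * gap_form y (m+2) (a+1) x -
   gap_form y (m+1) (a+1) x * gap_form (y+1) (m+1) (a+1) x"
proof -
  let ?q = "of_nat (y+2*a+x+3) * of_nat (a+1) * of_nat (4*y+4*m+6*a+2*x+11) * of_nat (3*y+2*a+x+4) :: rat"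
  let ?r1 = "of_nat (y+2*m+2*a+x+4) * of_nat (2*m+2*a+3) * of_nat (3*y+2*m+2*a+x+5)
    * of_nat (2*y+m+3*a+x+5) / ?q"
  let ?r2 = "of_nat (3*y+2*m+4*a+x+7) * of_nat (2*y+m+2*a+x+4) * of_nat (y+2*m+4*a+x+6)
    * of_nat (2*m+1) / ?q"
  have 1: "mixed_ratio ?r1 (gap_form (y+1) m (a+1) x) (gap_form y (m+2) (a+1) x)
     (gap_form (y+1) (m+2) a x) (gap_form y m (a+2) x)"
    unfolding gap_form_def
    apply (rule mixed_ratio_eq)
     apply (rule mixed_ratio_mult | rule mixed_ratio_divide |
       (rule mixed_ratio_same, simp, simp) | (rule mixed_ratio_swap, simp, simp) |
       (rule mixed_ratio_leaves, simp, simp, simp) |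
       (rule mixed_ratio_inverse, rule mixed_ratio_leaves, simp, simp, simp, simp))+
    apply (simp add: divide_simps)
    apply (simp add: ac_simps)
    apply (simp add: algebra_simps)
    done
  have 2: "mixed_ratio ?r2 (gap_form y (m+1) (a+1) x) (gap_form (y+1) (m+1) (a+1) x)
     (gap_form (y+1) (m+2) a x) (gap_form y m (a+2) x)"
    unfolding gap_form_def
    apply (rule mixed_ratio_eq)
     apply (rule mixed_ratio_mult | rule mixed_ratio_divide |
       (rule mixed_ratio_same, simp, simp) | (rule mixed_ratio_swap, simp, simp) |
       (rule mixed_ratio_leaves, simp, simp, simp) |
       (rule mixed_ratio_inverse, rule mixed_ratio_leaves, simp, simp, simp, simp))+
    apply (simp add: divide_simps)
    apply (simp add: ac_simps)
    apply (simp add: algebra_simps)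
    done
  have "?q > 0" by (intro mult_pos_pos) simp_all
  then have q: "?q \<noteq> 0" by linarith
  have "?r1 - ?r2 = 1"
    unfolding diff_divide_distrib[symmetric] divide_eq_1_iff
    using q by (simp add: algebra_simps)
  then show ?thesis
    using mixed_ratio_diff[OF 1 2] by simp
qed

text \<open>No column lies behind the gap, so the gap survives only in the first row number, which
  exceeds the one for \<open>d = 0\<close> by \<open>2*a\<close>.\<close>

lemma gap_form_m_0: "gap_form y 0 a x = block_form y (2*a) x"
proof -
  have "sfac (Suc 0) (x+y+3*a) = sfac 2 (x+y+3*a) * sfac 2 (x+y+3*a+1)"
    "sfac (Suc 0) (y+2*a+x) = sfac 2 (y+2*a+x) * sfac 2 (y+2*a+x+1)"
    "sfac (Suc 0) (3*y+2*a+x) = sfac 2 (3*y+2*a+x) * sfac 2 (3*y+2*a+x+1)"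
    by (rule sfac_rules; simp)+
  note e = this
  show ?thesis
    unfolding gap_form_def block_form_def
    using e by (simp add: sfac_small ac_simps divide_simps)
qed

text \<open>The single column behind the gap is the removable last one. Deleting it lowers the order
  but not the first row number, hence \<open>d = 2*a + 1\<close>.\<close>

lemma gap_form_m_1: "gap_form y 1 a x = block_form y (2*a+1) x"
proof -
  have "sfac (Suc 0) (y+2*a+x+1) = sfac 2 (y+2*a+x+1) * sfac 2 (y+2*a+x+2)"
    "sfac (Suc 0) (3*y+x+2*a+1) = sfac 2 (3*y+2*a+x+1) * sfac 2 (3*y+2*a+x+2)"
    "sfac (Suc 0) (2*y+3*a+x+2) = sfac (Suc 0) (2*y+3*a+x+1) * fact (2*y+3*a+x+1)"
    "sfac (Suc 0) (y+a+1) = sfac (Suc 0) (y+a) * fact (y+a)"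
    "sfac (Suc 0) (a+1) = sfac (Suc 0) a * fact a"
    "sfac 3 (3*y+3*a+x+4) = sfac 3 (3*y+3*a+x+1) * fact (3*y+3*a+x+1)"
    "sfac 3 (6*y+6*a+2*x+7) = sfac 3 (6*y+6*a+2*x+4) * fact (6*y+6*a+2*x+4)"
    "sfac 2 (6*y+6*a+2*x+6) = sfac 2 (6*y+6*a+2*x+4) * fact (6*y+6*a+2*x+4)"
    "sfac 2 (6*y+6*a+2*x+4) = 2^(3*y+3*a+x+1) * fact (3*y+3*a+x+1) * sfac 2 (6*y+6*a+2*x+3)"
    "sfac 2 (4*y+6*a+2*x+4) = 2^(2*y+3*a+x+1) * fact (2*y+3*a+x+1) * sfac 2 (4*y+6*a+2*x+3)"
    "sfac 2 (2*a+2) = 2^a * fact a * sfac 2 (2*a+1)"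
    "sfac 2 (2*y+2*a+2) = 2^(y+a) * fact (y+a) * sfac 2 (2*y+2*a+1)"
    by (rule sfac_rules; simp)+
  note e = this
  have "sfac (Suc 0) (Suc 0) = 1" "sfac 2 (Suc (Suc 0)) = 1"
    using sfac_step[of "Suc 0" 0 "Suc 0"] sfac_step[of 2 0 2] by (simp_all add: sfac_small numeral_2_eq_2)
  note e = e this
  have "gap_form y 1 a x = (sfac 3 (x+1) * sfac (Suc 0) (2*y+3*a+x+2) * sfac 2 (6*y+6*a+2*x+6)
      * sfac 3 (3*y+6*a+2*x+4) * sfac 2 (3*y+4*a+x+2) * sfac 2 (y+2*a+x+2)
      * sfac 2 (y+2*a+x+1) * sfac 3 (3*y+3*a+x+1) * sfac 2 (3*y+x+1) * sfac (Suc 0) (2*y+2*a+x+1)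
      * sfac (Suc 0) a * sfac (Suc 0) y * sfac 2 (2*a+2) * sfac (Suc 0) (y+a+1))
  / (sfac 3 (3*y+3*a+x+4) * sfac 2 (4*y+6*a+2*x+4) * sfac 3 (6*y+6*a+2*x+7)
      * sfac 2 (3*y+2*a+x+2) * sfac 2 (y+4*a+x+2) * sfac 2 (y+x+1) * sfac 3 (3*y+x+1)
      * sfac 2 (3*y+2*a+x+1) * sfac (Suc 0) (y+a) * sfac (Suc 0) (y+2*a+x+1)
      * sfac (Suc 0) (2*y+3*a+x+1) * sfac (Suc 0) (a+1) * sfac 2 (2*y+2*a+2))"
    unfolding gap_form_def by (simp add: e(13,14) ac_simps)
  also have "\<dots> = (sfac 3 (x+1) * sfac (Suc 0) y * sfac 2 (3*y+4*a+x+2) * sfac (Suc 0) (2*y+2*a+x+1) * sfac 2 (2*a+1)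
      * sfac 2 (3*y+x+1) * sfac 2 (6*y+6*a+2*x+3) * sfac 3 (3*y+6*a+2*x+4))
  / (sfac 3 (3*y+x+1) * sfac 2 (y+4*a+x+2) * sfac (Suc 0) (3*y+x+2*a+1) * sfac 2 (2*y+2*a+1)
      * sfac 2 (y+x+1) * sfac 2 (4*y+6*a+2*x+3) * sfac 3 (6*y+6*a+2*x+4))"
    by (simp only: e, simp add: divide_simps power_add ac_simps del: fact_Suc,
        simp add: power_add[symmetric])
  also have "\<dots> = block_form y (2*a+1) x"
    unfolding block_form_def by (simp add: ac_simps)
  finally show ?thesis .
qed

text \<open>No column lies in front of the gap: the columns start at \<open>a\<close>, and
  \<open>ballot_shift\<close> turns this offset into \<open>x + 3*a\<close>.\<close>

lemma gap_form_y_0: "gap_form 0 m a x = block_form m 0 (x + 3*a)"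
proof -
  have "sfac (Suc 0) (m+3*a+x) = sfac 2 (m+3*a+x) * sfac 2 (m+3*a+x+1)"
    "sfac (Suc 0) (3*m+3*a+x) = sfac 2 (3*m+3*a+x) * sfac 2 (3*m+3*a+x+1)"
    by (rule sfac_rules; simp)+
  note e = this
  show ?thesis
    unfolding gap_form_def block_form_def
    using e by (simp add: sfac_small ac_simps divide_simps)
qed

section \<open>Determinants of ballot numbers\<close>

lemma upt_Cons_eq: "i < j \<Longrightarrow> k = Suc i \<Longrightarrow> i # [k..<j] = [i..<j]"
  by (simp add: upt_conv_Cons)

lemma upt_snoc_eq: "i \<le> j \<Longrightarrow> k = j \<Longrightarrow> l = Suc j \<Longrightarrow> [i..<j] @ [k] = [i..<l]"
  by simp

text \<open>The binomial coefficient of \<open>2*R + x + 1 - k\<close> over \<open>R - 2*k\<close>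
  minus the one over \<open>R - 2*k - 1\<close>: a count of lattice walks that avoid a line, by the
  reflection principle (see \<open>walks_ballot\<close>).\<close>

definition ballot :: "nat \<Rightarrow> nat \<Rightarrow> nat \<Rightarrow> rat" where
  "ballot x R k = (if 2 * k \<le> R then
     of_nat (x + 2 + 3 * k) * fact (2 * R + x + 1 - k) / (fact (R - 2 * k) * fact (R + x + 2 + k)) else 0)"

lemma ballot_zero: "R < 2 * k \<Longrightarrow> ballot x R k = 0"
  by (simp add: ballot_def)

lemma ballot_diag: "ballot x (2 * k) k = 1"
proof -
  have "2 * (2 * k) + x + 1 - k = 3 * k + x + 1" "2 * k + x + 2 + k = Suc (3 * k + x + 1)" by simp_all
  then show ?thesis
    unfolding ballot_def by (simp only: fact_Suc) (simp add: divide_simps)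
qed

lemma ballot_shift: "ballot x (R + 2 * s) (k + s) = ballot (x + 3 * s) R k"
proof (cases "2 * k \<le> R")
  case True
  then have "2 * (R + 2 * s) + x + 1 - (k + s) = 2 * R + (x + 3 * s) + 1 - k"
    "R + 2 * s - 2 * (k + s) = R - 2 * k" "R + 2 * s + x + 2 + (k + s) = R + (x + 3 * s) + 2 + k"
    "x + 2 + 3 * (k + s) = x + 3 * s + 2 + 3 * k" "2 * (k + s) \<le> R + 2 * s"
    by simp_all
  then show ?thesis using True by (simp only: ballot_def)
qed (simp add: ballot_def)

lemma dt_ballot_shift:
  assumes "r' = r + 2 * s" "c' = c + s" "length cs = n"
    "\<And>i. i < n \<Longrightarrow> cs' ! i = cs ! i + s" "length cs' = n"
  shows "dt (ballot x) [r'..<r' + n] cs' = dt (ballot (x + 3 * s)) [r..<r + n] cs"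
proof (rule dt_cong)
  fix i j assume "i < length cs'" "j < length cs'"
  then show "ballot x ([r'..<r' + n] ! i) (cs' ! j) = ballot (x + 3 * s) ([r..<r + n] ! i) (cs ! j)"
    using assms ballot_shift[of x "r + i" s "cs ! j"] by (simp add: ac_simps)
qed (use assms in auto)

text \<open>In the column \<open>k\<close> all rows before \<open>2 * k\<close> vanish and the row
  \<open>2 * k\<close> has the entry 1, so the matrix is block triangular with corner 1.\<close>

lemma dt_ballot_reduce:
  assumes "r + n = 2 * k" "length cs = n"
  shows "dt (ballot x) [r..<r + Suc n] (cs @ [k]) = dt (ballot x) [r..<r + n] cs"
proof -
  have "dt (ballot x) ([r..<r + n] @ [2 * k]) (cs @ [k]) = dt (ballot x) [r..<r + n] cs * dt (ballot x) [2 * k] [k]"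
    by (rule dt_append_block_triangular) (use assms ballot_zero in auto)
  then show ?thesis using assms(1) by (simp add: ballot_diag)
qed

lemma block_form_1: "block_form 1 d x = ballot x d 0"
proof -
  have "sfac 2 (x+2*d+3) = sfac 2 (x+2*d+1) * fact (x+2*d+1)"
    "sfac (Suc 0) (x+d+3) = sfac (Suc 0) (x+d+2) * fact (x+d+2)"
    "sfac 2 (d+2) = sfac 2 d * fact d"
    "sfac 2 (x+4) = sfac 2 (x+2) * fact (x+2)"
    "sfac 2 (3*d+2*x+6) = sfac 2 (3*d+2*x+4) * fact (3*d+2*x+4)"
    "sfac 3 (3*d+2*x+7) = sfac 3 (3*d+2*x+4) * fact (3*d+2*x+4)"
    "sfac 3 (x+4) = sfac 3 (x+1) * fact (x+1)"
    by (rule sfac_rules; simp)+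
  note e = this
  have "sfac (Suc 0) (Suc 0) = 1" using sfac_step[of "Suc 0" 0 "Suc 0"] by (simp add: sfac_small)
  then have "block_form 1 d x =
    (sfac 3 (x+1) * sfac 2 (x+2*d+3) * sfac (Suc 0) (x+d+2) * sfac 2 d
      * sfac 2 (x+4) * sfac 2 (3*d+2*x+6) * sfac 3 (3*d+2*x+4))
  / (sfac 3 (x+4) * sfac 2 (x+2*d+1) * sfac (Suc 0) (x+d+3) * sfac 2 (d+2)
      * sfac 2 (x+2) * sfac 2 (3*d+2*x+4) * sfac 3 (3*d+2*x+7))"
    by (simp add: block_form_def ac_simps)
  also have "\<dots> = of_nat (x + 2) * fact (x+2*d+1) / (fact d * fact (x+d+2))"
  proof -
    have "fact (x+2) = of_nat (x + 2) * (fact (x + 1) :: rat)"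
      using fact_Suc[of "x+1"] by simp
    then show ?thesis by (simp only: e) (simp add: divide_simps ac_simps del: fact_Suc)
  qed
  also have "\<dots> = ballot x d 0" by (simp add: ballot_def ac_simps)
  finally show ?thesis .
qed

text \<open>The parameter \<open>d\<close> is the excess of the last row number over twice the last
  column number. At \<open>d = 0\<close> the last column can be removed; otherwise condensation
  applies, and in the minors without column 0 a shift of columns by one and of rows by two leads
  back to the family with \<open>x + 3\<close>.\<close>

lemma block_det:
  "r + 1 = n + d \<Longrightarrow> dt (ballot x) [r..<r + n] [0..<n] = block_form n d x"
proof (induction n arbitrary: r d x rule: less_induct)
  case (less n)
  consider "n = 0" | "n = 1" | v where "n = v + 2" "d = 0" | v e where "n = v + 2" "d = e + 1"
    by (metis One_nat_def Suc_1 Suc_eq_plus1 add_2_eq_Suc' not0_implies_Suc)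
  then show ?case
  proof cases
    case 1
    then show ?thesis by (simp add: block_form_0)
  next
    case 2
    then show ?thesis using less.prems block_form_1[of d x] by simp
  next
    case 3
    have "dt (ballot x) [r..<r + Suc (v + 1)] ([0..<v + 1] @ [v + 1]) = dt (ballot x) [r..<r + (v + 1)] [0..<v + 1]"
      by (rule dt_ballot_reduce) (use 3 less.prems in simp_all)
    also have "\<dots> = block_form (v + 1) 1 x"
      by (rule less.IH) (use 3 less.prems in simp_all)
    finally show ?thesis using block_form_reduce[of "v + 1" x] 3 by simp
  next
    case 4
    \<comment> \<open>The first row is written as \<open>s + 1\<close> with \<open>s\<close>
      positive, so that moving it down by two rows, to \<open>s - 1\<close>, stays in the natural
      numbers.\<close>
    define s where "s = v + e + 1"
    have r: "r = s + 1" using 4 less.prems by (simp add: s_def)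
    let ?I = "[s+2..<s+2+v]" and ?C = "[1..<v+1]"
    have sh: "dt (ballot x) [q+2..<q+2+k] [1..<k+1] = dt (ballot (x+3)) [q..<q+k] [0..<k]" for q k
      using dt_ballot_shift[where s = 1 and r = q and r' = "q + 2" and n = k and c = 0 and c' = 1
          and cs = "[0..<k]" and cs' = "[1..<k+1]" and x = x] by (simp del: upt_Suc)
    have I: "dt (ballot x) ?I ?C = block_form v (e+2) (x+3)"
      unfolding sh by (rule less.IH) (use 4 in \<open>simp_all add: s_def\<close>)
    have "dt (ballot x) ((s+1) # ?I @ [s+2+v]) ([] @ 0 # ?C @ (v+1) # []) * dt (ballot x) ?I ([] @ ?C @ []) =
      dt (ballot x) ((s+1) # ?I) ([] @ 0 # ?C @ []) * dt (ballot x) (?I @ [s+2+v]) ([] @ ?C @ (v+1) # []) -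
      dt (ballot x) ((s+1) # ?I) ([] @ ?C @ (v+1) # []) * dt (ballot x) (?I @ [s+2+v]) ([] @ 0 # ?C @ [])"
      by (rule dodgson) (use I block_form_pos[of v "e+2" "x+3"] in auto)
    moreover have "(s+1) # ?I = [s+1..<s+1+(v+1)]" using upt_Cons_eq[of "s+1" "s+1+(v+1)"] by simp
    moreover have "0 # ?C = [0..<v+1]" by (rule upt_Cons_eq) simp_all
    moreover have "(s+1) # ?I @ [s+2+v] = [r..<r+n]"
      using 4 r upt_Cons_eq[of "s+1" "s+3+v" "s+2"] upt_snoc_eq[of "s+2" "s+2+v" "s+2+v" "s+3+v"]
      by (simp del: upt_Suc add: numeral_3_eq_3)
    moreover have "0 # ?C @ [v+1] = [0..<n]"
      using 4 upt_Cons_eq[of 0 "v+2" 1] upt_snoc_eq[of 1 "v+1" "v+1" "v+2"] by (simp del: upt_Suc)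
    moreover have "?C @ [v+1] = [1..<(v+1)+1]" by (rule upt_snoc_eq) simp_all
    moreover have "?I @ [s+2+v] = [s+2..<s+2+(v+1)]" by (rule upt_snoc_eq) simp_all
    ultimately have "dt (ballot x) [r..<r+n] [0..<n] * block_form v (e+2) (x+3) =
      dt (ballot x) [s+1..<s+1+(v+1)] [0..<v+1] * dt (ballot x) [s+2..<s+2+(v+1)] [1..<(v+1)+1] -
      dt (ballot x) [s+1..<s+1+(v+1)] [1..<(v+1)+1] * dt (ballot x) [s+2..<s+2+(v+1)] [0..<v+1]"
      using I by simp
    also have "dt (ballot x) [s+1..<s+1+(v+1)] [0..<v+1] = block_form (v+1) (e+2) x"
      by (rule less.IH) (use 4 in \<open>simp_all add: s_def\<close>)
    also have "dt (ballot x) [s+2..<s+2+(v+1)] [0..<v+1] = block_form (v+1) (e+3) x"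
      by (rule less.IH) (use 4 in \<open>simp_all add: s_def\<close>)
    also have "dt (ballot x) [s+2..<s+2+(v+1)] [1..<(v+1)+1] = block_form (v+1) (e+1) (x+3)"
      unfolding sh by (rule less.IH) (use 4 in \<open>simp_all add: s_def\<close>)
    also have "dt (ballot x) [s+1..<s+1+(v+1)] [1..<(v+1)+1] = block_form (v+1) e (x+3)"
      using sh[of "s-1" "v+1"] less.IH[of "v+1" "s-1" e "x+3"] 4 by (simp add: s_def)
    also note block_form_dodgson[of v e x, symmetric]
    finally show ?thesis
      using block_form_pos[of v "e+2" "x+3"] 4 by simp
  qed
qed

lemma gap_det:
  "t = y + m \<Longrightarrow> r + 1 = t + 2 * a \<Longrightarrow>
    dt (ballot x) [r..<r + t] ([0..<y] @ [y + a..<t + a]) = gap_form y m a x"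
proof (induction t arbitrary: r y m a x rule: less_induct)
  case (less t)
  \<comment> \<open>Here the first row number is one too large for the order \<open>t'\<close>. Such
    a determinant is what remains of a member of the family with one more column behind the gap
    after its last column has been deleted.\<close>
  have reduced: "dt (ballot x) [r..<r + t'] ([0..<y] @ [y + a..<t' + a]) = gap_form y (m + 1) a x"
    if "t' + 1 < t" "t' = y + m" "r = t' + 2 * a" for t' r y m a
    using less.IH[of "t' + 1" y "m + 1" r a x] that
      dt_ballot_reduce[of r t' "t' + a" "[0..<y] @ [y + a..<t' + a]" x]
    by simp
  consider "m = 0" | "y = 0" | "m = 1" | v u where "y = v + 1" "m = u + 2"
    by (metis One_nat_def Suc_1 Suc_eq_plus1 add_2_eq_Suc' not0_implies_Suc)
  then show ?case
  proof cases
    case 1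
    then show ?thesis using less.prems block_det[of r y "2*a" x] by (simp add: gap_form_m_0)
  next
    case 2
    show ?thesis
    proof (cases "m = 0")
      case False
      have "dt (ballot x) [r..<r + t] [a..<t + a] = dt (ballot (x + 3 * a)) [m-1..<m-1 + t] [0..<m]"
        by (rule dt_ballot_shift[where c = 0]) (use less.prems 2 False in auto)
      then show ?thesis using 2 less.prems block_det[of "m-1" m 0 "x+3*a"] False by (simp add: gap_form_y_0)
    qed (use 2 less.prems in \<open>simp add: gap_form_y_0 block_form_0\<close>)
  next
    case 3
    then show ?thesis
      using less.prems dt_ballot_reduce[of r y "y + a" "[0..<y]" x] block_det[of r y "2*a+1" x] gap_form_m_1[of y a x]
      by simp
  next
    case 4
    \<comment> \<open>After the last column has been deleted the order is \<open>n + 2\<close>.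
      Condensation acts on that matrix, at the columns \<open>v = y - 1\<close> and
      \<open>v + 1 + a = y + a\<close>; so one column in front of the gap and two behind it are
      required.\<close>
    define n where "n = v + u"
    have t: "t = n + 3" using less.prems 4 by (simp add: n_def)
    have r: "r = n + 2 + 2 * a" using less.prems t by simp
    let ?I = "[r+1..<r+1+n]" and ?X = "[0..<v]" and ?Z = "[v+2+a..<n+2+a]"
    have I: "dt (ballot x) ?I (?X @ [] @ ?Z) = gap_form v u (a+2) x"
      using less.IH[of n v u "r+1" "a+2" x] t r by (simp add: n_def)
    have "dt (ballot x) (r # ?I @ [r+1+n]) (?X @ v # [] @ (v+1+a) # ?Z) * dt (ballot x) ?I (?X @ [] @ ?Z) =
      dt (ballot x) (r # ?I) (?X @ v # [] @ ?Z) * dt (ballot x) (?I @ [r+1+n]) (?X @ [] @ (v+1+a) # ?Z) -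
      dt (ballot x) (r # ?I) (?X @ [] @ (v+1+a) # ?Z) * dt (ballot x) (?I @ [r+1+n]) (?X @ v # [] @ ?Z)"
      by (rule dodgson) (use I gap_form_pos[of v u "a+2" x] in \<open>auto simp: n_def\<close>)
    moreover have "r # ?I = [r..<r+(n+1)]" using upt_Cons_eq[of r "r+(n+1)" "r+1"] by simp
    moreover have "?I @ [r+1+n] = [r+1..<r+1+(n+1)]" by (rule upt_snoc_eq) simp_all
    moreover have "r # ?I @ [r+1+n] = [r..<r+(n+2)]"
      using upt_Cons_eq[of r "r+(n+2)" "r+1"] upt_snoc_eq[of "r+1" "r+1+n" "r+1+n" "r+(n+2)"]
      by (simp del: upt_Suc)
    moreover have "?X @ v # [] @ (v+1+a) # ?Z = [0..<y] @ [y+a..<(n+2)+a]"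
      using 4 upt_Cons_eq[of "v+1+a" "n+2+a" "v+2+a"] upt_snoc_eq[of 0 v v y]
      by (simp add: n_def del: upt_Suc)
    moreover have "?X @ v # [] @ ?Z = [0..<y] @ [y+(a+1)..<(n+1)+(a+1)]"
      using 4 upt_snoc_eq[of 0 v v y] by (simp del: upt_Suc)
    moreover have "?X @ [] @ (v+1+a) # ?Z = [0..<v] @ [v+(a+1)..<(n+1)+(a+1)]"
      using upt_Cons_eq[of "v+1+a" "n+2+a" "v+2+a"] by (simp add: n_def del: upt_Suc)
    ultimately have "dt (ballot x) [r..<r+(n+2)] ([0..<y] @ [y+a..<(n+2)+a]) * gap_form v u (a+2) x =
      dt (ballot x) [r..<r+(n+1)] ([0..<y] @ [y+(a+1)..<(n+1)+(a+1)]) *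
      dt (ballot x) [r+1..<r+1+(n+1)] ([0..<v] @ [v+(a+1)..<(n+1)+(a+1)]) -
      dt (ballot x) [r..<r+(n+1)] ([0..<v] @ [v+(a+1)..<(n+1)+(a+1)]) *
      dt (ballot x) [r+1..<r+1+(n+1)] ([0..<y] @ [y+(a+1)..<(n+1)+(a+1)])"
      using I by (simp only:)
    also have "dt (ballot x) [r..<r+(n+1)] ([0..<y] @ [y+(a+1)..<(n+1)+(a+1)]) = gap_form (v+1) u (a+1) x"
      using less.IH[of "n+1" y u r "a+1" x] 4 t r by (simp add: n_def)
    also have "dt (ballot x) [r..<r+(n+1)] ([0..<v] @ [v+(a+1)..<(n+1)+(a+1)]) = gap_form v (u+1) (a+1) x"
      by (rule less.IH) (use 4 t r in \<open>simp_all add: n_def\<close>)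
    also have "dt (ballot x) [r+1..<r+1+(n+1)] ([0..<v] @ [v+(a+1)..<(n+1)+(a+1)]) = gap_form v (u+2) (a+1) x"
      using reduced[of "n+1" v "u+1" "r+1" "a+1"] 4 t r by (simp add: n_def del: upt_Suc)
    also have "dt (ballot x) [r+1..<r+1+(n+1)] ([0..<y] @ [y+(a+1)..<(n+1)+(a+1)]) = gap_form (v+1) (u+1) (a+1) x"
      using reduced[of "n+1" y u "r+1" "a+1"] 4 t r by (simp add: n_def del: upt_Suc)
    also note gap_form_dodgson[of v u a x, symmetric]
    finally have "dt (ballot x) [r..<r+(n+2)] ([0..<y] @ [y+a..<(n+2)+a]) = gap_form (v+1) (u+2) a x"
      using gap_form_pos[of v u "a+2" x] by (metis less_irrefl mult_right_cancel)
    moreover have "dt (ballot x) [r..<r + Suc (n+2)] (([0..<y] @ [y+a..<(n+2)+a]) @ [n+2+a]) =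
      dt (ballot x) [r..<r+(n+2)] ([0..<y] @ [y+a..<(n+2)+a])"
      by (rule dt_ballot_reduce) (use r 4 in \<open>simp_all add: n_def\<close>)
    moreover have "[y+a..<(n+2)+a] @ [n+2+a] = [y+a..<t+a]"
      by (rule upt_snoc_eq) (use 4 t in \<open>simp_all add: n_def\<close>)
    moreover have "r + Suc (n+2) = r + t" using t by simp
    ultimately show ?thesis using 4 by (simp only: append_assoc)
  qed
qed

section \<open>The product formula\<close>

text \<open>The quotient form also covers \<open>v < u\<close>, where the index is negative and
  \<open>poch\<close> is a reciprocal. The factors of \<open>P1\<close> whose index changes sign
  with \<open>i\<close> can thus be treated uniformly.\<close>

lemma poch_eq_fact_div: "poch (of_nat u + 1) (int v - int u) = fact v / fact u"
proof (cases "u \<le> v")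
  case True
  have "(\<Prod>k<v - u. (of_nat u + 1 + of_nat k :: rat)) = fact v / fact u"
    using True
  proof (induction v rule: dec_induct)
    case (step n)
    then have "Suc n - u = Suc (n - u)" by simp
    then show ?case using step by (simp add: of_nat_diff algebra_simps)
  qed simp
  moreover have "nat (int v - int u) = v - u" by simp
  ultimately show ?thesis using True by (simp add: poch_def)
next
  case False
  then have "v \<le> u" by simp
  have "(\<Prod>k\<in>{1..u - v}. (of_nat u + 1 - of_nat k :: rat)) * fact v = fact u"
    using \<open>v \<le> u\<close>
  proof (induction "u - v" arbitrary: v)
    case (Suc n)
    then have v: "Suc v \<le> u" "u - v = Suc (u - Suc v)" by simp_all
    then have "(\<Prod>k\<in>{1..u - v}. (of_nat u + 1 - of_nat k :: rat)) * fact v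
      = (\<Prod>k\<in>{1..u - Suc v}. (of_nat u + 1 - of_nat k)) * ((of_nat u + 1 - of_nat (u - v)) * fact v)"
      by (simp add: prod.nat_ivl_Suc')
    also have "(of_nat u + 1 - of_nat (u - v)) * fact v = (fact (Suc v) :: rat)"
      using v by (simp add: of_nat_diff)
    also have "(\<Prod>k\<in>{1..u - Suc v}. (of_nat u + 1 - of_nat k)) * (fact (Suc v) :: rat) = fact u"
      using Suc.hyps(1)[of "Suc v"] Suc.hyps(2) v by simp
    finally show ?case .
  qed simp
  moreover from this have "(\<Prod>k\<in>{1..u - v}. (of_nat u + 1 - of_nat k :: rat)) \<noteq> 0" by force
  moreover have "nat (int u - int v) = u - v" "\<not> int v - int u \<ge> 0" using False by auto
  ultimately show ?thesis by (simp add: poch_def divide_simps mult.commute)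
qed

lemma poch_nat:
  assumes "c = of_nat u + 1" "n = int v - int u"
  shows "poch c n = fact v / fact u"
  using poch_eq_fact_div assms by simp

text \<open>A product of consecutive odd numbers; inserting the missing even factors turns it into
  factorials and a power of two.\<close>

lemma spoch_nat:
  assumes "c = 2 * of_nat u + 1" "n = int k"
  shows "spoch c n = fact (2 * (u + k)) * fact u / (2 ^ k * fact (u + k) * fact (2 * u))"
proof -
  have "(\<Prod>i<k. (2 * of_nat u + 1 + 2 * of_nat i :: rat)) = fact (2 * (u + k)) * fact u / (2 ^ k * fact (u + k) * fact (2 * u))"
    by (induction k) (simp_all add: divide_simps, simp add: algebra_simps)
  then show ?thesis using assms by (simp add: spoch_def)
qed

lemma prod_fact_step:
  "s > 0 \<Longrightarrow> (\<Prod>j<a. fact (c + s * j)) = sfac s (c + s * a) / sfac s c"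
proof (induction a)
  case (Suc a)
  have "sfac s (c + s * Suc a) = sfac s (c + s * a) * fact (c + s * a)"
    by (rule sfac_step) (use Suc.prems in auto)
  then show ?case using Suc by simp
qed simp

lemma block_form_ratio:
  "block_form (t + 1) 0 s = block_form t 0 s *
    (2 * fact (2*s+3*t+1) * fact t * fact (2*s+6*t) * fact (s+2*t+1) * fact (s+2*t)
      / (fact (2*t) * fact (s+3*t) * fact (s+t) * fact (2*s+4*t+2) * fact (2*s+4*t)))"
proof -
  have "sfac (Suc 0) (s+3*t) = sfac 2 (s+3*t) * sfac 2 (s+3*t+1)"
    "sfac (Suc 0) (s+3*t+3) = sfac 2 (s+3*t+3) * sfac 2 (s+3*t+4)"
    "sfac 2 (s+t+2) = sfac 2 (s+t) * fact (s+t)"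
    "sfac (Suc 0) (t+1) = sfac (Suc 0) t * fact t"
    "sfac (Suc 0) (s+2*t+2) = sfac (Suc 0) (s+2*t+1) * fact (s+2*t+1)"
    "sfac (Suc 0) (s+2*t+1) = sfac (Suc 0) (s+2*t) * fact (s+2*t)"
    "sfac 2 (2*s+6*t+6) = sfac 2 (2*s+6*t+4) * fact (2*s+6*t+4)"
    "sfac 2 (2*s+6*t+4) = sfac 2 (2*s+6*t+2) * fact (2*s+6*t+2)"
    "sfac 2 (2*s+6*t+2) = sfac 2 (2*s+6*t) * fact (2*s+6*t)"
    "sfac 3 (2*s+3*t+4) = sfac 3 (2*s+3*t+1) * fact (2*s+3*t+1)"
    "sfac 3 (s+3*t+4) = sfac 3 (s+3*t+1) * fact (s+3*t+1)"
    "sfac 2 (2*t+2) = sfac 2 (2*t) * fact (2*t)"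
    "sfac 2 (2*s+4*t+4) = sfac 2 (2*s+4*t+2) * fact (2*s+4*t+2)"
    "sfac 2 (2*s+4*t+2) = sfac 2 (2*s+4*t) * fact (2*s+4*t)"
    "sfac 3 (2*s+6*t+7) = sfac 3 (2*s+6*t+4) * fact (2*s+6*t+4)"
    "sfac 3 (2*s+6*t+4) = sfac 3 (2*s+6*t+1) * fact (2*s+6*t+1)"
    by (rule sfac_rules; simp)+
  note e = this
  have f: "fact (2*s+6*t+2) = 2 * of_nat (s+3*t+1) * (fact (2*s+6*t+1) :: rat)"
    "fact (s+3*t+1) = of_nat (s+3*t+1) * (fact (s+3*t) :: rat)"
    using fact_Suc[of "2*s+6*t+1"] fact_Suc[of "s+3*t"] by simp_all
  have "block_form (t + 1) 0 s =
    (sfac 3 (s+1) * sfac (Suc 0) (t+1) * sfac 2 (s+3*t+3) * sfac (Suc 0) (s+2*t+2)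
      * sfac 2 (s+3*t+4) * sfac 2 (2*s+6*t+6) * sfac 3 (2*s+3*t+4))
  / (sfac 3 (s+3*t+4) * sfac 2 (s+t+1) * sfac (Suc 0) (s+3*t+3) * sfac 2 (2*t+2)
      * sfac 2 (s+t+2) * sfac 2 (2*s+4*t+4) * sfac 3 (2*s+6*t+7))"
    by (simp add: block_form_def sfac_small ac_simps)
  also have "\<dots> =
    (sfac 3 (s+1) * sfac (Suc 0) t * sfac 2 (s+3*t) * sfac (Suc 0) (s+2*t)
      * sfac 2 (s+3*t+1) * sfac 2 (2*s+6*t) * sfac 3 (2*s+3*t+1))
  / (sfac 3 (s+3*t+1) * sfac 2 (s+t) * sfac (Suc 0) (s+3*t) * sfac 2 (2*t)
      * sfac 2 (s+t+1) * sfac 2 (2*s+4*t) * sfac 3 (2*s+6*t+1)) *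
    (2 * fact (2*s+3*t+1) * fact t * fact (2*s+6*t) * fact (s+2*t+1) * fact (s+2*t)
      / (fact (2*t) * fact (s+3*t) * fact (s+t) * fact (2*s+4*t+2) * fact (2*s+4*t)))"
    by (simp only: e f, simp add: divide_simps ac_simps del: fact_Suc of_nat_Suc of_nat_add)
  also have "(sfac 3 (s+1) * sfac (Suc 0) t * sfac 2 (s+3*t) * sfac (Suc 0) (s+2*t)
      * sfac 2 (s+3*t+1) * sfac 2 (2*s+6*t) * sfac 3 (2*s+3*t+1))
  / (sfac 3 (s+3*t+1) * sfac 2 (s+t) * sfac (Suc 0) (s+3*t) * sfac 2 (2*t)
      * sfac 2 (s+t+1) * sfac 2 (2*s+4*t) * sfac 3 (2*s+6*t+1)) = block_form t 0 s"
    by (simp add: block_form_def sfac_small ac_simps)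
  finally show ?thesis .
qed

text \<open>The first product of \<open>P1\<close> is the determinant without gap at
  \<open>d = 0\<close> and \<open>x + 3 * a\<close>, built up order by order with
  \<open>block_form_ratio\<close>. The second product therefore carries all dependence on where the
  gap lies.\<close>

lemma first_product:
  "(1 / 2 ^ n) * (\<Prod>i\<in>{1..n}.
       (poch (2*of_nat (x + 1) + 6*of_nat a + 2*of_nat i) (int i)
        * spoch (2*of_nat (x + 1) + 6*of_nat a + 4*of_nat i + 1) (int i - 1))
     / (poch (of_nat i) (int i)
        * spoch (2*of_nat (x + 1) + 6*of_nat a + 2*of_nat i + 1) (int i - 1)))
   = block_form (n + 1) 0 (x + 3 * a)"
proof (induction n)
  case 0
  show ?case using block_form_reduce[of 0 "x + 3 * a"] by (simp add: block_form_0)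
next
  case (Suc n)
  define s t where "s = x + 3 * a" and "t = Suc n"
  have 1: "poch (2*of_nat (x + 1) + 6*of_nat a + 2*of_nat t) (int t) = fact (2*s+3*t+1) / fact (2*s+2*t+1)"
    by (rule poch_nat) (simp_all add: s_def)
  have 2: "poch (of_nat t) (int t) = fact (2*n+1) / fact n"
    by (rule poch_nat) (simp_all add: t_def)
  have 3: "spoch (2*of_nat (x + 1) + 6*of_nat a + 4*of_nat t + 1) (int t - 1) =
    fact (2 * ((s+2*t+1) + n)) * fact (s+2*t+1) / (2 ^ n * fact ((s+2*t+1) + n) * fact (2 * (s+2*t+1)))"
    by (rule spoch_nat) (simp_all add: s_def t_def)
  have 4: "spoch (2*of_nat (x + 1) + 6*of_nat a + 2*of_nat t + 1) (int t - 1) =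
    fact (2 * ((s+t+1) + n)) * fact (s+t+1) / (2 ^ n * fact ((s+t+1) + n) * fact (2 * (s+t+1)))"
    by (rule spoch_nat) (simp_all add: s_def t_def)
  have 5: "(s+2*t+1) + n = s+3*t" "(s+t+1) + n = s+2*t" "2 * (s+3*t) = 2*s+6*t" "2 * (s+2*t) = 2*s+4*t"
     "2 * (s+2*t+1) = 2*s+4*t+2" "2 * (s+t+1) = 2*s+2*t+2"
    by (simp_all add: t_def)
  have f: "fact (2*t) = 2 * of_nat t * (fact (2*n+1) :: rat)" "fact t = of_nat t * (fact n :: rat)"
    "fact (2*s+2*t+2) = 2 * of_nat (s+t+1) * (fact (2*s+2*t+1) :: rat)"
    "fact (s+t+1) = of_nat (s+t+1) * (fact (s+t) :: rat)"
    using fact_Suc[of "2*n+1"] fact_Suc[of n] fact_Suc[of "2*s+2*t+1"] fact_Suc[of "s+t"] by (simp_all add: t_def)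
  have nz: "(of_nat t :: rat) \<noteq> 0" "(of_nat (s+t+1) :: rat) \<noteq> 0"
    unfolding of_nat_eq_0_iff by (simp_all add: t_def)
  let ?f = "\<lambda>i. (poch (2*of_nat (x + 1) + 6*of_nat a + 2*of_nat i) (int i)
        * spoch (2*of_nat (x + 1) + 6*of_nat a + 4*of_nat i + 1) (int i - 1))
     / (poch (of_nat i) (int i)
        * spoch (2*of_nat (x + 1) + 6*of_nat a + 2*of_nat i + 1) (int i - 1))"
  have "?f t / 2 = 2 * fact (2*s+3*t+1) * fact t * fact (2*s+6*t) * fact (s+2*t+1) * fact (s+2*t)
      / (fact (2*t) * fact (s+3*t) * fact (s+t) * fact (2*s+4*t+2) * fact (2*s+4*t))"
    unfolding 1 2 3 4 5 f using nz
    by (simp add: divide_simps del: fact_Suc of_nat_Suc of_nat_add)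
  then have "block_form (t + 1) 0 s = block_form t 0 s * (?f t / 2)"
    by (simp only: block_form_ratio)
  moreover have "(1 / 2 ^ Suc n) * prod ?f {1..Suc n} = ((1 / 2 ^ n) * prod ?f {1..n}) * (?f t / 2)"
    unfolding t_def by (simp add: prod.nat_ivl_Suc' del: of_nat_Suc of_nat_add)
  ultimately show ?case using Suc by (simp only: t_def s_def Suc_eq_plus1)
qed

lemma prod_reverse: "(\<Prod>i\<in>{1..a}. f i) = (\<Prod>j<a. f (Suc j))" "(\<Prod>i\<in>{1..a}. f i) = (\<Prod>j<a. f (a - j))"
  for f :: "nat \<Rightarrow> rat"
proof -
  show 1: "(\<Prod>i\<in>{1..a}. f i) = (\<Prod>j<a. f (Suc j))"
    by (simp add: lessThan_atLeast0 prod.atLeast_Suc_atMost_Suc_shift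
        prod.atLeast1_atMost_eq)
  also have "\<dots> = (\<Prod>j<a. f (Suc (a - Suc j)))"
    by (rule prod.nat_diff_reindex[symmetric])
  also have "\<dots> = (\<Prod>j<a. f (a - j))"
    by (intro prod.cong) (auto simp: Suc_diff_Suc)
  finally show "(\<Prod>i\<in>{1..a}. f i) = (\<Prod>j<a. f (a - j))" .
qed

lemma prod_fact_up:
  assumes "s > 0" "\<And>j. j < a \<Longrightarrow> g (Suc j) = c + s * j"
  shows "(\<Prod>i\<in>{1..a}. fact (g i)) = sfac s (c + s * a) / sfac s c"
  unfolding prod_reverse(1) using prod_fact_step[OF assms(1), of c a] assms(2) by simp

lemma prod_fact_down:
  assumes "s > 0" "\<And>j. j < a \<Longrightarrow> g (a - j) = c + s * j"
  shows "(\<Prod>i\<in>{1..a}. fact (g i)) = sfac s (c + s * a) / sfac s c"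
  unfolding prod_reverse(2) using prod_fact_step[OF assms(1), of c a] assms(2) by simp

text \<open>Each symbol is a quotient of factorials with arguments linear in \<open>i\<close>, so
  each product over \<open>i\<close> telescopes to a quotient of superfactorials whose step is the
  slope. Arguments decreasing in \<open>i\<close> are read backwards.\<close>

lemma second_product:
  "(\<Prod>i\<in>{1..a}.
       (poch (of_nat z + of_nat i) (int y + int a - 2*int i + 1)
        * poch (of_nat (x+1) + of_nat y + 2*of_nat z + 2*of_nat a + 2*of_nat i)
               (2*int y + 2*int a - 4*int i + 2)
        * poch (of_nat (x+1) + 3*of_nat i - 2) (int y - int i + 1)
        * poch (of_nat (x+1) + 3*of_nat y + 2*of_nat i - 1) (int i - 1))
     / (poch (of_nat i) (int y)
        * poch (of_nat y + 2*of_nat z + 2*of_nat i - 1) (int y + 2*int a - 4*int i + 3)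
        * poch (2*of_nat z + 2*of_nat i) (int y + 2*int a - 4*int i + 1)
        * poch (of_nat (x+1) + of_nat y + of_nat z + 2*of_nat a + of_nat i)
               (int y + int a - 2*int i + 1)))
  = (sfac (Suc 0) (z+y+a) * sfac (Suc 0) z * sfac 2 (x+3*y+2*z+4*a+2) * sfac 2 (x+y+2*z+2*a+2)
     * sfac 2 (x+y+1+2*a) * sfac 3 (x+1) * sfac 3 (x+3*y+1+3*a) * sfac 2 (x+3*y+1)
     * sfac (Suc 0) y * sfac (Suc 0) a * sfac 2 (2*y+2*z+1) * sfac 2 (2*z+1+2*a)
     * sfac (Suc 0) (x+2*y+z+2*a+1) * sfac (Suc 0) (x+y+z+3*a+1))
  / (sfac (Suc 0) (z+y) * sfac (Suc 0) (z+a) * sfac 2 (x+3*y+2*z+2*a+2) * sfac 2 (x+y+2*z+4*a+2)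
     * sfac 2 (x+y+1) * sfac 3 (x+1+3*a) * sfac 3 (x+3*y+1) * sfac 2 (x+3*y+1+2*a)
     * sfac (Suc 0) (y+a) * sfac 2 (2*y+2*z+1+2*a) * sfac 2 (2*z+1)
     * sfac (Suc 0) (x+2*y+z+3*a+1) * sfac (Suc 0) (x+y+z+2*a+1))"
  (is "prod ?f _ = ?R")
proof -
  have "prod ?f {1..a} = (\<Prod>i\<in>{1..a}.
      (fact (z+y+a-i) / fact (z+i-1) * (fact (x+3*y+2*z+4*a+2-2*i) / fact (x+y+2*z+2*a+2*i))
        * (fact (x+y+2*i-1) / fact (x+3*i-2)) * (fact (x+3*y+3*i-2) / fact (x+3*y+2*i-1)))
     / (fact (y+i-1) / fact (i-1) * (fact (2*y+2*z+2*a+1-2*i) / fact (y+2*z+2*i-2))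
        * (fact (y+2*z+2*a-2*i) / fact (2*z+2*i-1))
        * (fact (x+2*y+z+3*a+1-i) / fact (x+y+z+2*a+i))))"
  proof (rule prod.cong)
    fix i assume "i \<in> {1..a}"
    then have i: "1 \<le> i" "i \<le> a" by auto
    then obtain j where j: "i = Suc j" by (cases i) auto
    have "poch (of_nat z + of_nat i) (int y + int a - 2*int i + 1) = fact (z+y+a-i) / fact (z+i-1)"
      "poch (of_nat (x+1) + of_nat y + 2*of_nat z + 2*of_nat a + 2*of_nat i) (2*int y + 2*int a - 4*int i + 2)
        = fact (x+3*y+2*z+4*a+2-2*i) / fact (x+y+2*z+2*a+2*i)"
      "poch (of_nat (x+1) + 3*of_nat i - 2) (int y - int i + 1) = fact (x+y+2*i-1) / fact (x+3*i-2)"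
      "poch (of_nat (x+1) + 3*of_nat y + 2*of_nat i - 1) (int i - 1) = fact (x+3*y+3*i-2) / fact (x+3*y+2*i-1)"
      "poch (of_nat i) (int y) = fact (y+i-1) / fact (i-1)"
      "poch (of_nat y + 2*of_nat z + 2*of_nat i - 1) (int y + 2*int a - 4*int i + 3)
        = fact (2*y+2*z+2*a+1-2*i) / fact (y+2*z+2*i-2)"
      "poch (2*of_nat z + 2*of_nat i) (int y + 2*int a - 4*int i + 1) = fact (y+2*z+2*a-2*i) / fact (2*z+2*i-1)"
      "poch (of_nat (x+1) + of_nat y + of_nat z + 2*of_nat a + of_nat i) (int y + int a - 2*int i + 1)
        = fact (x+2*y+z+3*a+1-i) / fact (x+y+z+2*a+i)"
      using i by (intro poch_nat; simp add: j of_nat_diff)+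
    then show "?f i = (fact (z+y+a-i) / fact (z+i-1) * (fact (x+3*y+2*z+4*a+2-2*i) / fact (x+y+2*z+2*a+2*i))
        * (fact (x+y+2*i-1) / fact (x+3*i-2)) * (fact (x+3*y+3*i-2) / fact (x+3*y+2*i-1)))
     / (fact (y+i-1) / fact (i-1) * (fact (2*y+2*z+2*a+1-2*i) / fact (y+2*z+2*i-2))
        * (fact (y+2*z+2*a-2*i) / fact (2*z+2*i-1))
        * (fact (x+2*y+z+3*a+1-i) / fact (x+y+z+2*a+i)))"
      by (simp only:)
  qed simp
  also have "\<dots> = ?R"
  proof -
    have up:
      "(\<Prod>i\<in>{1..a}. fact (z+i-1)) = sfac (Suc 0) (z + Suc 0 * a) / sfac (Suc 0) z"
      "(\<Prod>i\<in>{1..a}. fact (x+y+2*z+2*a+2*i)) = sfac 2 (x+y+2*z+2*a+2 + 2*a) / sfac 2 (x+y+2*z+2*a+2)"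
      "(\<Prod>i\<in>{1..a}. fact (x+y+2*i-1)) = sfac 2 (x+y+1 + 2*a) / sfac 2 (x+y+1)"
      "(\<Prod>i\<in>{1..a}. fact (x+3*i-2)) = sfac 3 (x+1 + 3*a) / sfac 3 (x+1)"
      "(\<Prod>i\<in>{1..a}. fact (x+3*y+3*i-2)) = sfac 3 (x+3*y+1 + 3*a) / sfac 3 (x+3*y+1)"
      "(\<Prod>i\<in>{1..a}. fact (x+3*y+2*i-1)) = sfac 2 (x+3*y+1 + 2*a) / sfac 2 (x+3*y+1)"
      "(\<Prod>i\<in>{1..a}. fact (y+i-1)) = sfac (Suc 0) (y + Suc 0 * a) / sfac (Suc 0) y"
      "(\<Prod>i\<in>{1..a}. fact (i-1)) = sfac (Suc 0) (0 + Suc 0 * a) / sfac (Suc 0) 0"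
      "(\<Prod>i\<in>{1..a}. fact (y+2*z+2*i-2)) = sfac 2 (y+2*z + 2*a) / sfac 2 (y+2*z)"
      "(\<Prod>i\<in>{1..a}. fact (2*z+2*i-1)) = sfac 2 (2*z+1 + 2*a) / sfac 2 (2*z+1)"
      "(\<Prod>i\<in>{1..a}. fact (x+y+z+2*a+i)) = sfac (Suc 0) (x+y+z+2*a+1 + Suc 0 * a) / sfac (Suc 0) (x+y+z+2*a+1)"
      by (rule prod_fact_up; simp)+
    have down:
      "(\<Prod>i\<in>{1..a}. fact (z+y+a-i)) = sfac (Suc 0) (z+y + Suc 0 * a) / sfac (Suc 0) (z+y)"
      "(\<Prod>i\<in>{1..a}. fact (x+3*y+2*z+4*a+2-2*i)) = sfac 2 (x+3*y+2*z+2*a+2 + 2*a) / sfac 2 (x+3*y+2*z+2*a+2)"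
      "(\<Prod>i\<in>{1..a}. fact (2*y+2*z+2*a+1-2*i)) = sfac 2 (2*y+2*z+1 + 2*a) / sfac 2 (2*y+2*z+1)"
      "(\<Prod>i\<in>{1..a}. fact (y+2*z+2*a-2*i)) = sfac 2 (y+2*z + 2*a) / sfac 2 (y+2*z)"
      "(\<Prod>i\<in>{1..a}. fact (x+2*y+z+3*a+1-i)) = sfac (Suc 0) (x+2*y+z+2*a+1 + Suc 0 * a) / sfac (Suc 0) (x+2*y+z+2*a+1)"
      by (rule prod_fact_down; simp)+
    show ?thesis
      \<comment> \<open>The products of \<open>fact (y+2*z+2*i-2)\<close> and of
        \<open>fact (y+2*z+2*a-2*i)\<close> run through the same factors in opposite order and
        cancel.\<close>
      unfolding prod.distrib prod_dividef up down
      by (simp add: sfac_small divide_simps ac_simps)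
  qed
  finally show ?thesis .
qed

text \<open>\<open>gap_form\<close> has even arguments where \<open>second_product\<close> has odd
  ones. The doubling rule converts them, and its powers of two cancel against the one hidden in
  \<open>block_form\<close>.\<close>

theorem gap_form_eq_P1: "gap_form y (z + 1) a x = P1 (x + 1) y z a"
proof -
  have "sfac 2 (2*z+2*a+2) = 2^(z+a) * fact (z+a) * sfac 2 (2*z+2*a+1)"
    "sfac 2 (2*z+2) = 2^z * fact z * sfac 2 (2*z+1)"
    "sfac 2 (2*y+2*z+2*a+2) = 2^(y+z+a) * fact (y+z+a) * sfac 2 (2*y+2*z+2*a+1)"
    "sfac 2 (2*y+2*z+2) = 2^(y+z) * fact (y+z) * sfac 2 (2*y+2*z+1)"
    "sfac (Suc 0) (z+1) = sfac (Suc 0) (z) * fact z"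
    "sfac (Suc 0) (z+a+1) = sfac (Suc 0) (z+a) * fact (z+a)"
    "sfac (Suc 0) (y+z+a+1) = sfac (Suc 0) (y+z+a) * fact (y+z+a)"
    "sfac (Suc 0) (y+z+1) = sfac (Suc 0) (y+z) * fact (y+z)"
    "sfac (Suc 0) (x+3*y+3*z+3*a+3) = sfac 2 (x+3*y+3*z+3*a+3) * sfac 2 (x+3*y+3*z+3*a+4)"
    "sfac (Suc 0) (x+y+z+3*a+1) = sfac 2 (x+y+z+3*a+1) * sfac 2 (x+y+z+3*a+2)"
    by (rule sfac_rules; simp)+
  note e = this
  have "gap_form y (z + 1) a x =
     (sfac 3 (x+1) * sfac (Suc 0) (x+2*y+2*z+3*a+2) * sfac 2 (2*x+6*y+6*z+6*a+6)
       * sfac 3 (2*x+3*y+3*z+6*a+4) * sfac 2 (x+3*y+2*z+4*a+2) * sfac 2 (x+y+2*z+2*a+2)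
       * sfac 2 (x+y+2*a+1) * sfac 3 (x+3*y+3*a+1) * sfac 2 (x+3*y+1)
       * sfac (Suc 0) (x+2*y+z+2*a+1) * sfac (Suc 0) (a) * sfac (Suc 0) (y)
       * sfac 2 (2*z+2*a+2) * sfac (Suc 0) (z+1) * sfac (Suc 0) (y+z+a+1))
      / (sfac 3 (x+3*y+3*z+3*a+4) * sfac 2 (2*x+4*y+4*z+6*a+4) * sfac 3 (2*x+6*y+6*z+6*a+7)
       * sfac 2 (x+3*y+2*z+2*a+2) * sfac 2 (x+y+2*z+4*a+2) * sfac 2 (x+y+1)
       * sfac 3 (x+3*y+1) * sfac 2 (x+3*y+2*a+1) * sfac (Suc 0) (y+a)
       * sfac (Suc 0) (x+y+z+2*a+1) * sfac (Suc 0) (x+2*y+z+3*a+1) * sfac (Suc 0) (z+a+1)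
       * sfac 2 (2*z+2) * sfac 2 (2*y+2*z+2*a+2))"
    unfolding gap_form_def by (simp add: ac_simps)
  also have "\<dots> =
     (sfac 3 (x+3*a+1) * sfac (Suc 0) (y+z+1) * sfac 2 (x+3*y+3*z+3*a+3)
       * sfac (Suc 0) (x+2*y+2*z+3*a+2) * sfac 2 (x+3*y+3*z+3*a+4)
       * sfac 2 (2*x+6*y+6*z+6*a+6) * sfac 3 (2*x+3*y+3*z+6*a+4))
      / (sfac 3 (x+3*y+3*z+3*a+4) * sfac 2 (x+y+z+3*a+1) * sfac (Suc 0) (x+3*y+3*z+3*a+3)
       * sfac 2 (2*y+2*z+2) * sfac 2 (x+y+z+3*a+2) * sfac 2 (2*x+4*y+4*z+6*a+4)
       * sfac 3 (2*x+6*y+6*z+6*a+7))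
    * ((sfac (Suc 0) (y+z+a) * sfac (Suc 0) (z) * sfac 2 (x+3*y+2*z+4*a+2)
       * sfac 2 (x+y+2*z+2*a+2) * sfac 2 (x+y+2*a+1) * sfac 3 (x+1) * sfac 3 (x+3*y+3*a+1)
       * sfac 2 (x+3*y+1) * sfac (Suc 0) (y) * sfac (Suc 0) (a) * sfac 2 (2*y+2*z+1)
       * sfac 2 (2*z+2*a+1) * sfac (Suc 0) (x+2*y+z+2*a+1) * sfac (Suc 0) (x+y+z+3*a+1))
      / (sfac (Suc 0) (y+z) * sfac (Suc 0) (z+a) * sfac 2 (x+3*y+2*z+2*a+2)
       * sfac 2 (x+y+2*z+4*a+2) * sfac 2 (x+y+1) * sfac 3 (x+3*a+1) * sfac 3 (x+3*y+1)
       * sfac 2 (x+3*y+2*a+1) * sfac (Suc 0) (y+a) * sfac 2 (2*y+2*z+2*a+1)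
       * sfac 2 (2*z+1) * sfac (Suc 0) (x+2*y+z+3*a+1) * sfac (Suc 0) (x+y+z+2*a+1)))"
    by (simp only: e, simp add: divide_simps power_add ac_simps del: fact_Suc)
  also have "(sfac 3 (x+3*a+1) * sfac (Suc 0) (y+z+1) * sfac 2 (x+3*y+3*z+3*a+3)
       * sfac (Suc 0) (x+2*y+2*z+3*a+2) * sfac 2 (x+3*y+3*z+3*a+4)
       * sfac 2 (2*x+6*y+6*z+6*a+6) * sfac 3 (2*x+3*y+3*z+6*a+4))
      / (sfac 3 (x+3*y+3*z+3*a+4) * sfac 2 (x+y+z+3*a+1) * sfac (Suc 0) (x+3*y+3*z+3*a+3)
       * sfac 2 (2*y+2*z+2) * sfac 2 (x+y+z+3*a+2) * sfac 2 (2*x+4*y+4*z+6*a+4)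
       * sfac 3 (2*x+6*y+6*z+6*a+7))
    = block_form (y + z + 1) 0 (x + 3 * a)"
    by (simp add: block_form_def sfac_small ac_simps)
  finally show ?thesis
    unfolding P1_def first_product second_product by (simp add: ac_simps)
qed

section \<open>Counting lozenge tilings\<close>

abbreviation tiling_count :: "tri set \<Rightarrow> nat" where
  "tiling_count R \<equiv> card (lozenge_tilings R)"

lemma adj_sym: "adj p q \<longleftrightarrow> adj q p"
  by (auto simp: adj_def split: prod.splits)

lemma adj_irrefl: "\<not> adj p p"
  by (auto simp: adj_def split: prod.splits)

lemma tilingD_edge: "T \<in> lozenge_tilings R \<Longrightarrow> e \<in> T \<Longrightarrow> \<exists>p q. e = {p, q} \<and> p \<in> R \<and> q \<in> R \<and> adj p q"
  by (auto simp: lozenge_tilings_def)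

lemma tilingD_cover: "T \<in> lozenge_tilings R \<Longrightarrow> p \<in> R \<Longrightarrow> \<exists>!e. e \<in> T \<and> p \<in> e"
  by (auto simp: lozenge_tilings_def)

lemma tiling_unique:
  "T \<in> lozenge_tilings R \<Longrightarrow> e \<in> T \<Longrightarrow> e' \<in> T \<Longrightarrow> p \<in> e \<Longrightarrow> p \<in> e' \<Longrightarrow> e = e'"
  using tilingD_cover tilingD_edge by (metis insertE singletonD)

lemma tilingD_edge_at:
  assumes "T \<in> lozenge_tilings R" "e \<in> T" "p \<in> e"
  shows "\<exists>q. e = {p, q} \<and> q \<in> R \<and> adj p q"
  using tilingD_edge[OF assms(1,2)] assms(3) adj_sym by blast

lemma tilingI:
  assumes "\<And>e. e \<in> T \<Longrightarrow> \<exists>p q. e = {p, q} \<and> p \<in> R \<and> q \<in> R \<and> adj p q"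
    and "\<And>p. p \<in> R \<Longrightarrow> \<exists>e\<in>T. p \<in> e"
    and "\<And>p e e'. e \<in> T \<Longrightarrow> e' \<in> T \<Longrightarrow> p \<in> e \<Longrightarrow> p \<in> e' \<Longrightarrow> e = e'"
  shows "T \<in> lozenge_tilings R"
  unfolding lozenge_tilings_def using assms by blast

lemma lozenge_tilings_empty: "lozenge_tilings {} = {{}}"
  by (auto simp: lozenge_tilings_def)

lemma finite_lozenge_tilings: "finite R \<Longrightarrow> finite (lozenge_tilings R)"
  by (rule finite_subset[of _ "Pow (Pow R)"]) (auto simp: lozenge_tilings_def)

lemma tilings_containing:
  assumes "p \<in> R" "q \<in> R" "adj p q"
  shows "bij_betw (insert {p, q}) (lozenge_tilings (R - {p, q})) {T \<in> lozenge_tilings R. {p, q} \<in> T}"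
proof (rule bij_betwI[where g = "\<lambda>T. T - {{p, q}}"])
  have sub: "e \<subseteq> R - {p, q}" if "T \<in> lozenge_tilings (R - {p, q})" "e \<in> T" for T e
    using tilingD_edge[OF that] by auto
  show "insert {p, q} \<in> lozenge_tilings (R - {p, q}) \<rightarrow> {T \<in> lozenge_tilings R. {p, q} \<in> T}"
  proof (intro Pi_I CollectI conjI insertI1)
    fix T assume T: "T \<in> lozenge_tilings (R - {p, q})"
    show "insert {p, q} T \<in> lozenge_tilings R"
    proof (rule tilingI)
      fix e assume "e \<in> insert {p, q} T"
      then show "\<exists>p q. e = {p, q} \<and> p \<in> R \<and> q \<in> R \<and> adj p q"
        using tilingD_edge[OF T, of e] assms by blast
    next
      fix r assume "r \<in> R"
      then show "\<exists>e\<in>insert {p, q} T. r \<in> e" using tilingD_cover[OF T, of r] by blast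
    next
      fix r e e' assume "e \<in> insert {p, q} T" "e' \<in> insert {p, q} T" "r \<in> e" "r \<in> e'"
      then show "e = e'" using tiling_unique[OF T, of e e' r] sub[OF T, of e] sub[OF T, of e'] by blast
    qed
  qed
  show "(\<lambda>T. T - {{p, q}}) \<in> {T \<in> lozenge_tilings R. {p, q} \<in> T} \<rightarrow> lozenge_tilings (R - {p, q})"
  proof (intro Pi_I)
    fix T assume "T \<in> {T \<in> lozenge_tilings R. {p, q} \<in> T}"
    then have T: "T \<in> lozenge_tilings R" and pq: "{p, q} \<in> T" by auto
    have out: "r \<notin> {p, q}" if "e \<in> T - {{p, q}}" "r \<in> e" for e r
      using tiling_unique[OF T _ pq, of e r] that by blast
    show "T - {{p, q}} \<in> lozenge_tilings (R - {p, q})"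
    proof (rule tilingI)
      fix e assume e: "e \<in> T - {{p, q}}"
      then show "\<exists>p' q'. e = {p', q'} \<and> p' \<in> R - {p, q} \<and> q' \<in> R - {p, q} \<and> adj p' q'"
        using tilingD_edge[OF T, of e] out[OF e] by blast
    next
      fix r assume "r \<in> R - {p, q}"
      then show "\<exists>e\<in>T - {{p, q}}. r \<in> e" using tilingD_cover[OF T, of r] by blast
    qed (use tiling_unique[OF T] in blast)
  qed
  show "insert {p, q} T - {{p, q}} = T" if "T \<in> lozenge_tilings (R - {p, q})" for T
    using sub[OF that, of "{p, q}"] by blast
qed auto

lemma tiling_count_peel:
  assumes "finite R" "p \<in> R"
  shows "tiling_count R = (\<Sum>q\<in>{q\<in>R. adj p q}. tiling_count (R - {p, q}))"
proof -
  let ?N = "{q \<in> R. adj p q}"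
  let ?T = "\<lambda>q. {T \<in> lozenge_tilings R. {p, q} \<in> T}"
  have "lozenge_tilings R = (\<Union>q\<in>?N. ?T q)"
  proof -
    have "\<exists>q\<in>?N. {p, q} \<in> T" if T: "T \<in> lozenge_tilings R" for T
    proof -
      obtain e where "e \<in> T" "p \<in> e" using tilingD_cover[OF T assms(2)] by blast
      then show ?thesis using tilingD_edge_at[OF T, of e p] by blast
    qed
    then show ?thesis by blast
  qed
  then have "tiling_count R = card (\<Union>q\<in>?N. ?T q)" by simp
  also have "\<dots> = (\<Sum>q\<in>?N. card (?T q))"
  proof (rule card_UN_disjoint)
    show "\<forall>i\<in>?N. \<forall>j\<in>?N. i \<noteq> j \<longrightarrow> ?T i \<inter> ?T j = {}"
    proof (intro ballI impI equals0I)
      fix i j T assume "i \<noteq> j" "T \<in> ?T i \<inter> ?T j"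
      then have "{p, i} = {p, j}" using tiling_unique[of T R "{p, i}" "{p, j}" p] by blast
      then show False using \<open>i \<noteq> j\<close> by (simp add: doubleton_eq_iff)
    qed
  qed (use assms finite_lozenge_tilings[of R] in auto)
  also have "\<dots> = (\<Sum>q\<in>?N. tiling_count (R - {p, q}))"
    using bij_betw_same_card[OF tilings_containing[OF assms(2)]] by (intro sum.cong refl) simp
  finally show ?thesis .
qed

text \<open>All triangles \<open>f q\<close> have a single neighbour, so their lozenges can be
  removed together; the disjointness conditions keep one removal from affecting another
  pair.\<close>

lemma tiling_count_forced:
  assumes "finite R" "finite Q" "\<And>q. q \<in> Q \<Longrightarrow> f q \<in> R \<and> g q \<in> R \<and> {r \<in> R. adj (f q) r} = {g q}"
    "inj_on f Q" "inj_on g Q" "f ` Q \<inter> g ` Q = {}"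
  shows "tiling_count R = tiling_count (R - f ` Q - g ` Q)"
  using assms(2,1,3-)
proof (induction Q arbitrary: R rule: finite_induct)
  case (insert q Q)
  have "tiling_count R = (\<Sum>r\<in>{r\<in>R. adj (f q) r}. tiling_count (R - {f q, r}))"
    by (rule tiling_count_peel) (use insert.prems in auto)
  also have "\<dots> = tiling_count (R - {f q, g q})" using insert.prems(2)[of q] by simp
  also have "\<dots> = tiling_count (R - {f q, g q} - f ` Q - g ` Q)"
  proof (rule insert.IH)
    fix q' assume q': "q' \<in> Q"
    then have "f q' \<in> R" "g q' \<in> R" "{r \<in> R. adj (f q') r} = {g q'}"
      using insert.prems(2)[of q'] by auto
    moreover have "f q \<notin> f ` Q" "g q \<notin> g ` Q" "g q \<notin> f ` Q" "f q \<notin> g ` Q"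
      using insert.hyps(2) insert.prems(3-5) by auto
    then have "f q' \<noteq> f q" "g q' \<noteq> g q" "f q' \<noteq> g q" "g q' \<noteq> f q"
      using q' by (metis imageI)+
    moreover have "{r \<in> R - {f q, g q}. adj (f q') r} = {r \<in> R. adj (f q') r} - {f q, g q}" by blast
    ultimately show "f q' \<in> R - {f q, g q} \<and> g q' \<in> R - {f q, g q} \<and> {r \<in> R - {f q, g q}. adj (f q') r} = {g q'}"
      by auto
  qed (use insert.prems in \<open>auto\<close>)
  also have "R - {f q, g q} - f ` Q - g ` Q = R - f ` insert q Q - g ` insert q Q" by auto
  finally show ?case .
qed simp

section \<open>Tilings and determinants\<close>

lemma dt_column_zero:
  assumes "length rs = length cs" "c \<in> set cs" "\<And>r. r \<in> set rs \<Longrightarrow> f r c = 0"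
  shows "dt f rs cs = 0"
proof -
  obtain xs ys where "cs = xs @ c # ys" using split_list[OF assms(2)] by blast
  then show ?thesis
    using dt_transpose[OF assms(1)] dt_row_zero[of xs ys rs "\<lambda>c r. f r c" c] assms by simp
qed

section \<open>Lozenge paths and their determinant, level by level\<close>

type_synonym label = "int \<times> int"

text \<open>A path of lozenges crosses the edges of the third direction. Such an edge carries the common
  first two coordinates \<open>(a, b)\<close> of its two triangles; a path steps from the label \<open>(a, b)\<close> to
  \<open>(a + 1, b)\<close> or \<open>(a, b + 1)\<close>.\<close>

definition level :: "label \<Rightarrow> int" where
  "level p = fst p + snd p"

definition down :: "int \<Rightarrow> label \<Rightarrow> tri" where
  "down L p = (fst p, snd p, L + 1 - level p)"

definition up :: "int \<Rightarrow> label \<Rightarrow> tri" where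
  "up L p = (fst p, snd p, L + 2 - level p)"

lemma down_inj [simp]: "down L p = down L q \<longleftrightarrow> p = q"
  by (auto simp: down_def level_def prod_eq_iff)

lemma up_inj [simp]: "up L p = up L q \<longleftrightarrow> p = q"
  by (auto simp: up_def level_def prod_eq_iff)

lemma down_neq_up [simp]: "down L p \<noteq> up L q" "up L q \<noteq> down L p"
  by (auto simp: down_def up_def level_def)

lemma not_adj_down [simp]: "\<not> adj (down L p) (down L q)"
  by (auto simp: adj_def down_def level_def)

lemma not_adj_up [simp]: "\<not> adj (up L p) (up L q)"
  by (auto simp: adj_def up_def level_def)

lemma adj_down_up: "adj (down L p) (up L q) \<longleftrightarrow>
    q = p \<or> q = (fst p + 1, snd p) \<or> q = (fst p, snd p + 1)"
  by (cases p; cases q) (auto simp: adj_def down_def up_def level_def)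

lemma adj_up_down: "adj (up L q) (down L p) \<longleftrightarrow>
    q = p \<or> q = (fst p + 1, snd p) \<or> q = (fst p, snd p + 1)"
  using adj_down_up adj_sym by blast

text \<open>The intended \<open>v p c\<close> is the number of paths from \<open>p\<close> to
  \<open>end_label c\<close>; the assumptions ask for its Pascal rule and boundary values. Each end
  is the first label of its level, which makes the path that is absorbed there the last one in the
  list of positions.\<close>

locale path_region =
  fixes L :: int and D U :: "label set" and end_label :: "'c \<Rightarrow> label"
    and v :: "label \<Rightarrow> 'c \<Rightarrow> rat" and cs :: "'c list" and start :: int
  assumes finite_D: "finite D" and finite_U: "finite U"
    and up_down: "q \<in> U \<Longrightarrow> q \<notin> D \<Longrightarrow> q \<in> end_label ` set cs"
    and end_not_D: "c \<in> set cs \<Longrightarrow> end_label c \<notin> D"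
    and down_up: "q \<in> D \<Longrightarrow> start < level q \<Longrightarrow> q \<in> U"
    and pascal: "p \<in> D \<Longrightarrow> c \<in> set cs \<Longrightarrow> v p c = v (fst p + 1, snd p) c + v (fst p, snd p + 1) c"
    and v_outside: "p \<in> D \<Longrightarrow> c \<in> set cs \<Longrightarrow> q = (fst p + 1, snd p) \<or> q = (fst p, snd p + 1) \<Longrightarrow>
      q \<notin> U \<Longrightarrow> v q c = 0"
    and v_end: "c \<in> set cs \<Longrightarrow> c' \<in> set cs \<Longrightarrow> v (end_label c) c' = (if c = c' then 1 else 0)"
    and v_same_level: "q \<in> U \<Longrightarrow> c \<in> set cs \<Longrightarrow> level q = level (end_label c) \<Longrightarrow> q \<noteq> end_label c \<Longrightarrow> v q c = 0"
    and end_first: "q \<in> U \<Longrightarrow> c \<in> set cs \<Longrightarrow> level q = level (end_label c) \<Longrightarrow> q \<noteq> end_label c \<Longrightarrow>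
      fst (end_label c) < fst q"
    and ends_sorted: "sorted_wrt (\<lambda>c c'. level (end_label c') < level (end_label c)) cs"
begin

text \<open>The triangles not yet used when the paths have reached the level \<open>l\<close>, where \<open>P\<close> are the
  positions of the paths that still have to leave that level and \<open>B\<close> the positions already taken
  on the next one.\<close>

definition remaining :: "int \<Rightarrow> label set \<Rightarrow> label set \<Rightarrow> tri set" where
  "remaining l B P = down L ` (P \<union> {q \<in> D. l < level q}) \<union> up L ` ({q \<in> U. l < level q} - B)"

lemma finite_remaining: "finite P \<Longrightarrow> finite (remaining l B P)"
  using finite_D finite_U by (auto simp: remaining_def)

text \<open>Strictly decreasing levels fix the order of a list. When all paths have been absorbed,
  the rows thus stand in the order of the columns and the determinant is that of the
  identity.\<close>

lemma absorbed_all: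
  assumes "sorted_wrt (\<lambda>z z'. level z' < level z) Z" "set Z \<subseteq> end_label ` set cs" "length Z = length cs"
  shows "Z = map end_label cs"
proof -
  let ?lt = "\<lambda>z z' :: label. level z' < level z"
  have s: "sorted_wrt ?lt (map end_label cs)" using ends_sorted by (simp add: sorted_wrt_map)
  have distinct: "distinct xs" if "sorted_wrt ?lt xs" for xs
    using that by (induction xs) auto
  have "set Z = set (map end_label cs)"
    by (rule card_subset_eq)
       (use assms distinct_card[OF distinct[OF assms(1)]] distinct_card[OF distinct[OF s]] in auto)
  moreover have "xs = ys" if "sorted_wrt ?lt xs" "sorted_wrt ?lt ys" "set xs = set ys" for xs ys
    using that
  proof (induction xs arbitrary: ys)
    case (Cons x xs)
    then obtain y ys' where ys: "ys = y # ys'" by (cases ys) auto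
    have "x = y"
    proof (rule ccontr)
      assume "x \<noteq> y"
      then have "x \<in> set ys'" "y \<in> set xs" using Cons.prems(3) ys by auto
      then show False using Cons.prems(1,2) ys by fastforce
    qed
    moreover have "x \<notin> set xs" "y \<notin> set ys'" using Cons.prems(1,2) ys by auto
    ultimately have "set xs = set ys'" using Cons.prems(3) ys by auto
    then show ?case using Cons ys \<open>x = y\<close> by auto
  qed simp
  ultimately show ?thesis using assms(1) s by blast
qed

text \<open>The rows are \<open>B\<close> (paths already moved to the next level), \<open>P\<close>
  (paths still to be moved) and \<open>Z\<close> (absorbed paths). Moving the first path of
  \<open>P\<close> splits the count over the neighbours of its triangle and the determinant over the
  Pascal rule for its row.\<close>

lemma step_paths:
  assumes next_level: "\<And>A Z. sorted_wrt (\<lambda>p q. fst q < fst p) A \<Longrightarrow> set A \<subseteq> {q \<in> D. level q = l + 1} \<Longrightarrow>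
      sorted_wrt (\<lambda>z z'. level z' < level z) Z \<Longrightarrow> set Z \<subseteq> {q \<in> end_label ` set cs. level q \<le> l + 1} \<Longrightarrow>
      length A + length Z = length cs \<Longrightarrow>
      of_nat (tiling_count (remaining (l + 1) {} (set A))) = dt v (A @ Z) cs"
    and Z: "sorted_wrt (\<lambda>z z'. level z' < level z) Z" "set Z \<subseteq> {q \<in> end_label ` set cs. level q \<le> l}"
    and l: "start \<le> l"
  shows "sorted_wrt (\<lambda>p q. fst q < fst p) (B @ P) \<Longrightarrow> set P \<subseteq> {q \<in> D. level q = l} \<Longrightarrow>
      set B \<subseteq> {q \<in> U. level q = l + 1} \<Longrightarrow> length B + length P + length Z = length cs \<Longrightarrow>
      of_nat (tiling_count (remaining l (set B) (set P))) = dt v (B @ P @ Z) cs"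
proof (induction P arbitrary: B)
  case Nil
  \<comment> \<open>These labels of the next level are reached by no path. With all triangles of the
    current level used up, their up-pointing triangle can only be joined to the down-pointing one
    with the same label.\<close>
  define Q where "Q = {q \<in> U. level q = l + 1} - set B"
  let ?R = "remaining l (set B) {}"
  have nb: "{r \<in> ?R. adj (up L q) r} = (if q \<in> D then {down L q} else {})" if "q \<in> Q" for q
    using that by (auto simp: remaining_def Q_def adj_up_down level_def)
  show ?case
  proof (cases "Q \<subseteq> D")
    case False
    \<comment> \<open>A missed end point: its triangle has no neighbour left, so there is no tiling,
      and its column of the determinant is zero.\<close>
    then obtain q where q: "q \<in> Q" "q \<notin> D" by blast
    then obtain c where c: "c \<in> set cs" "q = end_label c" using up_down Q_def by blast
    have "tiling_count ?R = (\<Sum>r\<in>{r \<in> ?R. adj (up L q) r}. tiling_count (?R - {up L q, r}))"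
      by (rule tiling_count_peel[OF finite_remaining]) (use q in \<open>auto simp: remaining_def Q_def\<close>)
    also have "\<dots> = 0" unfolding nb[OF q(1)] using q(2) by simp
    finally have "tiling_count ?R = 0" .
    moreover have "dt v (B @ Z) cs = 0"
    proof (rule dt_column_zero)
      fix r assume "r \<in> set (B @ Z)"
      then consider "r \<in> set B" | "r \<in> set Z" by auto
      then show "v r c = 0"
      proof cases
        case 1
        then show ?thesis using Nil.prems(3) q c by (intro v_same_level) (auto simp: Q_def)
      next
        case 2
        then obtain c' where "c' \<in> set cs" "r = end_label c'" "level r \<le> l" using Z(2) by blast
        then show ?thesis using v_end[of c' c] c q by (auto simp: Q_def)
      qed
    qed (use c Nil.prems in auto)
    ultimately show ?thesis by simp
  next
    case True
    have "tiling_count ?R = tiling_count (?R - up L ` Q - down L ` Q)"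
    proof (rule tiling_count_forced)
      show "finite Q" using finite_U by (simp add: Q_def)
      fix q assume q: "q \<in> Q"
      then show "up L q \<in> ?R \<and> down L q \<in> ?R \<and> {r \<in> ?R. adj (up L q) r} = {down L q}"
        using nb[OF q] True by (auto simp: remaining_def Q_def)
    qed (auto simp: finite_remaining inj_on_def)
    also have "?R - up L ` Q - down L ` Q = remaining (l + 1) {} (set B \<inter> D)"
      using Nil.prems(3) l down_up by (fastforce simp: remaining_def Q_def)
    finally have count: "tiling_count ?R = tiling_count (remaining (l + 1) {} (set B \<inter> D))" .
    show ?thesis
    proof (cases "set B \<subseteq> D")
      case BD: True
      then have "set B \<inter> D = set B" by blast
      then have "of_nat (tiling_count ?R) = (of_nat (tiling_count (remaining (l + 1) {} (set B))) :: rat)"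
        using count by simp
      also have "\<dots> = dt v (B @ Z) cs"
        by (rule next_level) (use BD Nil.prems Z in auto)
      finally show ?thesis by simp
    next
      case False
      then obtain b where b: "b \<in> set B" "b \<notin> D" by blast
      then obtain c where c: "c \<in> set cs" "b = end_label c" using up_down Nil.prems(3) by blast
      have BU: "r \<in> U \<and> level r = l + 1" if "r \<in> set B" for r using Nil.prems(3) that by blast
      have smallest: "fst b < fst b'" if "b' \<in> set B" "b' \<noteq> b" for b'
      proof -
        have "b' \<in> U" "level b' = level b" using BU[OF that(1)] BU[OF b(1)] by simp_all
        then show ?thesis using end_first[of b' c] that(2) c by simp
      qed
      obtain A A' where B: "B = A @ b # A'" using split_list[OF b(1)] by blast
      \<comment> \<open>The end \<open>b\<close> has the smallest first coordinate on its level, so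
        it is the last row of \<open>B\<close> and becomes the head of \<open>Z\<close> without any
        exchange of rows, hence without a sign.\<close>
      have "A' = []"
        using smallest[of "hd A'"] Nil.prems(1) by (cases A') (auto simp: B sorted_wrt_append)
      then have BA: "B = A @ [b]" using B by simp
      have AD: "set A \<subseteq> D"
      proof
        fix p assume p: "p \<in> set A"
        then have "p \<noteq> b" "p \<in> U" "level p = l + 1" using Nil.prems(1,3) BA by (auto simp: sorted_wrt_append)
        show "p \<in> D"
        proof (rule ccontr)
          assume "p \<notin> D"
          then obtain c' where c': "c' \<in> set cs" "p = end_label c'" using up_down \<open>p \<in> U\<close> by blast
          then show False using end_first[of b c'] smallest[of p] \<open>p \<noteq> b\<close> p b BA \<open>level p = l + 1\<close> BU[of b]
            by auto
        qed
      qed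
      have "set B \<inter> D = set A" using AD b BA by auto
      then have "of_nat (tiling_count ?R) = (of_nat (tiling_count (remaining (l + 1) {} (set A))) :: rat)"
        using count by simp
      also have "\<dots> = dt v (A @ (b # Z)) cs"
      proof (rule next_level)
        show "sorted_wrt (\<lambda>z z'. level z' < level z) (b # Z)"
          using Z b Nil.prems(3) by fastforce
      qed (use AD Nil.prems Z BA b c in \<open>auto simp: sorted_wrt_append\<close>)
      finally show ?thesis using BA by simp
    qed
  qed
next
  case (Cons p P)
  let ?R = "remaining l (set B) (set (p # P))"
  let ?q1 = "(fst p + 1, snd p)" and ?q2 = "(fst p, snd p + 1)"
  have p: "p \<in> D" "level p = l" using Cons.prems(2) by auto
  have pP: "p \<notin> set P" using Cons.prems(1) by (auto simp: sorted_wrt_append)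
  let ?N = "{q \<in> {?q1, ?q2}. q \<in> U \<and> q \<notin> set B}"
  have nb: "{r \<in> ?R. adj (down L p) r} = up L ` ?N"
    using p by (auto simp: remaining_def adj_down_up level_def)
  have lq: "level ?q1 = l + 1" "level ?q2 = l + 1" using p by (auto simp: level_def)
  \<comment> \<open>A successor outside \<open>U\<close> has a zero row. A successor already
    occupied must be the last row of \<open>B\<close>, so two adjacent rows coincide. In both cases
    the tiling side has no such neighbour.\<close>
  have summand: "(if q \<in> ?N then of_nat (tiling_count (?R - {down L p, up L q})) else 0) = dt v (B @ q # P @ Z) cs"
    if q: "q \<in> {?q1, ?q2}" for q
  proof (cases "q \<in> ?N")
    case True
    have "?R - {down L p, up L q} = remaining l (set (B @ [q])) (set P)"
      using True pP p lq by (auto simp: remaining_def)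
    moreover have "of_nat (tiling_count (remaining l (set (B @ [q])) (set P))) = dt v ((B @ [q]) @ P @ Z) cs"
    proof (rule Cons.IH)
      have "fst q < fst b" if b: "b \<in> set B" for b
      proof -
        have "fst p < fst b" using Cons.prems(1) b by (auto simp: sorted_wrt_append)
        moreover have "b \<noteq> q" "level b = level q" using True b Cons.prems(3) lq q by auto
        ultimately show ?thesis using q by (auto simp: level_def prod_eq_iff)
      qed
      moreover have "fst p \<le> fst q" using q by auto
      ultimately show "sorted_wrt (\<lambda>p q. fst q < fst p) ((B @ [q]) @ P)"
        using Cons.prems(1) by (fastforce simp: sorted_wrt_append)
    qed (use Cons.prems True lq in auto)
    ultimately show ?thesis using True by simp
  next
    case False
    then consider "q \<notin> U" | "q \<in> set B" using q by blast
    then have "dt v (B @ q # P @ Z) cs = 0"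
    proof cases
      case 1
      then show ?thesis using v_outside[OF p(1)] q Cons.prems(4) by (intro dt_row_zero) auto
    next
      case 2
      obtain B1 B2 where B: "B = B1 @ q # B2" using split_list[OF 2] by blast
      have "B2 = []"
      proof (rule ccontr)
        assume "B2 \<noteq> []"
        then obtain b where b: "b \<in> set B2" by (cases B2) auto
        then have "fst b < fst q" "fst p < fst b" using Cons.prems(1) B by (auto simp: sorted_wrt_append)
        then show False using q by auto
      qed
      then show ?thesis using dt_equal_adjacent_rows[of B1 "P @ Z" cs v q q] B Cons.prems(4) by simp
    qed
    then show ?thesis unfolding if_not_P[OF False] by simp
  qed
  have "tiling_count ?R = (\<Sum>r\<in>up L ` ?N. tiling_count (?R - {down L p, r}))"
    unfolding nb[symmetric] by (rule tiling_count_peel[OF finite_remaining]) (auto simp: remaining_def)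
  also have "\<dots> = (\<Sum>q\<in>?N. tiling_count (?R - {down L p, up L q}))"
    by (subst sum.reindex) (auto simp: inj_on_def)
  also have "\<dots> = (\<Sum>q\<in>{?q1, ?q2}. if q \<in> ?N then tiling_count (?R - {down L p, up L q}) else 0)"
    by (rule sum.mono_neutral_cong_left) auto
  finally have "(of_nat (tiling_count ?R) :: rat) =
      (\<Sum>q\<in>{?q1, ?q2}. if q \<in> ?N then of_nat (tiling_count (?R - {down L p, up L q})) else 0)"
    by (simp add: of_nat_sum if_distrib cong: if_cong)
  also have "\<dots> = (\<Sum>q\<in>{?q1, ?q2}. dt v (B @ q # P @ Z) cs)"
    by (intro sum.cong summand) auto
  also have "\<dots> = dt v (B @ ?q1 # P @ Z) cs + dt v (B @ ?q2 # P @ Z) cs"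
    by simp
  also have "\<dots> = dt v (B @ p # P @ Z) cs"
    by (rule dt_row_add[symmetric]) (use Cons.prems(4) pascal[OF p(1)] in auto)
  finally show ?case by simp
qed

lemma count_from_level:
  assumes "start \<le> l" "sorted_wrt (\<lambda>p q. fst q < fst p) A" "set A \<subseteq> {q \<in> D. level q = l}"
    "sorted_wrt (\<lambda>z z'. level z' < level z) Z" "set Z \<subseteq> {q \<in> end_label ` set cs. level q \<le> l}"
    "length A + length Z = length cs"
  shows "of_nat (tiling_count (remaining l {} (set A))) = dt v (A @ Z) cs"
proof -
  obtain top where top: "\<And>q. q \<in> D \<union> U \<Longrightarrow> level q < top"
  proof -
    have "finite (level ` (D \<union> U))" using finite_D finite_U by simp
    then have "level q \<le> Max (level ` (D \<union> U))" if "q \<in> D \<union> U" for q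
      using that by (intro Max_ge) auto
    then show ?thesis using that[of "Max (level ` (D \<union> U)) + 1"] by fastforce
  qed
  show ?thesis using assms
  proof (induction "nat (top - l)" arbitrary: l A Z)
    case 0
    then have "A = []" using top by (cases A) fastforce+
    moreover have "remaining l {} {} = {}" using 0 top by (fastforce simp: remaining_def)
    moreover have "dt v Z cs = 1"
    proof -
      have Z: "Z = map end_label cs"
        by (rule absorbed_all) (use 0 \<open>A = []\<close> in auto)
      have "distinct cs" using ends_sorted by (induction cs) auto
      then show ?thesis unfolding Z
        by (intro dt_permuted_unit_rows) (auto simp: v_end nth_eq_iff_index_eq)
    qed
    ultimately show ?case by (simp add: lozenge_tilings_empty)
  next
    case (Suc k)
    have "of_nat (tiling_count (remaining l (set []) (set A))) = dt v ([] @ A @ Z) cs"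
    proof (rule step_paths)
      fix A Z assume "sorted_wrt (\<lambda>p q. fst q < fst p) A" "set A \<subseteq> {q \<in> D. level q = l + 1}"
        "sorted_wrt (\<lambda>z z'. level z' < level z) Z" "set Z \<subseteq> {q \<in> end_label ` set cs. level q \<le> l + 1}"
        "length A + length Z = length cs"
      then show "of_nat (tiling_count (remaining (l + 1) {} (set A))) = dt v (A @ Z) cs"
        using Suc by (intro Suc.hyps(1)) auto
    qed (use Suc.prems in auto)
    then show ?case by simp
  qed
qed

end

definition ibin :: "int \<Rightarrow> int \<Rightarrow> rat" where
  "ibin n k = (if 0 \<le> k \<and> k \<le> n then of_nat (nat n choose nat k) else 0)"

lemma ibin_nat: "ibin (int n) (int k) = of_nat (n choose k)"
  by (simp add: ibin_def binomial_eq_0)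

lemma ibin_nonzero: "ibin n k \<noteq> 0 \<Longrightarrow> 0 \<le> k \<and> k \<le> n"
  by (simp add: ibin_def split: if_splits)

text \<open>The bound matters: row 0 has the entry 1 at \<open>k = 0\<close>, whereas all entries of
  row -1 are zero by convention.\<close>

lemma ibin_pascal:
  assumes "1 \<le> n"
  shows "ibin n k = ibin (n - 1) k + ibin (n - 1) (k - 1)"
proof (cases "0 \<le> k")
  case True
  define m j where "m = nat (n - 1)" and "j = nat k"
  have n: "n = int (Suc m)" "n - 1 = int m" and k: "k = int j"
    using assms True by (simp_all add: m_def j_def)
  show ?thesis
  proof (cases j)
    case 0
    then show ?thesis unfolding n k by (simp only: ibin_nat) (simp add: ibin_def)
  next
    case (Suc i)
    have "ibin (int (Suc m)) (int (Suc i)) = ibin (int m) (int (Suc i)) + ibin (int m) (int i)"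
      unfolding ibin_nat by simp
    moreover have "k = int (Suc i)" "k - 1 = int i" using k Suc by simp_all
    ultimately show ?thesis using n by metis
  qed
qed (simp add: ibin_def)

lemma ibin_diff:
  assumes "int K = k" "int n = m" "2 * K \<le> n"
  shows "ibin m k - ibin m (k - 1) = of_nat (n + 1 - 2 * K) * fact n / (fact K * fact (n + 1 - K))"
proof -
  have nm: "nat m = n" "nat k = K" using assms by auto
  have c: "of_nat (n choose K) = (fact n / (fact K * fact (n - K)) :: rat)"
    by (rule binomial_fact) (use assms in simp)
  have f: "fact (n + 1 - K) = of_nat (n + 1 - K) * (fact (n - K) :: rat)"
    using fact_Suc[of "n - K"] assms by (simp add: Suc_diff_le)
  show ?thesis
  proof (cases K)
    case 0
    then show ?thesis using assms nm f by (simp add: ibin_def)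
  next
    case (Suc K')
    have c': "of_nat (n choose K') = (fact n / (fact K' * fact (n - K')) :: rat)"
      by (rule binomial_fact) (use assms Suc in simp)
    have "n - K' = n + 1 - K" using Suc by simp
    then have "of_nat (n choose K') = of_nat K * (fact n / (fact K * fact (n + 1 - K)) :: rat)"
      unfolding c' Suc by (simp add: divide_simps)
    moreover have "of_nat (n choose K) = of_nat (n + 1 - K) * (fact n / (fact K * fact (n + 1 - K)) :: rat)"
      unfolding c f using assms by (simp add: divide_simps)
    moreover have "(of_nat (n + 1 - 2 * K) :: rat) = of_nat (n + 1 - K) - of_nat K"
      using assms by (simp add: of_nat_diff)
    moreover have "ibin m k - ibin m (k - 1) = of_nat (n choose K) - of_nat (n choose K')"
      using assms nm Suc by (auto simp: ibin_def nat_diff_distrib)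
    ultimately have "ibin m k - ibin m (k - 1) =
        of_nat (n + 1 - 2 * K) * (fact n / (fact K * fact (n + 1 - K)))"
      by (simp only: left_diff_distrib)
    then show ?thesis by simp
  qed
qed

section \<open>The fundamental domain\<close>

definition chamber :: "nat \<Rightarrow> nat \<Rightarrow> nat \<Rightarrow> nat \<Rightarrow> tri set" where
  "chamber t y a x = {(u1, u2, u3). (u1, u2, u3) \<in> regionH (2*t) y (2*a) (2*x) \<and> u1 < u2 \<and> u2 < u3}"

text \<open>In increasing order only the smallest coordinate decides about the central hole, and
  only the southern satellite meets the sextant: triangles of the other two would have
  \<open>u1\<close> beyond \<open>2*t + 2*a\<close>, hence lie in the central hole.\<close>

lemma chamber_iff:
  "(u1, u2, u3) \<in> chamber t y a x \<longleftrightarrow>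
    (u1 + u2 + u3 = 6*int t + 2*int x + 6*int a + 1 \<or> u1 + u2 + u3 = 6*int t + 2*int x + 6*int a + 2) \<and>
    1 \<le> u1 \<and> u1 < u2 \<and> u2 < u3 \<and> u3 \<le> 4*int t + 2*int x + 6*int a \<and> u1 \<le> 2*int t + 2*int a \<and>
    \<not> (2*int t - 2*int y + 1 \<le> u1 \<and> 2*int t + 2*int a + int y + int x + 1 \<le> u2)"
  (is "_ \<longleftrightarrow> ?R")
proof (cases "u1 < u2 \<and> u2 < u3")
  case True
  have 1: "in_sat (2*t) y (2*a) (2*x) u1 u2 u3 \<longleftrightarrow>
      2*int t - 2*int y + 1 \<le> u1 \<and> 2*int t + 2*int a + int y + int x + 1 \<le> u2"
    using True unfolding in_sat_def by auto
  have 2: "in_sat (2*t) y (2*a) (2*x) u2 u3 u1 \<Longrightarrow> 2*int t + 2*int a + 1 \<le> u1"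
    "in_sat (2*t) y (2*a) (2*x) u3 u1 u2 \<Longrightarrow> 2*int t + 2*int a + 1 \<le> u1"
    unfolding in_sat_def by simp_all
  have 3: "3 * int (2*t) + int (2*x) + 3 * int (2*a) = 6*int t + 2*int x + 6*int a"
    "6*int t + 2*int x + 6*int a - int (2*t) = 4*int t + 2*int x + 6*int a"
    "int (2*t) + int (2*a) + 1 = 2*int t + 2*int a + 1" by simp_all
  have "(u1, u2, u3) \<in> chamber t y a x \<longleftrightarrow>
    (u1 + u2 + u3 = 6*int t + 2*int x + 6*int a + 1 \<or> u1 + u2 + u3 = 6*int t + 2*int x + 6*int a + 2) \<and>
    1 \<le> u1 \<and> u3 \<le> 4*int t + 2*int x + 6*int a \<and> \<not> 2*int t + 2*int a + 1 \<le> u1 \<and>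
    \<not> in_sat (2*t) y (2*a) (2*x) u1 u2 u3"
    unfolding chamber_def regionH_def Let_def mem_Collect_eq prod.case 3 using True 2 by (meson le_less_trans less_le_trans less_imp_le order_trans)
  then show ?thesis using True unfolding 1 by (simp add: not_le)
qed (auto simp: chamber_def)

locale wedge =
  fixes t y a x :: nat
  assumes y_less: "y < t"
begin

text \<open>The column \<open>k\<close> belongs to the end point number \<open>j = t + a - k\<close> on the vertical axis, counted from
  the southern side; reversing the order makes the first column the end point next to the central hole.\<close>

definition "N = 3*int t + int x + 3*int a"
definition "D = {q. down (2*N) q \<in> chamber t y a x}"
definition "U = {q. up (2*N) q \<in> chamber t y a x}"
definition "columns = [0..<y] @ [y + a..<t + a]"
definition "axis k = (2*(int t + int a - int k) - 1, N + 1 - (int t + int a - int k))"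
text \<open>The reflection principle for walks with unit steps to the end \<open>axis k\<close> that
  avoid the line of equal coordinates: the second binomial coefficient counts all walks from the
  mirrored starting label.\<close>

definition walks :: "label \<Rightarrow> nat \<Rightarrow> rat" where
  "walks p k = ibin (N + (int t + int a - int k) - level p) (2*(int t + int a - int k) - 1 - fst p)
     - ibin (N + (int t + int a - int k) - level p) (2*(int t + int a - int k) - 1 - snd p)"

lemma D_iff: "(p, q) \<in> D \<longleftrightarrow> 1 \<le> p \<and> p < q \<and> q < 2*N + 1 - p - q \<and> 2*int t + 1 \<le> p + q \<and> p \<le> 2*int t + 2*int a \<and>
    \<not> (2*int t - 2*int y + 1 \<le> p \<and> 2*int t + 2*int a + int y + int x + 1 \<le> q)"
  unfolding D_def down_def level_def mem_Collect_eq fst_conv snd_conv chamber_iff N_def by auto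

lemma U_iff: "(p, q) \<in> U \<longleftrightarrow> 1 \<le> p \<and> p < q \<and> q < 2*N + 2 - p - q \<and> 2*int t + 2 \<le> p + q \<and> p \<le> 2*int t + 2*int a \<and>
    \<not> (2*int t - 2*int y + 1 \<le> p \<and> 2*int t + 2*int a + int y + int x + 1 \<le> q)"
  unfolding U_def up_def level_def mem_Collect_eq fst_conv snd_conv chamber_iff N_def by auto

lemma U_bounds:
  assumes "(p, q) \<in> U"
  shows "1 \<le> p" "p < q" "p + 2*q < 2*N + 2" "2*int t + 2 \<le> p + q" "p \<le> 2*int t + 2*int a"
    "p \<le> 2*int t - 2*int y \<or> q \<le> 2*int t + 2*int a + int y + int x"
  using assms by (auto simp: U_iff)

lemma D_bounds:
  assumes "(p, q) \<in> D"
  shows "1 \<le> p" "p < q" "p + 2*q < 2*N + 1" "2*int t + 1 \<le> p + q" "p \<le> 2*int t + 2*int a"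
    "p \<le> 2*int t - 2*int y \<or> q \<le> 2*int t + 2*int a + int y + int x"
  using assms by (auto simp: D_iff)

lemma chamber_eq: "chamber t y a x = down (2*N) ` D \<union> up (2*N) ` U"
proof -
  have "u \<in> down (2*N) ` D \<union> up (2*N) ` U" if u: "u \<in> chamber t y a x" for u
  proof -
    obtain u1 u2 u3 where [simp]: "u = (u1, u2, u3)" by (cases u)
    have "u = down (2*N) (u1, u2) \<or> u = up (2*N) (u1, u2)"
      using u by (auto simp: chamber_iff down_def up_def level_def N_def)
    then show ?thesis using u by (auto simp: D_def U_def)
  qed
  then show ?thesis by (auto simp: D_def U_def)
qed

lemma columns_iff: "k \<in> set columns \<longleftrightarrow> k < y \<or> y + a \<le> k \<and> k < t + a"
  using y_less by (auto simp: columns_def)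

text \<open>Coordinates never decrease along a walk. For the reflected term the bounds come from
  \<open>3 * J \<le> N\<close>, which says that the end number \<open>J\<close> lies far enough from
  the wall.\<close>

lemma walks_nonzero:
  assumes "walks (p, q) k \<noteq> 0" "p \<le> q" "k < t + a"
  shows "p \<le> 2*(int t + int a - int k) - 1" "q \<le> N + 1 - (int t + int a - int k)"
proof -
  define J where "J = int t + int a - int k"
  have J: "J \<ge> 1" "3 * J \<le> N" using assms(3) by (simp_all add: J_def N_def)
  from assms(1) have "ibin (N + J - (p + q)) (2*J - 1 - p) \<noteq> 0 \<or> ibin (N + J - (p + q)) (2*J - 1 - q) \<noteq> 0"
    unfolding walks_def level_def J_def[symmetric] fst_conv snd_conv by force
  then have "p \<le> 2*J - 1 \<and> q \<le> N + 1 - J"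
    using ibin_nonzero[of "N + J - (p + q)" "2*J - 1 - p"] ibin_nonzero[of "N + J - (p + q)" "2*J - 1 - q"] J assms(2)
    by linarith
  then show "p \<le> 2*(int t + int a - int k) - 1" "q \<le> N + 1 - (int t + int a - int k)"
    by (simp_all add: J_def)
qed

lemma walks_diagonal: "walks (p, p) k = 0"
  by (simp add: walks_def)

lemma walks_pascal:
  assumes "p + q < N + (int t + int a - int k)"
  shows "walks (p, q) k = walks (p + 1, q) k + walks (p, q + 1) k"
proof -
  define n where "n = N + (int t + int a - int k) - (p + q)"
  have n: "1 \<le> n" using assms by (simp add: n_def)
  have "N + (int t + int a - int k) - (p + 1 + q) = n - 1" "N + (int t + int a - int k) - (p + (q + 1)) = n - 1"
    by (simp_all add: n_def)
  then show ?thesis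
    using ibin_pascal[OF n, of "2*(int t + int a - int k) - 1 - p"] ibin_pascal[OF n, of "2*(int t + int a - int k) - 1 - q"]
    by (simp add: walks_def level_def n_def[symmetric] algebra_simps)
qed

lemma walks_past:
  assumes "N + (int t + int a - int k) < p + q"
  shows "walks (p, q) k = 0"
  using assms by (simp add: walks_def ibin_def level_def)

lemma walks_at_level:
  assumes "N + (int t + int a - int k) = p + q"
  shows "walks (p, q) k = (if p = 2*(int t + int a - int k) - 1 then 1 else 0) -
      (if q = 2*(int t + int a - int k) - 1 then 1 else 0)"
  using assms by (auto simp: walks_def ibin_def level_def)

lemma finite_labels: "finite D" "finite U"
proof -
  have "D \<subseteq> {1..2*int t + 2*int a} \<times> {1..2*N}" "U \<subseteq> {1..2*int t + 2*int a} \<times> {1..2*N}"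
    by (auto simp: D_iff U_iff)
  then show "finite D" "finite U"
    by (auto intro: finite_subset[of _ "{1..2*int t + 2*int a} \<times> {1..2*N}"])
qed

text \<open>Such a triangle borders the vertical axis, where \<open>p + 2*q = 2*N + 1\<close> makes
  \<open>p\<close> odd. The central hole bounds the end number above, and the satellite removes
  \<open>a\<close> consecutive numbers.\<close>

lemma up_only_axis:
  assumes "(p, q) \<in> U" "(p, q) \<notin> D"
  shows "(p, q) \<in> axis ` set columns"
proof -
  have pq: "p + 2*q = 2*N + 1" using assms by (auto simp: U_iff D_iff)
  define k where "k = nat (int t + int a - (N + 1 - q))"
  have k: "int k = int t + int a - (N + 1 - q)" "p = 2 * (N + 1 - q) - 1"
    using assms pq by (auto simp: U_iff k_def)
  have "(p, q) = axis k" using k by (simp add: axis_def)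
  moreover have "int k < int t + int a"
    using U_bounds[OF assms(1)] k by linarith
  moreover have "int k < int y \<or> int y + int a \<le> int k"
    using U_bounds(6)[OF assms(1)] k unfolding N_def by auto
  ultimately have "(p, q) = axis k" "k \<in> set columns" unfolding columns_iff by auto
  then show ?thesis by blast
qed

lemma axis_not_down: "axis k \<notin> D"
  by (auto simp: axis_def D_iff)

lemma down_imp_up: "(p, q) \<in> D \<Longrightarrow> 2*int t + 1 < p + q \<Longrightarrow> (p, q) \<in> U"
  unfolding D_iff U_iff N_def by auto

lemma column_less: "k \<in> set columns \<Longrightarrow> k < t + a"
  using y_less by (auto simp: columns_iff)

lemma walks_down:
  assumes r: "(p, q) \<in> D" and k: "k < t + a"
  shows "walks (p, q) k = walks (p + 1, q) k + walks (p, q + 1) k"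
proof (cases "p + q" "N + (int t + int a - int k)" rule: linorder_cases)
  case less
  then show ?thesis by (rule walks_pascal)
next
  case equal
  define J where "J = int t + int a - int k"
  have J: "J \<ge> 1" "3 * J \<le> N" using k by (simp_all add: J_def N_def)
  have "p \<noteq> 2*J - 1"
    using D_bounds[OF r] equal[folded J_def] J by linarith
  moreover have "q \<noteq> 2*J - 1"
    using D_bounds[OF r] equal[folded J_def] J by linarith
  ultimately have "walks (p, q) k = 0" using equal by (simp add: walks_at_level J_def)
  moreover have "walks (p + 1, q) k = 0" "walks (p, q + 1) k = 0"
    using equal by (auto intro: walks_past)
  ultimately show ?thesis by simp
next
  case greater
  then show ?thesis by (simp add: walks_past)
qed

text \<open>Both holes are closed under increasing \<open>p\<close> and \<open>q\<close> inside the
  sextant and contain no end of a column, so no walk to such an end can enter them. Thus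
  \<open>walks\<close> sees the holes only through the choice of columns.\<close>

lemma walks_blocked:
  assumes r: "(p0, q0) \<in> D" and k: "k \<in> set columns"
    and pq: "p = p0 + 1 \<and> q = q0 \<or> p = p0 \<and> q = q0 + 1" and out: "(p, q) \<notin> U"
  shows "walks (p, q) k = 0"
proof (rule ccontr)
  assume nz: "walks (p, q) k \<noteq> 0"
  have "1 \<le> p0" "2*int t + 1 \<le> p0 + q0" "p0 < q0" using r by (simp_all add: D_iff)
  then have low: "1 \<le> p" "2*int t + 2 \<le> p + q" "p \<le> q"
    using pq by auto
  have "p \<noteq> q" using nz walks_diagonal by auto
  define J where "J = int t + int a - int k"
  have J: "J \<le> int t - int y \<or> int t + int a - int y + 1 \<le> J" "J \<le> int t + int a"
    using k y_less by (auto simp: columns_iff J_def)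
  have w: "p \<le> 2*J - 1" "q \<le> N + 1 - J"
    using walks_nonzero[OF nz low(3) column_less[OF k]] by (simp_all add: J_def)
  have "p < q" using low(3) \<open>p \<noteq> q\<close> by simp
  moreover have "q < 2*N + 2 - p - q" using w by linarith
  moreover have "p \<le> 2*int t + 2*int a" using w J(2) by linarith
  moreover have "\<not> (2*int t - 2*int y + 1 \<le> p \<and> 2*int t + 2*int a + int y + int x + 1 \<le> q)"
    using J(1) w unfolding N_def by auto
  ultimately show False using out low unfolding U_iff by blast
qed

lemma walks_axis:
  assumes "k < t + a" "k' < t + a"
  shows "walks (axis k) k' = (if k = k' then 1 else 0)"
proof -
  define J J' where "J = int t + int a - int k" and "J' = int t + int a - int k'"
  have J: "1 \<le> J" "3 * J \<le> N" "1 \<le> J'" "3 * J' \<le> N" using assms by (simp_all add: J_def J'_def N_def)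
  have "walks (axis k) k' = ibin (J' - J) (2 * (J' - J)) - ibin (J' - J) (2*J' + J - N - 2)"
    by (simp add: walks_def axis_def level_def J_def J'_def algebra_simps)
  moreover have "ibin (J' - J) (2*J' + J - N - 2) = 0"
    using ibin_nonzero[of "J' - J" "2*J' + J - N - 2"] J by linarith
  moreover have "ibin (J' - J) (2 * (J' - J)) = (if k = k' then 1 else 0)"
    by (auto simp: ibin_def J_def J'_def)
  ultimately show ?thesis by simp
qed

lemma same_level_as_axis:
  assumes "(p, q) \<in> U" "k < t + a" "p + q = level (axis k)" "(p, q) \<noteq> axis k"
  shows "walks (p, q) k = 0" "fst (axis k) < p"
proof -
  define J where "J = int t + int a - int k"
  have J: "1 \<le> J" "3 * J \<le> N" using assms by (simp_all add: J_def N_def)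
  have l: "N + J = p + q" using assms(3) by (simp add: level_def axis_def J_def)
  have p: "p \<noteq> 2*J - 1" using assms(4) l by (auto simp: axis_def J_def)
  then have lt: "2*J - 1 < p" using U_bounds[OF assms(1)] l by linarith
  then show "fst (axis k) < p" by (simp add: axis_def J_def)
  have "q \<noteq> 2*J - 1" using U_bounds[OF assms(1)] lt by linarith
  then show "walks (p, q) k = 0"
    using walks_at_level[of k p q] l p by (simp add: J_def)
qed

sublocale path_region "2*N" D U axis walks columns "2*int t + 1"
proof
  show "r \<in> axis ` set columns" if "r \<in> U" "r \<notin> D" for r
    using up_only_axis[of "fst r" "snd r"] that by simp
  show "r \<in> U" if "r \<in> D" "2*int t + 1 < level r" for r
    using down_imp_up[of "fst r" "snd r"] that by (simp add: level_def)
  show "walks r k = walks (fst r + 1, snd r) k + walks (fst r, snd r + 1) k" if "r \<in> D" "k \<in> set columns" for r k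
    using walks_down[of "fst r" "snd r" k] column_less that by simp
  show "walks q k = 0" if "r \<in> D" "k \<in> set columns" "q = (fst r + 1, snd r) \<or> q = (fst r, snd r + 1)" "q \<notin> U" for r k q
    using walks_blocked[of "fst r" "snd r" k "fst q" "snd q"] that by auto
  show "walks (axis k) k' = (if k = k' then 1 else 0)" if "k \<in> set columns" "k' \<in> set columns" for k k'
    using walks_axis column_less that by simp
  show "walks r k = 0" "fst (axis k) < fst r"
    if "r \<in> U" "k \<in> set columns" "level r = level (axis k)" "r \<noteq> axis k" for r k
    using same_level_as_axis[of "fst r" "snd r" k] column_less that by (simp_all add: level_def[of r])
  have "sorted_wrt (<) columns"
    unfolding columns_def sorted_wrt_append by (intro conjI ballI sorted_wrt_upt) simp
  then show "sorted_wrt (\<lambda>c c'. level (axis c') < level (axis c)) columns"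
    by (rule sorted_wrt_mono_rel[rotated]) (simp add: axis_def level_def)
qed (simp_all add: finite_labels axis_not_down)

lemma count_chamber:
  "of_nat (tiling_count (chamber t y a x)) = dt walks (map (\<lambda>i. (int t - int i, int t + 1 + int i)) [0..<t]) columns"
proof -
  \<comment> \<open>The half of a short side of the hexagon inside the sextant: its \<open>t\<close>
    down-pointing triangles have no up-pointing one with the same label, so a path starts at each of
    them.\<close>
  define A where "A = map (\<lambda>i. (int t - int i, int t + 1 + int i)) [0..<t]"
  have 1: "(p, q) \<in> set A" if "(p, q) \<in> D" "p + q = 2*int t + 1" for p q
    using that by (auto simp: A_def D_iff image_iff intro!: bexI[of _ "nat (int t - p)"])
  have 2: "(p, q) \<in> D \<and> p + q = 2*int t + 1" if "(p, q) \<in> set A" for p q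
    using that y_less by (auto simp: A_def D_iff N_def)
  have A: "set A = {q \<in> D. level q = 2*int t + 1}"
    using 1 2 by (auto simp: level_def)
  have "of_nat (tiling_count (remaining (2*int t + 1) {} (set A))) = dt walks (A @ []) columns"
  proof (rule count_from_level)
    show "sorted_wrt (\<lambda>p q. fst q < fst p) A"
      unfolding A_def sorted_wrt_map by (rule sorted_wrt_mono_rel[of _ "(<)"]) auto
    show "length A + length [] = length columns" using y_less by (simp add: A_def columns_def)
  qed (use A in auto)
  moreover have "{q \<in> D. level q = 2*int t + 1} \<union> {q \<in> D. 2*int t + 1 < level q} = D"
    by (auto simp: level_def D_iff)
  moreover have "{q \<in> U. 2*int t + 1 < level q} = U"
    by (auto simp: level_def U_iff)
  ultimately have "of_nat (tiling_count (chamber t y a x)) = dt walks A columns"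
    unfolding chamber_eq remaining_def A by simp
  then show ?thesis unfolding A_def .
qed

text \<open>Iterating the Pascal rule up to the starting level gives only \<open>u \<ge> p\<close>,
  and \<open>u = p\<close> is reached by the straight walk alone, with coefficient 1. On the wall
  the value is zero, so all coefficients may be zero there.\<close>

lemma walks_expand:
  assumes "1 \<le> p" "p \<le> q" "p + q \<le> 2*int t + 1"
  shows "\<exists>c. (\<forall>k\<in>set columns. walks (p, q) k = (\<Sum>u\<in>{p..int t}. c u * walks (u, 2*int t + 1 - u) k)) \<and> (p < q \<longrightarrow> c p = (1 :: rat))"
  using assms
proof (induction "nat (2*int t + 1 - (p + q))" arbitrary: p q)
  case 0
  then have "q = 2*int t + 1 - p" by auto
  moreover from this have "p \<noteq> q" by presburger
  ultimately have pq: "q = 2*int t + 1 - p" "p < q" using 0 by auto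
  have "(\<Sum>u\<in>{p..int t}. (if u = p then 1 else 0) * walks (u, 2*int t + 1 - u) k) = walks (p, q) k" for k
  proof -
    have "(\<Sum>u\<in>{p..int t}. (if u = p then 1 else 0) * walks (u, 2*int t + 1 - u) k) =
      (\<Sum>u\<in>{p..int t}. if u = p then walks (p, q) k else 0)"
      using pq by (intro sum.cong) auto
    then show ?thesis using 0 pq by simp
  qed
  then show ?case by (intro exI[of _ "\<lambda>u. if u = p then 1 else 0"]) auto
next
  case (Suc n)
  show ?case
  proof (cases "p = q")
    case True
    then show ?thesis by (intro exI[of _ "\<lambda>_. 0"]) (simp add: walks_diagonal)
  next
    case False
    then have less: "p < q" using Suc.prems by simp
    have le: "p + q \<le> 2*int t" "n = nat (2*int t + 1 - (p + q + 1))" using Suc.hyps(2) by auto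
    obtain c1 where c1: "\<And>k. k \<in> set columns \<Longrightarrow> walks (p + 1, q) k = (\<Sum>u\<in>{p+1..int t}. c1 u * walks (u, 2*int t + 1 - u) k)"
      using Suc.hyps(1)[of "p + 1" q] le Suc.prems less by (auto simp: algebra_simps)
    obtain c2 where c2: "\<And>k. k \<in> set columns \<Longrightarrow> walks (p, q + 1) k = (\<Sum>u\<in>{p..int t}. c2 u * walks (u, 2*int t + 1 - u) k)"
        "c2 p = 1"
      using Suc.hyps(1)[of p "q + 1"] le Suc.prems less by (auto simp: algebra_simps)
    let ?c = "\<lambda>u. (if u = p then 0 else c1 u) + c2 u"
    have "walks (p, q) k = (\<Sum>u\<in>{p..int t}. ?c u * walks (u, 2*int t + 1 - u) k)" if k: "k \<in> set columns" for k
    proof -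
      have "p + q < N + (int t + int a - int k)"
        using Suc.hyps(2) k y_less by (auto simp: columns_iff N_def)
      then have "walks (p, q) k = walks (p + 1, q) k + walks (p, q + 1) k" by (rule walks_pascal)
      also have "walks (p + 1, q) k = (\<Sum>u\<in>{p..int t}. (if u = p then 0 else c1 u) * walks (u, 2*int t + 1 - u) k)"
        unfolding c1[OF k] by (rule sum.mono_neutral_cong_left) auto
      finally show ?thesis unfolding c2(1)[OF k] by (simp add: sum.distrib distrib_right)
    qed
    then show ?thesis using c2(2) less by (intro exI[of _ ?c]) auto
  qed
qed

text \<open>Each path may be prolonged backwards to the wall of the wedge: in terms of the determinant this is
  a unitriangular change of rows, after which the entries are ballot numbers.\<close>

lemma dt_wall:
  "dt walks (map (\<lambda>i. (int t - int i, int t - int i + 1)) [0..<t]) columns =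
   dt walks (map (\<lambda>i. (int t - int i, int t + 1 + int i)) [0..<t]) columns"
proof -
  have "\<forall>i\<in>{..<t}. \<exists>c. (\<forall>k\<in>set columns. walks (int t - int i, int t - int i + 1) k =
      (\<Sum>u\<in>{int t - int i..int t}. c u * walks (u, 2*int t + 1 - u) k)) \<and> c (int t - int i) = (1 :: rat)"
    using walks_expand[of "int t - int i" "int t - int i + 1" for i] by force
  from bchoice[OF this] obtain c where c: "\<And>i k. i < t \<Longrightarrow> k \<in> set columns \<Longrightarrow> walks (int t - int i, int t - int i + 1) k =
      (\<Sum>u\<in>{int t - int i..int t}. c i u * walks (u, 2*int t + 1 - u) k)"
    and c1: "\<And>i. i < t \<Longrightarrow> c i (int t - int i) = (1 :: rat)"
    by blast
  have len: "length columns = t" using y_less by (simp add: columns_def)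
  \<comment> \<open>The index \<open>j\<close> stands for \<open>u = int t - int j\<close>, so the
    range \<open>u \<ge> int t - int i\<close> becomes \<open>j \<le> i\<close> and \<open>C\<close>
    is lower unitriangular.\<close>
  define C where "C = mat t t (\<lambda>(i,j). if j \<le> i then c i (int t - int j) else 0)"
  define M where "M = mat t t (\<lambda>(i,j). walks (int t - int i, int t + 1 + int i) (columns ! j))"
  have "det C = prod_list (diag_mat C)"
    by (rule det_lower_triangular[of t]) (auto simp: C_def)
  also have "diag_mat C = map (\<lambda>_. 1) [0..<t]"
    unfolding diag_mat_def by (auto simp: C_def c1)
  finally have "det C = 1" by (simp add: map_replicate_const)
  have "mat t t (\<lambda>(i,j). walks (int t - int i, int t - int i + 1) (columns ! j)) = C * M"
  proof (intro eq_matI)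
    fix i j assume "i < dim_row (C * M)" "j < dim_col (C * M)"
    then have ij: "i < t" "j < t" by (auto simp: C_def M_def)
    have "walks (int t - int i, int t - int i + 1) (columns ! j) =
      (\<Sum>u\<in>{int t - int i..int t}. c i u * walks (u, 2*int t + 1 - u) (columns ! j))"
      using ij len by (intro c) auto
    also have "\<dots> = (\<Sum>m\<in>{0..i}. c i (int t - int m) * walks (int t - int m, int t + 1 + int m) (columns ! j))"
      by (rule sum.reindex_bij_witness[of _ "\<lambda>m. int t - int m" "\<lambda>u. nat (int t - u)"])
         (use ij in \<open>auto simp: algebra_simps\<close>)
    also have "\<dots> = (\<Sum>m\<in>{0..<t}. C $$ (i, m) * M $$ (m, j))"
      by (rule sum.mono_neutral_cong_left) (use ij in \<open>auto simp: C_def M_def\<close>)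
    also have "\<dots> = (C * M) $$ (i, j)"
      using ij by (simp add: C_def M_def scalar_prod_def)
    finally show "mat t t (\<lambda>(i,j). walks (int t - int i, int t - int i + 1) (columns ! j)) $$ (i, j) = (C * M) $$ (i, j)"
      using ij by simp
  qed (auto simp: C_def M_def)
  moreover have "det (C * M) = det C * det M"
    by (rule det_mult[of _ t]) (auto simp: C_def M_def)
  ultimately have "det (mat t t (\<lambda>(i,j). walks (int t - int i, int t - int i + 1) (columns ! j))) = det M"
    using \<open>det C = 1\<close> by simp
  moreover have "dt f [0..<t] columns = det (mat t t (\<lambda>(i,j). f i (columns ! j)))" for f
    unfolding dt_def by (intro arg_cong[of _ _ det] eq_matI) auto
  ultimately show ?thesis by (simp add: dt_map_rows M_def)
qed

text \<open>The coordinates of a label next to the wall differ by one, so the two binomial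
  coefficients have consecutive lower indices and their difference is a ballot number.\<close>

lemma walks_ballot:
  assumes "i < t" "k < t + a"
  shows "walks (int t - int i, int t - int i + 1) k = ballot x (t + 2*a - 1 + i) k"
proof -
  define R where "R = t + 2*a - 1 + i"
  have R: "int R = int t + 2*int a - 1 + int i" using assms by (simp add: R_def)
  have n: "N + (int t + int a - int k) - (int t - int i + (int t - int i + 1)) = 2*int R + int x + 1 - int k"
    using R by (simp add: N_def)
  have k: "2*(int t + int a - int k) - 1 - (int t - int i) = int R - 2*int k"
     "2*(int t + int a - int k) - 1 - (int t - int i + 1) = int R - 2*int k - 1"
    using R by simp_all
  have "walks (int t - int i, int t - int i + 1) k =
      ibin (2*int R + int x + 1 - int k) (int R - 2*int k) - ibin (2*int R + int x + 1 - int k) (int R - 2*int k - 1)"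
    unfolding walks_def level_def fst_conv snd_conv n k ..
  also have "\<dots> = ballot x R k"
  proof (cases "2 * k \<le> R")
    case True
    have "ibin (2*int R + int x + 1 - int k) (int R - 2*int k) - ibin (2*int R + int x + 1 - int k) (int R - 2*int k - 1)
      = of_nat ((2*R + x + 1 - k) + 1 - 2 * (R - 2*k)) * fact (2*R + x + 1 - k) /
        (fact (R - 2*k) * fact ((2*R + x + 1 - k) + 1 - (R - 2*k)))"
      by (rule ibin_diff) (use True in auto)
    also have "(2*R + x + 1 - k) + 1 - 2 * (R - 2*k) = x + 2 + 3*k" using True by simp
    also have "(2*R + x + 1 - k) + 1 - (R - 2*k) = R + x + 2 + k" using True by simp
    finally show ?thesis using True by (simp add: ballot_def)
  qed (auto simp: ibin_def ballot_def)
  finally show ?thesis by (simp add: R_def)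
qed

theorem count_chamber_ballot:
  "of_nat (tiling_count (chamber t y a x)) = gap_form y (t - y) a x"
proof -
  have len: "length columns = t" using y_less by (simp add: columns_def)
  have "dt walks (map (\<lambda>i. (int t - int i, int t - int i + 1)) [0..<t]) columns =
      dt (ballot x) [t + 2*a - 1..<t + 2*a - 1 + t] columns"
  proof (rule dt_cong)
    fix i j assume ij: "i < length columns" "j < length columns"
    then have "columns ! j < t + a" using columns_iff[of "columns ! j"] y_less by force
    then show "walks (map (\<lambda>i. (int t - int i, int t - int i + 1)) [0..<t] ! i) (columns ! j) =
        ballot x ([t + 2*a - 1..<t + 2*a - 1 + t] ! i) (columns ! j)"
      using ij len walks_ballot[of i "columns ! j"] by simp
  qed (use len in auto)
  also have "\<dots> = gap_form y (t - y) a x"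
    unfolding columns_def by (rule gap_det) (use y_less in auto)
  finally show ?thesis using count_chamber dt_wall by simp
qed

end

section \<open>Symmetric tilings\<close>

definition coord_perms :: "(tri \<Rightarrow> tri) set" where
  "coord_perms = {\<lambda>(a,b,c). (a,b,c), \<lambda>(a,b,c). (a,c,b), \<lambda>(a,b,c). (b,a,c),
     \<lambda>(a,b,c). (b,c,a), \<lambda>(a,b,c). (c,a,b), \<lambda>(a,b,c). (c,b,a)}"

lemma coord_perms_cases:
  assumes "g \<in> coord_perms"
  obtains "\<And>a b c. g (a,b,c) = (a,b,c)" | "\<And>a b c. g (a,b,c) = (a,c,b)" | "\<And>a b c. g (a,b,c) = (b,a,c)"
    | "\<And>a b c. g (a,b,c) = (b,c,a)" | "\<And>a b c. g (a,b,c) = (c,a,b)" | "\<And>a b c. g (a,b,c) = (c,b,a)"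
  using assms unfolding coord_perms_def by fastforce

lemma coord_perm_inverse:
  assumes "g \<in> coord_perms"
  obtains h where "h \<in> coord_perms" "\<And>u. h (g u) = u" "\<And>u. g (h u) = u"
proof -
  have "\<forall>g\<in>coord_perms. \<exists>h\<in>coord_perms. (\<forall>u. h (g u) = u) \<and> (\<forall>u. g (h u) = u)"
    unfolding coord_perms_def by simp
  then show ?thesis using assms that by blast
qed

lemma coord_perm_compose:
  assumes "g \<in> coord_perms"
  shows "rot120 \<circ> g \<in> coord_perms" "vrefl \<circ> g \<in> coord_perms"
  using assms unfolding coord_perms_def by (auto simp: rot120_def vrefl_def fun_eq_iff)

lemma coord_perm_adj: "g \<in> coord_perms \<Longrightarrow> adj (g p) (g q) \<longleftrightarrow> adj p q"
  by (cases p; cases q; erule coord_perms_cases) (auto simp: adj_def)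

definition nondec :: "tri \<Rightarrow> bool" where
  "nondec u = (case u of (a,b,c) \<Rightarrow> a \<le> b \<and> b \<le> c)"

definition incr :: "tri \<Rightarrow> bool" where
  "incr u = (case u of (a,b,c) \<Rightarrow> a < b \<and> b < c)"

definition off_axes :: "tri \<Rightarrow> bool" where
  "off_axes u = (case u of (a,b,c) \<Rightarrow> a \<noteq> b \<and> b \<noteq> c \<and> a \<noteq> c)"

lemma incr_iff: "incr u \<longleftrightarrow> nondec u \<and> off_axes u"
  by (cases u) (auto simp: incr_def nondec_def off_axes_def)

lemma coord_perm_off_axes: "g \<in> coord_perms \<Longrightarrow> off_axes (g u) \<longleftrightarrow> off_axes u"
  by (cases u; erule coord_perms_cases) (auto simp: off_axes_def)

text \<open>The difference of two coordinates changes by at most one between adjacent triangles, so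
  it never has opposite strict signs in \<open>p\<close> and \<open>q\<close>. Sorting the sums of
  corresponding coordinates sorts both.\<close>

lemma coord_perm_sorting:
  assumes "adj p q"
  obtains g where "g \<in> coord_perms" "nondec (g p)" "nondec (g q)"
proof -
  obtain p1 p2 p3 q1 q2 q3 where pq: "p = (p1,p2,p3)" "q = (q1,q2,q3)" by (cases p; cases q)
  have close: "p1 + q1 \<le> p2 + q2 \<Longrightarrow> p1 \<le> p2 \<and> q1 \<le> q2" "p2 + q2 \<le> p1 + q1 \<Longrightarrow> p2 \<le> p1 \<and> q2 \<le> q1"
    "p1 + q1 \<le> p3 + q3 \<Longrightarrow> p1 \<le> p3 \<and> q1 \<le> q3" "p3 + q3 \<le> p1 + q1 \<Longrightarrow> p3 \<le> p1 \<and> q3 \<le> q1"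
    "p2 + q2 \<le> p3 + q3 \<Longrightarrow> p2 \<le> p3 \<and> q2 \<le> q3" "p3 + q3 \<le> p2 + q2 \<Longrightarrow> p3 \<le> p2 \<and> q3 \<le> q2"
    using assms unfolding pq adj_def by auto
  have "\<exists>g\<in>coord_perms. nondec (g p) \<and> nondec (g q)"
    unfolding coord_perms_def nondec_def pq
    using close linear[of "p1 + q1" "p2 + q2"] linear[of "p1 + q1" "p3 + q3"] linear[of "p2 + q2" "p3 + q3"]
    by simp blast
  then show ?thesis using that by blast
qed

lemma coord_perm_sorting_single:
  obtains g where "g \<in> coord_perms" "nondec (g p)"
proof -
  obtain p1 p2 p3 where p: "p = (p1,p2,p3)" by (cases p)
  have "adj p (p1 + 1, p2, p3)" by (simp add: p adj_def)
  then show ?thesis using coord_perm_sorting that by metis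
qed

lemma coord_perm_unique:
  assumes "g \<in> coord_perms" "h \<in> coord_perms" "incr (g u)" "incr (h u)"
  shows "g = h"
  using assms unfolding coord_perms_def by (cases u) (auto simp: incr_def)

lemma invariant_coord_perm:
  assumes "invariant_under rot120 T" "invariant_under vrefl T" "g \<in> coord_perms" "e \<in> T"
  shows "g ` e \<in> T"
proof -
  have r: "rot120 ` e \<in> T" if "e \<in> T" for e using assms(1) that by (auto simp: invariant_under_def)
  have v: "vrefl ` e \<in> T" if "e \<in> T" for e using assms(2) that by (auto simp: invariant_under_def)
  have "g \<in> {\<lambda>u. u, rot120, rot120 \<circ> rot120, vrefl, rot120 \<circ> vrefl, rot120 \<circ> rot120 \<circ> vrefl}"
    using assms(3) unfolding coord_perms_def by (auto simp: rot120_def vrefl_def fun_eq_iff)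
  moreover have "rot120 ` e \<in> T" "rot120 ` rot120 ` e \<in> T" "vrefl ` e \<in> T" "rot120 ` vrefl ` e \<in> T" "rot120 ` rot120 ` vrefl ` e \<in> T"
    using r v assms(4) by simp_all
  ultimately show ?thesis using assms(4) by (auto simp: image_comp comp_assoc)
qed

text \<open>The coordinate sum is \<open>L + 1\<close> or \<open>L + 2\<close> with \<open>L\<close>
  even, and the two other coordinates agree on an axis. Hence \<open>p\<close> is odd for
  down-pointing and even for up-pointing triangles, and the pairs are
  \<open>{2k - 1, 2k}\<close>.\<close>

definition axis_step :: "int \<Rightarrow> int" where
  "axis_step p = (if odd p then p + 1 else p - 1)"

text \<open>On a symmetry axis a symmetric tiling is forced: every triangle there is matched with the neighbour
  obtained by moving along the axis.\<close>

definition axis_partner :: "tri \<Rightarrow> tri" where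
  "axis_partner u = (case u of (a,b,c) \<Rightarrow>
     if b = c then (axis_step a, b, c) else if a = c then (a, axis_step b, c) else (a, b, axis_step c))"

lemma axis_step_twice [simp]: "axis_step (axis_step p) = p"
  by (simp add: axis_step_def)

context
  fixes t y a x :: nat
begin

abbreviation (input) "region \<equiv> regionH (2*t) y (2*a) (2*x)"
abbreviation (input) "sextant \<equiv> chamber t y a x"

lemma region_iff: "(u1,u2,u3) \<in> region \<longleftrightarrow>
    (u1 + u2 + u3 = 6*int t + 2*int x + 6*int a + 1 \<or> u1 + u2 + u3 = 6*int t + 2*int x + 6*int a + 2) \<and>
    (1 \<le> u1 \<and> 1 \<le> u2 \<and> 1 \<le> u3) \<and>
    (u1 \<le> 4*int t + 2*int x + 6*int a \<and> u2 \<le> 4*int t + 2*int x + 6*int a \<and> u3 \<le> 4*int t + 2*int x + 6*int a) \<and>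
    \<not> (2*int t + 2*int a + 1 \<le> u1 \<and> 2*int t + 2*int a + 1 \<le> u2 \<and> 2*int t + 2*int a + 1 \<le> u3) \<and>
    \<not> in_sat (2*t) y (2*a) (2*x) u1 u2 u3 \<and> \<not> in_sat (2*t) y (2*a) (2*x) u2 u3 u1 \<and>
    \<not> in_sat (2*t) y (2*a) (2*x) u3 u1 u2"
proof -
  have 3: "3 * int (2*t) + int (2*x) + 3 * int (2*a) = 6*int t + 2*int x + 6*int a"
    "6*int t + 2*int x + 6*int a - int (2*t) = 4*int t + 2*int x + 6*int a"
    "int (2*t) + int (2*a) + 1 = 2*int t + 2*int a + 1" by simp_all
  show ?thesis unfolding regionH_def Let_def mem_Collect_eq prod.case 3 by blast
qed

lemma in_sat_commute: "in_sat t' y' a' x' p q r = in_sat t' y' a' x' p r q"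
  unfolding in_sat_def by blast

lemma coord_perm_region: "g \<in> coord_perms \<Longrightarrow> g u \<in> region \<longleftrightarrow> u \<in> region"
proof -
  have s: "u1 + u3 + u2 = u1 + u2 + u3" "u2 + u3 + u1 = u1 + u2 + u3" for u1 u2 u3 :: int by simp_all
  have 1: "(u1,u2,u3) \<in> region \<longleftrightarrow> (u1,u3,u2) \<in> region" for u1 u2 u3
    unfolding region_iff s(1)[of u1 u3 u2] in_sat_commute[of _ _ _ _ u1 u3 u2]
      in_sat_commute[of _ _ _ _ u3 u2 u1] in_sat_commute[of _ _ _ _ u2 u1 u3] by blast
  have 2: "(u1,u2,u3) \<in> region \<longleftrightarrow> (u2,u3,u1) \<in> region" for u1 u2 u3
    unfolding region_iff s(2)[of u2 u3 u1] by blast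
  obtain u1 u2 u3 where u: "u = (u1,u2,u3)" by (cases u)
  have "(u1,u3,u2) \<in> region \<longleftrightarrow> (u1,u2,u3) \<in> region" "(u2,u3,u1) \<in> region \<longleftrightarrow> (u1,u2,u3) \<in> region"
    "(u2,u1,u3) \<in> region \<longleftrightarrow> (u1,u2,u3) \<in> region" "(u3,u1,u2) \<in> region \<longleftrightarrow> (u1,u2,u3) \<in> region"
    "(u3,u2,u1) \<in> region \<longleftrightarrow> (u1,u2,u3) \<in> region"
    using 1[of u1 u2 u3] 2[of u1 u2 u3] 1[of u2 u1 u3] 2[of u3 u1 u2] 1[of u3 u2 u1] by simp_all
  moreover assume "g \<in> coord_perms"
  ultimately show ?thesis
    unfolding u by (elim coord_perms_cases) (simp_all only:)
qed

lemma sextant_iff: "u \<in> sextant \<longleftrightarrow> u \<in> region \<and> incr u"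
  by (cases u) (simp add: chamber_def incr_def)

lemma not_center: "(u,u,u) \<notin> region"
proof
  assume "(u,u,u) \<in> region"
  then have "3*u = 6*int t + 2*int x + 6*int a + 1 \<or> 3*u = 6*int t + 2*int x + 6*int a + 2"
    "u \<le> 2*int t + 2*int a" by (auto simp: region_iff)
  then show False by auto
qed

text \<open>All lower bounds on the moved coordinate are odd and its upper bound is even, so no pair
  \<open>{2k - 1, 2k}\<close> is separated by the hexagon or a hole.\<close>

lemma axis_step_region:
  assumes "(p,b,b) \<in> region"
  shows "(axis_step p,b,b) \<in> region"
proof -
  define h L where "h = 2*int t + 2*int a + 1" and "L = 6*int t + 2*int x + 6*int a"
  have step: "c \<le> axis_step p \<longleftrightarrow> c \<le> p" if "odd c" for c
    using that unfolding axis_step_def by presburger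
  have step': "axis_step p \<le> c \<longleftrightarrow> p \<le> c" if "even c" for c
    using that unfolding axis_step_def by presburger
  have "p + b + b = L + 1 \<or> p + b + b = L + 2" using assms by (simp add: region_iff L_def)
  moreover have "even L" by (simp add: L_def)
  ultimately have "axis_step p + b + b = L + 1 \<or> axis_step p + b + b = L + 2"
    unfolding axis_step_def by presburger
  moreover have hole: "\<not> (h \<le> axis_step p \<and> h \<le> b)"
    using assms step[of h] by (simp add: region_iff h_def)
  moreover have "1 \<le> axis_step p" "axis_step p \<le> 4*int t + 2*int x + 6*int a"
    using assms step[of 1] step'[of "4*int t + 2*int x + 6*int a"] by (simp_all add: region_iff)
  moreover have "\<not> in_sat (2*t) y (2*a) (2*x) (axis_step p) b b"
    using assms step[of "int (2*t) - 2 * int y + 1"] by (simp add: region_iff in_sat_def)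
  moreover have "\<not> in_sat (2*t) y (2*a) (2*x) b b (axis_step p)" "\<not> in_sat (2*t) y (2*a) (2*x) b (axis_step p) b"
    using hole unfolding in_sat_def h_def by auto
  ultimately show ?thesis using assms by (simp add: region_iff L_def h_def)
qed

lemma axis_normal_form:
  assumes "u \<in> region" "\<not> off_axes u"
  obtains g p b where "g \<in> coord_perms" "u = g (p,b,b)" "(p,b,b) \<in> region" "p \<noteq> b"
    "axis_partner u = g (axis_step p,b,b)"
proof -
  obtain u1 u2 u3 where u: "u = (u1,u2,u3)" by (cases u)
  have ne: "\<not> (u1 = u2 \<and> u2 = u3)" using assms(1) not_center u by auto
  have "\<exists>g\<in>coord_perms. \<exists>p b. u = g (p,b,b) \<and> p \<noteq> b \<and> axis_partner u = g (axis_step p,b,b)"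
    using assms(2) ne unfolding u coord_perms_def off_axes_def axis_partner_def by auto
  then show ?thesis using that assms(1) coord_perm_region by metis
qed

lemma axis_partner:
  assumes "u \<in> region" "\<not> off_axes u"
  shows "axis_partner u \<in> region" "\<not> off_axes (axis_partner u)" "adj u (axis_partner u)"
    "axis_partner (axis_partner u) = u"
proof -
  obtain g p b where g: "g \<in> coord_perms" "u = g (p,b,b)" "(p,b,b) \<in> region" "p \<noteq> b"
    "axis_partner u = g (axis_step p,b,b)" using axis_normal_form[OF assms] .
  have r: "(axis_step p,b,b) \<in> region" by (rule axis_step_region[OF g(3)])
  then have ne: "axis_step p \<noteq> b" using not_center by auto
  show "axis_partner u \<in> region" using r g(1,5) coord_perm_region by simp
  show "\<not> off_axes (axis_partner u)" using g(1,5) coord_perm_off_axes by (simp add: off_axes_def)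
  show "adj u (axis_partner u)" using g(1,2,5) coord_perm_adj[OF g(1)] by (simp add: adj_def axis_step_def)
  show "axis_partner (axis_partner u) = u"
    using g(1) unfolding g(5) unfolding g(2)
    by (elim coord_perms_cases) (use ne in \<open>auto simp: axis_partner_def\<close>)
qed

lemma coord_perm_axis_partner:
  assumes "u \<in> region" "\<not> off_axes u" "g \<in> coord_perms"
  shows "axis_partner (g u) = g (axis_partner u)"
proof -
  obtain u1 u2 u3 where u: "u = (u1,u2,u3)" by (cases u)
  have ne: "\<not> (u1 = u2 \<and> u2 = u3)" using assms(1) not_center u by auto
  show ?thesis using assms(3)
    by (elim coord_perms_cases) (use ne assms(2) in \<open>auto simp: u axis_partner_def off_axes_def\<close>)
qed

definition symmetric_tilings :: "tri set set set" where
  "symmetric_tilings = {T \<in> lozenge_tilings region. invariant_under rot120 T \<and> invariant_under vrefl T}"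

lemma symmetric_coord_perm: "T \<in> symmetric_tilings \<Longrightarrow> g \<in> coord_perms \<Longrightarrow> e \<in> T \<Longrightarrow> g ` e \<in> T"
  using invariant_coord_perm by (simp add: symmetric_tilings_def)

text \<open>The reflection in the axis fixes the triangle, hence its lozenge and the other triangle
  of that lozenge, which must then lie on the axis too. Parity leaves one direction.\<close>

lemma axis_forced:
  assumes T: "T \<in> symmetric_tilings" and u: "u \<in> region" "\<not> off_axes u"
  shows "{u, axis_partner u} \<in> T"
proof -
  have TR: "T \<in> lozenge_tilings region" using T by (simp add: symmetric_tilings_def)
  obtain g p b where g: "g \<in> coord_perms" "u = g (p,b,b)" "(p,b,b) \<in> region" "p \<noteq> b"
    "axis_partner u = g (axis_step p,b,b)" using axis_normal_form[OF u] .
  obtain e where e: "e \<in> T" "(p,b,b) \<in> e" using tilingD_cover[OF TR g(3)] by blast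
  obtain q where q: "e = {(p,b,b), q}" "q \<in> region" "adj (p,b,b) q" using tilingD_edge_at[OF TR e] by blast
  have "(\<lambda>(a,b,c). (a,c,b)) \<in> coord_perms" by (simp add: coord_perms_def)
  from symmetric_coord_perm[OF T this e(1)] have "{(p,b,b), (\<lambda>(a,b,c). (a,c,b)) q} \<in> T"
    by (simp add: q)
  then have "{(p,b,b), (\<lambda>(a,b,c). (a,c,b)) q} = {(p,b,b), q}"
    using tiling_unique[OF TR _ e(1) _ e(2)] q(1) by blast
  moreover obtain q1 q2 q3 where q': "q = (q1,q2,q3)" by (cases q)
  ultimately have "q2 = q3" by (auto simp: doubleton_eq_iff)
  then have b: "q2 = b" "q3 = b" and "q1 = p + 1 \<or> q1 = p - 1"
    using q(3) unfolding q' adj_def by auto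
  moreover have "p + b + b = 2*(3*int t + int x + 3*int a) + 1 \<or> p + b + b = 2*(3*int t + int x + 3*int a) + 2"
    "q1 + b + b = 2*(3*int t + int x + 3*int a) + 1 \<or> q1 + b + b = 2*(3*int t + int x + 3*int a) + 2"
    using q(2) g(3) unfolding q' region_iff b by auto
  ultimately have "q1 = axis_step p" unfolding axis_step_def by presburger
  then have "q = (axis_step p, b, b)" by (simp add: q' b)
  then have "{(p,b,b), (axis_step p,b,b)} \<in> T" using e(1) q(1) by simp
  from symmetric_coord_perm[OF T g(1) this] show ?thesis using g by simp
qed

text \<open>Triangles on the axes are joined among themselves, so no lozenge at a triangle of the
  sextant touches an axis; and adjacent triangles off the axes have their coordinates in the same
  order.\<close>

lemma restrict_tiling:
  assumes T: "T \<in> symmetric_tilings"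
  shows "{e \<in> T. e \<subseteq> sextant} \<in> lozenge_tilings sextant"
proof (rule tilingI)
  have TR: "T \<in> lozenge_tilings region" using T by (simp add: symmetric_tilings_def)
  show "\<exists>p q. e = {p, q} \<and> p \<in> sextant \<and> q \<in> sextant \<and> adj p q" if "e \<in> {e \<in> T. e \<subseteq> sextant}" for e
    using tilingD_edge[OF TR, of e] that by blast
  show "e = e'" if "e \<in> {e \<in> T. e \<subseteq> sextant}" "e' \<in> {e \<in> T. e \<subseteq> sextant}" "p \<in> e" "p \<in> e'" for p e e'
    using tiling_unique[OF TR, of e e' p] that by blast
  fix p assume p: "p \<in> sextant"
  then obtain e where e: "e \<in> T" "p \<in> e" using tilingD_cover[OF TR, of p] sextant_iff by blast
  obtain q where q: "e = {p, q}" "q \<in> region" "adj p q" using tilingD_edge_at[OF TR e] by blast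
  have "off_axes q"
  proof (rule ccontr)
    assume n: "\<not> off_axes q"
    have "{q, axis_partner q} = e"
      by (rule tiling_unique[OF TR axis_forced[OF T q(2) n] e(1)]) (use q in auto)
    then have "p = axis_partner q" using q adj_irrefl by (auto simp: doubleton_eq_iff)
    then show False using axis_partner(2)[OF q(2) n] p by (simp add: sextant_iff incr_iff)
  qed
  moreover have "incr q"
    using p q(3) \<open>off_axes q\<close> unfolding sextant_iff incr_def off_axes_def adj_def by (auto split: prod.splits)
  ultimately have "q \<in> sextant" using q(2) by (simp add: sextant_iff)
  then show "\<exists>e\<in>{e \<in> T. e \<subseteq> sextant}. p \<in> e" using e q p by blast
qed

text \<open>A lozenge off the axes is moved into the sextant by some permutation of the coordinates
  and back by its inverse; a lozenge meeting an axis is forced in both tilings.\<close>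

lemma restrict_inj:
  assumes T: "T \<in> symmetric_tilings" and T': "T' \<in> symmetric_tilings"
    and eq: "{e \<in> T. e \<subseteq> sextant} = {e \<in> T'. e \<subseteq> sextant}"
  shows "T \<subseteq> T'"
proof
  have TR: "T \<in> lozenge_tilings region" using T by (simp add: symmetric_tilings_def)
  fix e assume e: "e \<in> T"
  obtain p q where pq: "e = {p, q}" "p \<in> region" "q \<in> region" "adj p q" using tilingD_edge[OF TR e] by blast
  have axis: "e \<in> T'" if u: "u \<in> e" "\<not> off_axes u" for u
  proof -
    have "u \<in> region" using u pq by auto
    then have "{u, axis_partner u} = e" "{u, axis_partner u} \<in> T'"
      using tiling_unique[OF TR axis_forced[OF T _ u(2)] e, of u] axis_forced[OF T' _ u(2)] u by auto
    then show ?thesis by simp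
  qed
  show "e \<in> T'"
  proof (cases "off_axes p \<and> off_axes q")
    case True
    obtain g where g: "g \<in> coord_perms" "nondec (g p)" "nondec (g q)" using coord_perm_sorting[OF pq(4)] .
    obtain h where h: "h \<in> coord_perms" "\<And>u. h (g u) = u" using coord_perm_inverse[OF g(1)] by blast
    have "g ` e \<subseteq> sextant"
      using g True pq coord_perm_off_axes[OF g(1)] coord_perm_region[OF g(1)] by (auto simp: sextant_iff incr_iff)
    then have "g ` e \<in> T'" using symmetric_coord_perm[OF T g(1) e] eq by blast
    from symmetric_coord_perm[OF T' h(1) this] show ?thesis by (simp add: image_image h(2))
  next
    case False
    then show ?thesis using axis[of p] axis[of q] pq(1) by auto
  qed
qed

definition extend :: "tri set set \<Rightarrow> tri set set" where
  "extend S = {g ` e | g e. g \<in> coord_perms \<and> e \<in> S} \<union> {{u, axis_partner u} | u. u \<in> region \<and> \<not> off_axes u}"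

lemma extend_symmetric:
  assumes S: "S \<in> lozenge_tilings sextant"
  shows "extend S \<in> symmetric_tilings"
proof -
  have edge: "\<exists>p q. e = {p, q} \<and> p \<in> sextant \<and> q \<in> sextant \<and> adj p q" if "e \<in> S" for e
    by (rule tilingD_edge[OF S that])
  have off: "off_axes u" if "e \<in> S" "g \<in> coord_perms" "u \<in> g ` e" for e g u
    using edge[OF that(1)] that coord_perm_off_axes[OF that(2)] by (auto simp: sextant_iff incr_iff)
  have "extend S \<in> lozenge_tilings region"
  proof (rule tilingI)
    fix e assume "e \<in> extend S"
    then consider g e' where "g \<in> coord_perms" "e' \<in> S" "e = g ` e'"
      | u where "u \<in> region" "\<not> off_axes u" "e = {u, axis_partner u}" by (auto simp: extend_def)
    then show "\<exists>p q. e = {p, q} \<and> p \<in> region \<and> q \<in> region \<and> adj p q"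
    proof cases
      case 1
      obtain p q where "e' = {p, q}" "p \<in> sextant" "q \<in> sextant" "adj p q" using edge[OF 1(2)] by blast
      then have "e = {g p, g q}" "g p \<in> region" "g q \<in> region" "adj (g p) (g q)"
        using 1 coord_perm_adj[OF 1(1)] coord_perm_region[OF 1(1)] by (auto simp: sextant_iff)
      then show ?thesis by blast
    next
      case 2
      then show ?thesis using axis_partner[OF 2(1,2)] by blast
    qed
  next
    fix p assume p: "p \<in> region"
    show "\<exists>e\<in>extend S. p \<in> e"
    proof (cases "off_axes p")
      case True
      obtain g where g: "g \<in> coord_perms" "nondec (g p)" using coord_perm_sorting_single .
      obtain h where h: "h \<in> coord_perms" "\<And>u. h (g u) = u" using coord_perm_inverse[OF g(1)] by blast
      have "g p \<in> sextant" using g True p coord_perm_off_axes[OF g(1)] coord_perm_region[OF g(1)] by (simp add: sextant_iff incr_iff)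
      then obtain e where "e \<in> S" "g p \<in> e" using tilingD_cover[OF S] by blast
      then have "h ` e \<in> extend S" "h (g p) \<in> h ` e" using h(1) unfolding extend_def by blast+
      then show ?thesis using h(2) by auto
    next
      case False
      then have "{p, axis_partner p} \<in> extend S" using p unfolding extend_def by blast
      then show ?thesis by blast
    qed
  next
    fix p e e' assume e: "e \<in> extend S" "e' \<in> extend S" "p \<in> e" "p \<in> e'"
    show "e = e'"
    proof (cases "off_axes p")
      case True
      have "\<exists>g d. g \<in> coord_perms \<and> d \<in> S \<and> e = g ` d" if e: "e \<in> extend S" "p \<in> e" for e
      proof (rule ccontr)
        assume "\<not> ?thesis"
        then obtain u where u: "u \<in> region" "\<not> off_axes u" "e = {u, axis_partner u}"
          using e(1) unfolding extend_def by blast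
        then show False using axis_partner(2)[OF u(1,2)] True e(2) by blast
      qed
      then obtain g d g' d' where g: "g \<in> coord_perms" "d \<in> S" "e = g ` d" "g' \<in> coord_perms" "d' \<in> S" "e' = g' ` d'"
        using e by meson
      obtain h where h: "h \<in> coord_perms" "\<And>u. h (g u) = u" "\<And>u. g (h u) = u" using coord_perm_inverse[OF g(1)] by blast
      obtain h' where h': "h' \<in> coord_perms" "\<And>u. h' (g' u) = u" "\<And>u. g' (h' u) = u" using coord_perm_inverse[OF g(4)] by blast
      obtain r r' where r: "r \<in> d" "p = g r" "r' \<in> d'" "p = g' r'" using e(3,4) g(3,6) by blast
      have in_d: "h p \<in> d" using r(1) h(2)[of r] unfolding r(2) by simp
      have in_d': "h' p \<in> d'" using r(3) h'(2)[of r'] unfolding r(4) by simp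
      \<comment> \<open>Only one permutation makes the distinct coordinates of \<open>p\<close>
        increasing, so both lozenges are images under the same permutation and the uniqueness inside
        the sextant applies.\<close>
      have "incr (h p)" "incr (h' p)"
        using in_d in_d' edge[OF g(2)] edge[OF g(5)] sextant_iff by blast+
      then have "h = h'" using coord_perm_unique h(1) h'(1) by blast
      then have "g u = g' u" for u using h(3)[of "g' u"] h'(2)[of u] by simp
      then have "g = g'" by (rule ext)
      moreover have "d = d'" using tiling_unique[OF S g(2,5)] in_d in_d' \<open>h = h'\<close> by blast
      ultimately show ?thesis using g by simp
    next
      case False
      have "e = {p, axis_partner p}" if e: "e \<in> extend S" "p \<in> e" for e
      proof -
        have "\<not> (\<exists>g d. g \<in> coord_perms \<and> d \<in> S \<and> e = g ` d)" using off e(2) False by blast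
        then obtain u where u: "u \<in> region" "\<not> off_axes u" "e = {u, axis_partner u}"
          using e(1) unfolding extend_def by blast
        then show ?thesis using axis_partner(4)[OF u(1,2)] e(2) by auto
      qed
      then show ?thesis using e by metis
    qed
  qed
  moreover have closed: "f ` e \<in> extend S" if f: "f \<in> {rot120, vrefl}" and "e \<in> extend S" for f e
  proof -
    from that(2) consider g e' where "g \<in> coord_perms" "e' \<in> S" "e = g ` e'"
      | u where "u \<in> region" "\<not> off_axes u" "e = {u, axis_partner u}" by (auto simp: extend_def)
    then show ?thesis
    proof cases
      case 1
      then have "f \<circ> g \<in> coord_perms" "f ` e = (f \<circ> g) ` e'"
        using coord_perm_compose f by (auto simp: image_comp)
      then show ?thesis using 1(2) by (auto simp: extend_def)
    next
      case 2
      have fG: "f \<in> coord_perms" using f by (auto simp: coord_perms_def rot120_def vrefl_def fun_eq_iff)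
      have "f ` e = {f u, axis_partner (f u)}" "f u \<in> region" "\<not> off_axes (f u)"
        using 2 coord_perm_axis_partner[OF 2(1,2) fG] coord_perm_region[OF fG] coord_perm_off_axes[OF fG] by auto
      then show ?thesis unfolding extend_def by blast
    qed
  qed
  moreover have "invariant_under rot120 (extend S)"
  proof -
    have "rot120 (rot120 (rot120 u)) = u" for u by (cases u) (simp add: rot120_def)
    then have "rot120 ` rot120 ` rot120 ` e = e" for e by (simp add: image_image)
    then have "e \<in> (\<lambda>e. rot120 ` e) ` extend S" if "e \<in> extend S" for e
      using that closed by (metis image_eqI insertI1)
    then show ?thesis using closed by (auto simp: invariant_under_def)
  qed
  moreover have "invariant_under vrefl (extend S)"
  proof -
    have "vrefl (vrefl u) = u" for u by (cases u) (simp add: vrefl_def)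
    then have "vrefl ` vrefl ` e = e" for e by (simp add: image_image)
    then have "e \<in> (\<lambda>e. vrefl ` e) ` extend S" if "e \<in> extend S" for e
      using that closed by (metis image_eqI insertI1 insertI2)
    then show ?thesis using closed by (auto simp: invariant_under_def)
  qed
  ultimately show ?thesis by (simp add: symmetric_tilings_def)
qed

lemma restrict_extend:
  assumes S: "S \<in> lozenge_tilings sextant"
  shows "{e \<in> extend S. e \<subseteq> sextant} = S"
proof (intro equalityI subsetI)
  fix e assume "e \<in> {e \<in> extend S. e \<subseteq> sextant}"
  then have e: "e \<in> extend S" "e \<subseteq> sextant" by auto
  then obtain g d where g: "g \<in> coord_perms" "d \<in> S" "e = g ` d"
    by (auto simp: extend_def sextant_iff incr_iff)
  obtain p q where d: "d = {p, q}" "p \<in> sextant" using tilingD_edge[OF S g(2)] by blast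
  have "incr (g p)" "incr p" using d e g by (auto simp: sextant_iff)
  moreover have "(\<lambda>(a,b,c). (a,b,c)) \<in> coord_perms" by (simp add: coord_perms_def)
  ultimately have "g = (\<lambda>(a,b,c). (a,b,c))" using coord_perm_unique[OF g(1)] by simp
  then show "e \<in> S" using g by simp
next
  fix e assume e: "e \<in> S"
  have "(\<lambda>(a,b,c). (a,b,c)) \<in> coord_perms" by (simp add: coord_perms_def)
  moreover have "e = (\<lambda>(a,b,c). (a,b,c)) ` e" by simp
  ultimately have "e \<in> extend S" using e unfolding extend_def by blast
  then show "e \<in> {e \<in> extend S. e \<subseteq> sextant}" using tilingD_edge[OF S e] by auto
qed

theorem CSTC_eq_count_chamber: "CSTC region = tiling_count sextant"
proof -
  have "bij_betw (\<lambda>T. {e \<in> T. e \<subseteq> sextant}) symmetric_tilings (lozenge_tilings sextant)"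
  proof (rule bij_betw_imageI)
    show "inj_on (\<lambda>T. {e \<in> T. e \<subseteq> sextant}) symmetric_tilings"
      using restrict_inj by (intro inj_onI equalityI) simp_all
    show "(\<lambda>T. {e \<in> T. e \<subseteq> sextant}) ` symmetric_tilings = lozenge_tilings sextant"
      using restrict_tiling restrict_extend extend_symmetric by (auto simp: image_iff) metis
  qed
  then show ?thesis by (simp add: CSTC_def symmetric_tilings_def bij_betw_same_card)
qed

end

theorem theorem2p3:
  fixes y t a x :: nat
  assumes "y < t"
  shows "of_nat (CSTC (regionH (2 * t) y (2 * a) (2 * x))) = P1 (x + 1) y (t - y - 1) a"
proof -
  interpret wedge t y a x by unfold_locales (rule assms)
  have "t - y = (t - y - 1) + 1" using assms by simp
  then have "gap_form y (t - y) a x = P1 (x + 1) y (t - y - 1) a"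
    using gap_form_eq_P1[of y "t - y - 1" a x] by simp
  then show ?thesis
    using count_chamber_ballot by (simp only: CSTC_eq_count_chamber)
qed

end
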